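(* Let $H$ be a Hilbert space and let $A:D(A)\to H$ be a positive self-adjoint operator with compact inverse, with eigenvalues $0<\lambda_1\le\lambda_2\le\cdots$ (counted with multiplicity) and corresponding orthonormal basis of eigenvectors $\{e_n\}_{n\ge1}$. Assume $$L_0:=\sup_{n\in\mathbb N}(\lambda_{n+1}-\lambda_n)<\infty .$$ Then for every $L>\max\{\tfrac12 L_0,\lambda_1\}$ there exists a nonlinear operator $F\in C^\infty(H,H)$ such that: 1) $F$ is globally Lipschitz on $H$ with Lipschitz constant $L$: $\|F(u)-F(v)\|_H\le L\|u-v\|_H$ for all $u,v\in H$; 2) the equation $\partial_t u+Au=F(u)$, $u|_{t=0}=u_0\in H$, possesses a compact global attractor $\mathcal A$ in $H$; 3) there is no finite-dimensional invariant $C^1$-submanifold of $H$ containing the global attractor $\mathcal A$.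
   Context: The equation $\partial_t u+Au=F(u)$ generates a solution semigroup $S(t):H\to H$, $t\ge0$. A global attractor is a compact set $\mathcal A\subset H$ which is strictly invariant ($S(t)\mathcal A=\mathcal A$ for all $t\ge0$) and attracts the images of all bounded subsets of $H$ as $t\to\infty$. An invariant submanifold $\mathcal M$ is one with $S(t)\mathcal M\subset\mathcal M$ for $t\ge 0$. *)

theory Defs
  imports "HOL-Analysis.Analysis"
begin

text \<open>Spectral data of A: orthonormal basis e of eigenvectors, eigenvalues lam
  (index 0 corresponds to the paper's index 1).  A positive self-adjoint operator with
  compact inverse and eigenbasis e, eigenvalues lam, is exactly determined by these data.\<close>

definition spectral_data :: "(nat \<Rightarrow> 'a::{real_inner,complete_space}) \<Rightarrow> (nat \<Rightarrow> real) \<Rightarrow> bool" where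
  "spectral_data e lam \<longleftrightarrow>
     (\<forall>i j. e i \<bullet> e j = (if i = j then 1 else 0)) \<and>
     closure (span (range e)) = UNIV \<and>
     0 < lam 0 \<and> mono lam \<and> filterlim lam at_top sequentially"

definition op_dom :: "(nat \<Rightarrow> 'a::{real_inner,complete_space}) \<Rightarrow> (nat \<Rightarrow> real) \<Rightarrow> 'a set" where
  "op_dom e lam = {u. summable (\<lambda>n. (lam n * (u \<bullet> e n))\<^sup>2)}"

definition op_A :: "(nat \<Rightarrow> 'a::{real_inner,complete_space}) \<Rightarrow> (nat \<Rightarrow> real) \<Rightarrow> 'a \<Rightarrow> 'a" where
  "op_A e lam u = (\<Sum>n. (lam n * (u \<bullet> e n)) *\<^sub>R e n)"

text \<open>Mild solution of  u_t + A u = F(u),  u(0) = u0, on [0,\<infinity>), written coordinatewise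
  in the eigenbasis (variation of constants formula).  For t<0 the function is normalised
  to u0 so that uniqueness makes sense for functions on all of the reals.\<close>

definition mild_solution ::
  "(nat \<Rightarrow> 'a::{real_inner,complete_space}) \<Rightarrow> (nat \<Rightarrow> real) \<Rightarrow> ('a \<Rightarrow> 'a) \<Rightarrow> 'a \<Rightarrow> (real \<Rightarrow> 'a) \<Rightarrow> bool" where
  "mild_solution e lam F u0 u \<longleftrightarrow>
     continuous_on {0..} u \<and> (\<forall>t<0. u t = u0) \<and>
     (\<forall>t\<ge>0. \<forall>n. u t \<bullet> e n =
        exp (- lam n * t) * (u0 \<bullet> e n)
        + integral {0..t} (\<lambda>s. exp (- lam n * (t - s)) * (F (u s) \<bullet> e n)))"

definition well_posed ::
  "(nat \<Rightarrow> 'a::{real_inner,complete_space}) \<Rightarrow> (nat \<Rightarrow> real) \<Rightarrow> ('a \<Rightarrow> 'a) \<Rightarrow> bool" where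
  "well_posed e lam F \<longleftrightarrow> (\<forall>u0. \<exists>!u. mild_solution e lam F u0 u)"

definition solution_semigroup ::
  "(nat \<Rightarrow> 'a::{real_inner,complete_space}) \<Rightarrow> (nat \<Rightarrow> real) \<Rightarrow> ('a \<Rightarrow> 'a) \<Rightarrow> real \<Rightarrow> 'a \<Rightarrow> 'a" where
  "solution_semigroup e lam F t u0 = (THE u. mild_solution e lam F u0 u) t"

definition global_attractor :: "(real \<Rightarrow> 'a::metric_space \<Rightarrow> 'a) \<Rightarrow> 'a set \<Rightarrow> bool" where
  "global_attractor S \<A> \<longleftrightarrow>
     compact \<A> \<and> \<A> \<noteq> {} \<and>
     (\<forall>t\<ge>0. S t ` \<A> = \<A>) \<and>
     (\<forall>B. bounded B \<longrightarrow>
        (\<forall>\<epsilon>>0. \<exists>T. \<forall>t\<ge>T. \<forall>b\<in>B. infdist (S t b) \<A> < \<epsilon>))"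

definition bounded_multilinear_k :: "nat \<Rightarrow> ('a::real_normed_vector list \<Rightarrow> 'b::real_normed_vector) \<Rightarrow> bool" where
  "bounded_multilinear_k k M \<longleftrightarrow>
     (\<forall>xs ys. length xs + length ys + 1 = k \<longrightarrow> linear (\<lambda>v. M (xs @ v # ys))) \<and>
     (\<exists>C. \<forall>vs. length vs = k \<longrightarrow> norm (M vs) \<le> C * prod_list (map norm vs))"

text \<open>C^\<infinity> in the Frechet sense: D k x is the k-th Frechet derivative at x, a bounded
  k-multilinear map, and D (k+1) is the Frechet derivative of D k (in operator norm).\<close>

definition smooth_map :: "('a::real_normed_vector \<Rightarrow> 'b::real_normed_vector) \<Rightarrow> bool" where
  "smooth_map f \<longleftrightarrow>
     (\<exists>D :: nat \<Rightarrow> 'a \<Rightarrow> 'a list \<Rightarrow> 'b.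
        (\<forall>x. D 0 x [] = f x) \<and>
        (\<forall>k x. bounded_multilinear_k k (D k x)) \<and>
        (\<forall>k x. \<forall>\<epsilon>>0. \<exists>\<delta>>0. \<forall>h. norm h < \<delta> \<longrightarrow>
            (\<forall>vs. length vs = k \<and> (\<forall>v\<in>set vs. norm v \<le> 1) \<longrightarrow>
               norm (D k (x + h) vs - D k x vs - D (Suc k) x (h # vs)) \<le> \<epsilon> * norm h)))"

text \<open>Embedded C^1 submanifold of dimension n of H: locally the homeomorphic image of a
  relatively open subset W of an n-dimensional linear space E (a copy of R^n inside H)
  under a C^1 immersion.\<close>

definition C1_submanifold :: "nat \<Rightarrow> 'a::real_inner set \<Rightarrow> bool" where
  "C1_submanifold n M \<longleftrightarrow>
     (\<forall>p\<in>M. \<exists>V (B::'a set) W \<phi> \<psi> \<phi>'.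
        open V \<and> p \<in> V \<and>
        finite B \<and> independent B \<and> card B = n \<and>
        W \<subseteq> span B \<and> openin (top_of_set (span B)) W \<and>
        homeomorphism W (M \<inter> V) \<phi> \<psi> \<and>
        (\<forall>w\<in>W. (\<phi> has_derivative \<phi>' w) (at w within W)) \<and>
        (\<forall>w\<in>W. \<forall>v\<in>span B. \<phi>' w v = 0 \<longrightarrow> v = 0) \<and>
        (\<forall>w\<in>W. \<forall>\<epsilon>>0. \<exists>\<delta>>0. \<forall>w'\<in>W. dist w' w < \<delta> \<longrightarrow>
            (\<forall>v\<in>span B. norm v \<le> 1 \<longrightarrow> norm (\<phi>' w' v - \<phi>' w v) \<le> \<epsilon>)))"

definition invariant_set :: "(real \<Rightarrow> 'a \<Rightarrow> 'a) \<Rightarrow> 'a set \<Rightarrow> bool" where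
  "invariant_set S M \<longleftrightarrow> (\<forall>t\<ge>0. S t ` M \<subseteq> M)"

end

theory Submission
  imports Defs
begin

text \<open>Two equilibria with tangent spaces of different parity.  Write \<open>s = u \<bullet> e 0\<close>.
  Every point \<open>s e 0\<close> with \<open>-1 \<le> s \<le> 0\<close> is an equilibrium, and so is \<open>e 0\<close>; all of them lie
  in the attractor.  At \<open>e 0\<close> the linearisation couples the modes \<open>(0,1), (2,3), \<dots>\<close>: a diagonal
  term of size half the spectral gap makes the two decay rates of a pair equal, and a small
  antisymmetric term then rotates the pair.  Hence the linearised solution operator has no real
  eigenvalue, and every finite-dimensional invariant subspace has even dimension.  At \<open>0\<close> the
  coupled pairs are \<open>(1,2), (3,4), \<dots>\<close>, and the tangent space of an invariant manifold contains
  \<open>e 0\<close>, the direction of the segment of equilibria; so its dimension is odd.  The nonlinearity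
  interpolates between the two linearisations in \<open>s\<close> and acts on the other coordinates only
  through a bounded displacement of small amplitude, which makes the interpolation cheap in the
  Lipschitz norm; \<open>lam 0 < L\<close> is what lets the graph of the first component reach a second
  equilibrium transversally.\<close>

section \<open>Smooth maps through families of iterated derivatives\<close>

text \<open>Parity is decided at a single time. If all planes rotate with the same speed
  \<open>\<beta>\<close>, then after the quarter turn \<open>pi / (2 * \<beta>)\<close> the
  linearised solution operator is antisymmetric on the paired modes, and a real antisymmetric matrix
  of odd size is singular. Invariance of a tangent space under one injective antisymmetric operator
  therefore forces even dimension. Only fixed points of the flow enter, because there the tangent
  space of an invariant manifold is mapped into itself. Equal decay rates within a pair put half a
  gap on the diagonal in both modes, with opposite signs, which is the origin of the threshold
  \<open>L0 / 2\<close>. The first pair at \<open>e 0\<close> is different: its diagonal entries are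
  the slope \<open>\<gamma>\<close> of the first component at 1 and \<open>\<gamma>\<close> plus the
  first gap, so \<open>\<gamma>\<close> has to lie between \<open>- M\<close> and \<open>M\<close>
  minus that gap, an interval that can be arbitrarily short. The rotation, the coupling of the first
  axis to mode 1 and the interpolation are as small as desired and are paid from the slack between
  an intermediate constant \<open>M\<close> and \<open>L\<close>.\<close>

abbreviation norm_prod :: "'a::real_normed_vector list \<Rightarrow> real" where
  "norm_prod vs \<equiv> prod_list (map norm vs)"

text \<open>The list \<open>vs\<close> holds the directions, the most recent one first.  Local boundedness of
  all orders makes every remainder quadratic, so pointwise derivatives suffice.\<close>

definition derivative_family ::
  "('a::real_normed_vector list \<Rightarrow> 'a \<Rightarrow> 'b::real_normed_vector) \<Rightarrow> bool" where
  "derivative_family D \<longleftrightarrow>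
     (\<forall>vs x. (D vs has_derivative (\<lambda>h. D (h # vs) x)) (at x)) \<and>
     (\<forall>k x. \<exists>r>0. \<exists>C. \<forall>y vs. dist y x < r \<longrightarrow> length vs = k \<longrightarrow>
        norm (D vs y) \<le> C * norm_prod vs)"

definition smooth :: "('a::real_normed_vector \<Rightarrow> 'b::real_normed_vector) \<Rightarrow> bool" where
  "smooth f \<longleftrightarrow> (\<exists>D. derivative_family D \<and> D [] = f)"

lemma norm_prod_nonneg: "0 \<le> norm_prod vs"
  by (induction vs) auto

lemma norm_prod_le_1:
  "(\<And>v. v \<in> set vs \<Longrightarrow> norm v \<le> 1) \<Longrightarrow> norm_prod vs \<le> 1"
  by (induction vs) (auto intro!: mult_le_one norm_prod_nonneg)

lemma derivative_family_has_derivative: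
  "derivative_family D \<Longrightarrow> (D vs has_derivative (\<lambda>h. D (h # vs) x)) (at x)"
  by (auto simp: derivative_family_def)

text \<open>A single radius and a single nonnegative constant serve all orders up to
  \<open>k\<close>, because the Leibniz and Faa di Bruno sums mix orders.\<close>

lemma derivative_family_bound:
  assumes "derivative_family D"
  shows "\<exists>r>0. \<exists>C\<ge>0. \<forall>y vs. dist y x < r \<longrightarrow> length vs \<le> k \<longrightarrow>
           norm (D vs y) \<le> C * norm_prod vs"
proof (induction k)
  have ex: "\<exists>r>0. \<exists>C. \<forall>y vs. dist y x < r \<longrightarrow> length vs = k \<longrightarrow>
        norm (D vs y) \<le> C * norm_prod vs" for k
    using assms by (auto simp: derivative_family_def)
  case 0
  obtain r C where rC: "r > 0" "\<And>y vs. dist y x < r \<Longrightarrow> length vs = 0 \<Longrightarrow>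
        norm (D vs y) \<le> C * norm_prod vs"
    using ex by metis
  have "norm (D vs y) \<le> max C 0 * norm_prod vs" if "dist y x < r" "length vs \<le> 0" for y vs
    using rC(2)[OF that(1), of vs] that(2) by auto
  then show ?case using rC(1) by (intro exI[of _ r] conjI exI[of _ "max C 0"]) auto
next
  case (Suc k)
  have ex: "\<exists>r>0. \<exists>C. \<forall>y vs. dist y x < r \<longrightarrow> length vs = k \<longrightarrow>
        norm (D vs y) \<le> C * norm_prod vs" for k
    using assms by (auto simp: derivative_family_def)
  obtain r C where rC: "r > 0" "\<And>y vs. dist y x < r \<Longrightarrow> length vs = Suc k \<Longrightarrow>
        norm (D vs y) \<le> C * norm_prod vs"
    using ex by metis
  obtain r' C' where rC': "r' > 0" "C' \<ge> 0" "\<And>y vs. dist y x < r' \<Longrightarrow> length vs \<le> k \<Longrightarrow>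
        norm (D vs y) \<le> C' * norm_prod vs"
    using Suc by metis
  have "norm (D vs y) \<le> max C C' * norm_prod vs"
    if "dist y x < min r r'" "length vs \<le> Suc k" for y vs
  proof (cases "length vs = Suc k")
    case True
    then have "norm (D vs y) \<le> C * norm_prod vs" using rC that by auto
    also have "\<dots> \<le> max C C' * norm_prod vs"
      by (intro mult_right_mono norm_prod_nonneg) auto
    finally show ?thesis .
  next
    case False
    then have "norm (D vs y) \<le> C' * norm_prod vs" using rC' that by auto
    also have "\<dots> \<le> max C C' * norm_prod vs"
      by (intro mult_right_mono norm_prod_nonneg) auto
    finally show ?thesis .
  qed
  then show ?case using rC(1) rC'(1,2) by (intro exI[of _ "min r r'"] conjI exI[of _ "max C C'"]) auto
qed

text \<open>Linearity in the newest slot belongs to the Frechet derivative. An older slot is reached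
  by differentiating the linearity identity in the base point and using uniqueness of derivatives,
  hence \<open>x\<close> is arbitrary in the induction.\<close>

lemma derivative_family_linear:
  assumes "derivative_family D"
  shows "linear (\<lambda>v. D (xs @ v # ys) x)"
proof (induction xs arbitrary: x)
  case Nil
  then show ?case
    using derivative_family_has_derivative[OF assms, of ys x] has_derivative_linear by auto
next
  case (Cons h xs)
  have d: "(D (xs @ v # ys) has_derivative (\<lambda>h. D (h # xs @ v # ys) x)) (at x)" for v
    by (rule derivative_family_has_derivative[OF assms])
  show ?case
  proof (rule linearI)
    fix v w
    have "D (xs @ (v + w) # ys) = (\<lambda>x. D (xs @ v # ys) x + D (xs @ w # ys) x)"
      using linear_add[OF Cons] by auto
    then have "(\<lambda>h. D (h # xs @ (v + w) # ys) x) = (\<lambda>h. D (h # xs @ v # ys) x + D (h # xs @ w # ys) x)"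
      using has_derivative_unique[OF d[of "v + w"]] has_derivative_add[OF d[of v] d[of w]] by auto
    from fun_cong[OF this, of h]
    show "D ((h # xs) @ (v + w) # ys) x = D ((h # xs) @ v # ys) x + D ((h # xs) @ w # ys) x"
      by simp
  next
    fix c v
    have "D (xs @ (c *\<^sub>R v) # ys) = (\<lambda>x. c *\<^sub>R D (xs @ v # ys) x)"
      using linear_scale[OF Cons] by auto
    then have "(\<lambda>h. D (h # xs @ (c *\<^sub>R v) # ys) x) = (\<lambda>h. c *\<^sub>R D (h # xs @ v # ys) x)"
      using has_derivative_unique[OF d[of "c *\<^sub>R v"]] has_derivative_scaleR_right[OF d[of v], of c] by auto
    from fun_cong[OF this, of h]
    show "D ((h # xs) @ (c *\<^sub>R v) # ys) x = c *\<^sub>R D ((h # xs) @ v # ys) x"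
      by simp
  qed
qed

text \<open>Mean value inequality twice: the bound of order \<open>k + 2\<close> makes the next
  derivative Lipschitz near \<open>x\<close>, which makes the remainder at most
  \<open>C * (norm h)^2\<close>, uniformly in directions of norm at most 1.\<close>

lemma derivative_family_remainder:
  fixes D :: "'a::real_normed_vector list \<Rightarrow> 'a \<Rightarrow> 'b::real_normed_vector"
  assumes D: "derivative_family D" and "\<epsilon> > 0"
  shows "\<exists>\<delta>>0. \<forall>h. norm h < \<delta> \<longrightarrow> (\<forall>vs. length vs = k \<and> (\<forall>v\<in>set vs. norm v \<le> 1) \<longrightarrow>
           norm (D vs (x + h) - D vs x - D (h # vs) x) \<le> \<epsilon> * norm h)"
proof -
  obtain r C where r: "r > 0" and C: "C \<ge> 0" and b: "\<And>y vs. dist y x < r \<Longrightarrow> length vs \<le> Suc (Suc k) \<Longrightarrow>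
        norm (D vs y) \<le> C * norm_prod vs"
    using derivative_family_bound[OF D, of x "Suc (Suc k)"] by metis
  show ?thesis
  \<comment> \<open>Below this radius \<open>C * (norm h)^2\<close> is at most
    \<open>\<epsilon> * norm h\<close>; the \<open>+ 1\<close> covers \<open>C = 0\<close>.\<close>
  proof (intro exI[of _ "min r (\<epsilon> / (C + 1))"] conjI allI impI)
    show "0 < min r (\<epsilon> / (C + 1))" using r C \<open>\<epsilon> > 0\<close> by auto
    fix h :: 'a and vs :: "'a list"
    assume h: "norm h < min r (\<epsilon> / (C + 1))" and vs: "length vs = k \<and> (\<forall>v\<in>set vs. norm v \<le> 1)"
    have p1: "norm_prod vs \<le> 1" using vs by (intro norm_prod_le_1) auto
    have ball: "dist y x < r" if "y \<in> cball x (norm h)" for y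
      using that h by (auto simp: dist_commute)
    have 1: "norm (D (w # vs) y - D (w # vs) x) \<le> C * norm h * norm w"
      if y: "y \<in> cball x (norm h)" for y w
    proof -
      have "norm (D (w # vs) y - D (w # vs) x) \<le> C * norm w * norm (y - x)"
      proof (rule differentiable_bound[of "cball x (norm h)" _ "\<lambda>z h'. D (h' # w # vs) z"])
        fix z assume z: "z \<in> cball x (norm h)"
        show "(D (w # vs) has_derivative (\<lambda>h'. D (h' # w # vs) z)) (at z within cball x (norm h))"
          by (rule has_derivative_at_withinI[OF derivative_family_has_derivative[OF D]])
        show "onorm (\<lambda>h'. D (h' # w # vs) z) \<le> C * norm w"
        proof (rule onorm_bound)
          fix h'
          have "norm (D (h' # w # vs) z) \<le> C * (norm h' * (norm w * norm_prod vs))"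
            using b[OF ball[OF z], of "h' # w # vs"] vs by auto
          also have "\<dots> \<le> C * (norm h' * (norm w * 1))"
            by (intro mult_left_mono p1) (use C in auto)
          finally show "norm (D (h' # w # vs) z) \<le> C * norm w * norm h'" by (simp add: mult_ac)
        qed (use C in auto)
      qed (use y in auto)
      also have "\<dots> \<le> C * norm w * norm h"
        using y C by (intro mult_left_mono) (auto simp: dist_norm norm_minus_commute)
      finally show ?thesis by (simp add: mult_ac)
    qed
    \<comment> \<open>Subtracting the linear part turns the remainder into an increment of
      \<open>\<phi>\<close>, whose derivative vanishes at \<open>x\<close>.\<close>
    define \<phi> where "\<phi> y = D vs y - D ((y - x) # vs) x" for y
    have lin: "linear (\<lambda>v. D (v # vs) x)" using derivative_family_linear[OF D, of "[]"] by simp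
    have bl: "bounded_linear (\<lambda>v. D (v # vs) x)"
      using derivative_family_has_derivative[OF D, of vs x] has_derivative_bounded_linear by blast
    have "norm (\<phi> (x + h) - \<phi> x) \<le> C * norm h * norm ((x + h) - x)"
    proof (rule differentiable_bound[of "cball x (norm h)" _ "\<lambda>z w. D (w # vs) z - D (w # vs) x"])
      fix z assume z: "z \<in> cball x (norm h)"
      have "((\<lambda>y. D ((y - x) # vs) x) has_derivative (\<lambda>w. D (w # vs) x)) (at z within cball x (norm h))"
        by (rule bounded_linear.has_derivative[OF bl, of "\<lambda>y. y - x" "\<lambda>w. w"])
          (auto intro!: derivative_eq_intros)
      then show "(\<phi> has_derivative (\<lambda>w. D (w # vs) z - D (w # vs) x)) (at z within cball x (norm h))"
        unfolding \<phi>_def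
        by (intro has_derivative_diff has_derivative_at_withinI[OF derivative_family_has_derivative[OF D]])
      show "onorm (\<lambda>w. D (w # vs) z - D (w # vs) x) \<le> C * norm h"
        by (rule onorm_bound) (use 1[OF z] C in auto)
    qed (auto simp: dist_norm)
    also have "C * norm h * norm ((x + h) - x) \<le> \<epsilon> * norm h"
    proof -
      have "C * norm h \<le> (C + 1) * (\<epsilon> / (C + 1))"
        using h C \<open>\<epsilon> > 0\<close> by (intro mult_mono) auto
      also have "\<dots> = \<epsilon>" using C by auto
      finally show ?thesis by (simp add: mult_right_mono)
    qed
    also have "\<phi> (x + h) - \<phi> x = D vs (x + h) - D vs x - D (h # vs) x"
      using linear_0[OF lin] by (simp add: \<phi>_def)
    finally show "norm (D vs (x + h) - D vs x - D (h # vs) x) \<le> \<epsilon> * norm h" .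
  qed
qed

lemma smooth_imp_smooth_map:
  assumes "smooth f"
  shows "smooth_map f"
proof -
  obtain D where D: "derivative_family D" "D [] = f"
    using assms by (auto simp: smooth_def)
  show ?thesis unfolding smooth_map_def
  proof (intro exI[of _ "\<lambda>k x vs. D vs x"] conjI allI impI)
    fix k x
    show "D [] x = f x" by (simp add: D)
    obtain r C where "r > 0" "\<And>y vs. dist y x < r \<Longrightarrow> length vs \<le> k \<Longrightarrow>
        norm (D vs y) \<le> C * norm_prod vs"
      using derivative_family_bound[OF D(1), of x k] by metis
    then have "\<forall>vs. length vs = k \<longrightarrow> norm (D vs x) \<le> C * norm_prod vs"
      by simp
    show "bounded_multilinear_k k (\<lambda>vs. D vs x)"
      unfolding bounded_multilinear_k_def
      using \<open>\<forall>vs. length vs = k \<longrightarrow> norm (D vs x) \<le> C * norm_prod vs\<close>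
        derivative_family_linear[OF D(1)] by auto
    fix \<epsilon> :: real assume "\<epsilon> > 0"
    then show "\<exists>\<delta>>0. \<forall>h. norm h < \<delta> \<longrightarrow> (\<forall>vs. length vs = k \<and> (\<forall>v\<in>set vs. norm v \<le> 1) \<longrightarrow>
           norm (D vs (x + h) - D vs x - D (h # vs) x) \<le> \<epsilon> * norm h)"
      by (rule derivative_family_remainder[OF D(1)])
  qed
qed

section \<open>Constants, bounded linear maps and sums\<close>

lemma smooth_const [intro]: "smooth (\<lambda>x. c)"
proof -
  define D where "D = (\<lambda>(vs :: 'a list) (x :: 'a). if vs = [] then c else 0)"
  have "derivative_family D"
    unfolding derivative_family_def
  proof (intro conjI allI)
    fix vs x
    show "(D vs has_derivative (\<lambda>h. D (h # vs) x)) (at x)"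
      by (auto simp: D_def)
    fix k
    show "\<exists>r>0. \<exists>C. \<forall>y vs. dist y x < r \<longrightarrow> length vs = k \<longrightarrow> norm (D vs y) \<le> C * norm_prod vs"
      by (intro exI[of _ 1] conjI exI[of _ "norm c"]) (auto simp: D_def norm_prod_nonneg)
  qed
  moreover have "D [] = (\<lambda>x. c)" by (auto simp: D_def)
  ultimately show ?thesis by (auto simp: smooth_def)
qed

lemma smooth_linear [intro]:
  assumes "bounded_linear f"
  shows "smooth f"
proof -
  define D where "D = (\<lambda>(vs :: 'a list) (x :: 'a). case vs of [] \<Rightarrow> f x | [v] \<Rightarrow> f v | _ \<Rightarrow> 0)"
  obtain K where K: "\<And>x. norm (f x) \<le> norm x * K" "K > 0" using bounded_linear.pos_bounded[OF assms] by blast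
  have "derivative_family D"
    unfolding derivative_family_def
  proof (intro conjI allI)
    fix vs x
    show "(D vs has_derivative (\<lambda>h. D (h # vs) x)) (at x)"
      by (cases vs) (auto simp: D_def bounded_linear_imp_has_derivative[OF assms] split: list.splits)
    fix k
    have "norm (D vs y) \<le> (K * (norm x + 1)) * norm_prod vs" if "dist y x < 1" for y and vs
    proof -
      have y: "norm y \<le> norm x + 1" using that norm_triangle_ineq2[of y x] by (simp add: dist_norm)
      consider "vs = []" | v where "vs = [v]" | v w us where "vs = v # w # us" by (metis list.exhaust)
      then show ?thesis
      proof cases
        case 1
        have "norm (f y) \<le> norm y * K" by (rule K)
        also have "\<dots> \<le> (norm x + 1) * K" using y K by (intro mult_right_mono) auto
        finally show ?thesis using 1 by (simp add: D_def mult_ac)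
      next
        case 2
        have "norm (f v) \<le> (K * norm v) * 1" using K by (simp add: mult_ac)
        also have "\<dots> \<le> (K * norm v) * (norm x + 1)" using K by (intro mult_left_mono) auto
        finally show ?thesis using 2 by (simp add: D_def mult_ac)
      next
        case 3
        then show ?thesis using K by (simp add: D_def norm_prod_nonneg)
      qed
    qed
    then show "\<exists>r>0. \<exists>C. \<forall>y vs. dist y x < r \<longrightarrow> length vs = k \<longrightarrow> norm (D vs y) \<le> C * norm_prod vs"
      by (intro exI[of _ 1] conjI exI[of _ "K * (norm x + 1)"]) auto
  qed
  moreover have "D [] = f" by (auto simp: D_def)
  ultimately show ?thesis by (auto simp: smooth_def)
qed

lemma smooth_add [intro]:
  assumes "smooth f" "smooth g"
  shows "smooth (\<lambda>x. f x + g x)"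
proof -
  obtain D E where D: "derivative_family D" "D [] = f" and E: "derivative_family E" "E [] = g"
    using assms by (auto simp: smooth_def)
  have "derivative_family (\<lambda>vs x. D vs x + E vs x)"
    unfolding derivative_family_def
  proof (intro conjI allI)
    fix vs x
    show "((\<lambda>x. D vs x + E vs x) has_derivative (\<lambda>h. D (h # vs) x + E (h # vs) x)) (at x)"
      by (intro has_derivative_add derivative_family_has_derivative D E)
    fix k
    obtain r C where rC: "r > 0" "\<And>y vs. dist y x < r \<Longrightarrow> length vs \<le> k \<Longrightarrow>
        norm (D vs y) \<le> C * norm_prod vs"
      using derivative_family_bound[OF D(1), of x k] by metis
    obtain r' C' where rC': "r' > 0" "\<And>y vs. dist y x < r' \<Longrightarrow> length vs \<le> k \<Longrightarrow>
        norm (E vs y) \<le> C' * norm_prod vs"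
      using derivative_family_bound[OF E(1), of x k] by metis
    have "norm (D vs y + E vs y) \<le> (C + C') * norm_prod vs"
      if "dist y x < min r r'" "length vs = k" for y vs
      using norm_triangle_ineq[of "D vs y" "E vs y"] rC(2)[of y vs] rC'(2)[of y vs] that
      by (simp add: distrib_right)
    then show "\<exists>r>0. \<exists>C. \<forall>y vs. dist y x < r \<longrightarrow> length vs = k \<longrightarrow>
        norm (D vs y + E vs y) \<le> C * norm_prod vs"
      using rC rC' by (intro exI[of _ "min r r'"] conjI exI[of _ "C + C'"]) auto
  qed
  moreover have "(\<lambda>x. D [] x + E [] x) = (\<lambda>x. f x + g x)" using D E by auto
  ultimately show ?thesis unfolding smooth_def
    by (intro exI[of _ "\<lambda>vs x. D vs x + E vs x"]) auto
qed

section \<open>Leibniz rule for bilinear products\<close>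

fun splits :: "'a list \<Rightarrow> ('a list \<times> 'a list) list" where
  "splits [] = [([], [])]"
| "splits (h # vs) = map (\<lambda>(a, b). (h # a, b)) (splits vs) @ map (\<lambda>(a, b). (a, h # b)) (splits vs)"

lemma length_splits: "length (splits vs) = 2 ^ length vs"
  by (induction vs) auto

lemma splits_prod_norm:
  "(a, b) \<in> set (splits vs) \<Longrightarrow> length a \<le> length vs \<and> length b \<le> length vs \<and>
     norm_prod a * norm_prod b = norm_prod vs"
proof (induction vs arbitrary: a b)
  case (Cons h vs)
  then obtain c d where "(c, d) \<in> set (splits vs)" "(a, b) = (h # c, d) \<or> (a, b) = (c, h # d)"
    by auto
  then show ?case using Cons.IH[of c d] by (auto simp: mult_ac)
qed auto

lemma has_derivative_sum_list:
  "(\<And>p. p \<in> set ps \<Longrightarrow> (f p has_derivative f' p) F) \<Longrightarrow>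
     ((\<lambda>x. \<Sum>p\<leftarrow>ps. f p x) has_derivative (\<lambda>h. \<Sum>p\<leftarrow>ps. f' p h)) F"
  by (induction ps) (auto intro!: has_derivative_add)

lemma norm_sum_list_le:
  "(\<And>p. p \<in> set ps \<Longrightarrow> norm (f p) \<le> B) \<Longrightarrow> norm (\<Sum>p\<leftarrow>ps. f p) \<le> real (length ps) * B"
proof (induction ps)
  case (Cons p ps)
  have "norm (f p + (\<Sum>p\<leftarrow>ps. f p)) \<le> B + real (length ps) * B"
    using Cons by (intro norm_triangle_mono) auto
  then show ?case by (simp add: algebra_simps)
qed auto

text \<open>Each direction differentiates one of the two factors, so the derivatives are sums over
  all splittings of the list of directions. Lists keep repeated directions apart and give exactly
  \<open>2 ^ k\<close> terms in the bound.\<close>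

lemma smooth_bilinear:
  assumes bil: "bounded_bilinear bmul"
    and "smooth f" "smooth g"
  shows "smooth (\<lambda>x. bmul (f x) (g x))"
proof -
  obtain D E where D: "derivative_family D" "D [] = f" and E: "derivative_family E" "E [] = g"
    using assms by (auto simp: smooth_def)
  obtain K where K: "K > 0" "\<And>a b. norm (bmul a b) \<le> norm a * norm b * K"
    using bounded_bilinear.pos_bounded[OF bil] by blast
  define P where "P vs x = (\<Sum>p\<leftarrow>splits vs. bmul (D (fst p) x) (E (snd p) x))" for vs x
  have "derivative_family P"
    unfolding derivative_family_def
  proof (intro conjI allI)
    fix vs x
    have "(P vs has_derivative (\<lambda>h. \<Sum>p\<leftarrow>splits vs. bmul (D (fst p) x) (E (h # snd p) x) + bmul (D (h # fst p) x) (E (snd p) x))) (at x)"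
      unfolding P_def
      by (intro has_derivative_sum_list bounded_bilinear.FDERIV[OF bil] derivative_family_has_derivative D E)
    also have "(\<lambda>h. \<Sum>p\<leftarrow>splits vs. bmul (D (fst p) x) (E (h # snd p) x) + bmul (D (h # fst p) x) (E (snd p) x))
        = (\<lambda>h. P (h # vs) x)"
      by (auto simp: P_def sum_list_addf o_def case_prod_beta add_ac)
    finally show "(P vs has_derivative (\<lambda>h. P (h # vs) x)) (at x)" .
    fix k
    obtain r C where rC: "r > 0" "C \<ge> 0" "\<And>y vs. dist y x < r \<Longrightarrow> length vs \<le> k \<Longrightarrow>
        norm (D vs y) \<le> C * norm_prod vs"
      using derivative_family_bound[OF D(1), of x k] by metis
    obtain r' C' where rC': "r' > 0" "C' \<ge> 0" "\<And>y vs. dist y x < r' \<Longrightarrow> length vs \<le> k \<Longrightarrow>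
        norm (E vs y) \<le> C' * norm_prod vs"
      using derivative_family_bound[OF E(1), of x k] by metis
    have "norm (P vs y) \<le> (2 ^ k * (C * C' * K)) * norm_prod vs"
      if y: "dist y x < min r r'" and vs: "length vs = k" for y vs
    proof -
      have "norm (P vs y) \<le> real (length (splits vs)) * (C * C' * K * norm_prod vs)"
        unfolding P_def
      proof (rule norm_sum_list_le)
        fix p assume "p \<in> set (splits vs)"
        then have p: "length (fst p) \<le> k" "length (snd p) \<le> k"
          and pr: "norm_prod (fst p) * norm_prod (snd p) = norm_prod vs"
          using splits_prod_norm[of "fst p" "snd p" vs] vs by auto
        have "norm (bmul (D (fst p) y) (E (snd p) y)) \<le> norm (D (fst p) y) * norm (E (snd p) y) * K"
          by (rule K)
        also have "\<dots> \<le> (C * norm_prod (fst p)) * (C' * norm_prod (snd p)) * K"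
          using p y rC rC' K by (intro mult_right_mono mult_mono) (auto intro!: mult_nonneg_nonneg norm_prod_nonneg)
        also have "\<dots> = C * C' * K * (norm_prod (fst p) * norm_prod (snd p))"
          by (simp add: mult_ac)
        finally show "norm (bmul (D (fst p) y) (E (snd p) y)) \<le> C * C' * K * norm_prod vs"
          by (simp add: pr)
      qed
      then show ?thesis by (simp add: length_splits vs mult_ac)
    qed
    then show "\<exists>r>0. \<exists>C. \<forall>y vs. dist y x < r \<longrightarrow> length vs = k \<longrightarrow>
        norm (P vs y) \<le> C * norm_prod vs"
      using rC rC' by (intro exI[of _ "min r r'"] conjI exI[of _ "2 ^ k * (C * C' * K)"]) auto
  qed
  moreover have "P [] = (\<lambda>x. bmul (f x) (g x))" using D E by (auto simp: P_def)
  ultimately show ?thesis by (auto simp: smooth_def)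
qed

lemmas smooth_scaleR [intro] =
  smooth_bilinear[OF bounded_bilinear_scaleR]

lemmas smooth_mult [intro] =
  smooth_bilinear[OF bounded_bilinear_mult]

lemmas smooth_inner [intro] =
  smooth_bilinear[OF bounded_bilinear_inner]

section \<open>Composition with functions of one real variable\<close>

definition derivative_sequence :: "(nat \<Rightarrow> real \<Rightarrow> real) \<Rightarrow> bool" where
  "derivative_sequence \<Phi> \<longleftrightarrow> (\<forall>n x. (\<Phi> n has_real_derivative \<Phi> (Suc n) x) (at x))"

text \<open>Partitions of a list of directions into blocks, the index set of the
  formula of Faa di Bruno: a new direction opens a new block or joins an old one.\<close>

fun join_block :: "'a \<Rightarrow> 'a list list \<Rightarrow> 'a list list list" where
  "join_block h [] = []"
| "join_block h (w # ws) = ((h # w) # ws) # map (\<lambda>ws'. w # ws') (join_block h ws)"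

fun block_partitions :: "'a list \<Rightarrow> 'a list list list" where
  "block_partitions [] = [[]]"
| "block_partitions (h # vs) = concat (map (\<lambda>ws. ([h] # ws) # join_block h ws) (block_partitions vs))"

lemma length_join_block: "length (join_block h ws) = length ws"
  by (induction ws) auto

lemma join_block_length: "ws' \<in> set (join_block h ws) \<Longrightarrow> length ws' = length ws"
  by (induction ws arbitrary: ws') auto

lemma join_block_block_length:
  "ws' \<in> set (join_block h ws) \<Longrightarrow> (\<And>w. w \<in> set ws \<Longrightarrow> length w \<le> k) \<Longrightarrow>
     w \<in> set ws' \<Longrightarrow> length w \<le> Suc k"
  by (induction ws arbitrary: ws') (auto simp: le_SucI)

lemma join_block_prod_norm:
  "ws' \<in> set (join_block h ws) \<Longrightarrow>
     norm_prod (concat ws') = norm h * norm_prod (concat ws)"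
  by (induction ws arbitrary: ws') (auto simp: mult_ac)

lemma block_partitions_props:
  "ws \<in> set (block_partitions vs) \<Longrightarrow>
     length ws \<le> length vs \<and> (\<forall>w\<in>set ws. length w \<le> length vs) \<and>
     norm_prod (concat ws) = norm_prod vs"
proof (induction vs arbitrary: ws)
  case (Cons h vs)
  then obtain us where us: "us \<in> set (block_partitions vs)" "ws = [h] # us \<or> ws \<in> set (join_block h us)"
    by auto
  note IH = Cons.IH[OF us(1)]
  from us(2) show ?case
  proof
    assume "ws = [h] # us"
    then show ?thesis using IH by (auto simp: le_SucI)
  next
    assume j: "ws \<in> set (join_block h us)"
    show ?thesis
      using join_block_length[OF j] join_block_prod_norm[OF j] join_block_block_length[OF j, of "length vs"] IH
      by auto
  qed
qed auto

text \<open>Crude bound for the Bell numbers: a partition of \<open>k\<close> directions has at most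
  \<open>k\<close> blocks, so a further direction has at most \<open>k + 1\<close> places to
  go.\<close>

lemma length_block_partitions:
  fixes vs :: "'a::real_normed_vector list"
  shows "length (block_partitions vs) \<le> fact (length vs)"
proof (induction vs)
  case (Cons h vs)
  have "length (block_partitions (h # vs)) = (\<Sum>ws\<leftarrow>block_partitions vs. Suc (length ws))"
    by (simp add: length_concat o_def length_join_block)
  also have "\<dots> \<le> (\<Sum>ws\<leftarrow>block_partitions vs. Suc (length vs))"
    by (intro sum_list_mono) (use block_partitions_props in auto)
  also have "\<dots> = Suc (length vs) * length (block_partitions vs)"
    by (simp add: sum_list_triv)
  also have "\<dots> \<le> Suc (length vs) * fact (length vs)"
    using Cons by (intro mult_left_mono) auto
  finally show ?case by simp
qed auto

text \<open>In the product rule the new direction joins exactly one of the existing blocks; the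
  terms with a new block come from the outer function of the composition.\<close>

lemma has_derivative_prod_blocks:
  fixes D :: "'a::real_normed_vector list \<Rightarrow> 'a \<Rightarrow> real"
  assumes D: "derivative_family D"
  shows "((\<lambda>x. \<Prod>w\<leftarrow>ws. D w x) has_derivative (\<lambda>h. \<Sum>ws'\<leftarrow>join_block h ws. \<Prod>w\<leftarrow>ws'. D w x)) (at x)"
proof (induction ws)
  case (Cons w ws)
  have "((\<lambda>x. D w x * (\<Prod>w\<leftarrow>ws. D w x)) has_derivative
     (\<lambda>h. D w x * (\<Sum>ws'\<leftarrow>join_block h ws. \<Prod>w\<leftarrow>ws'. D w x) + D (h # w) x * (\<Prod>w\<leftarrow>ws. D w x))) (at x)"
    by (intro has_derivative_mult Cons derivative_family_has_derivative D)
  then show ?case by (simp add: o_def sum_list_const_mult add_ac)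
qed auto

lemma prod_list_block_bound:
  fixes D :: "'a::real_normed_vector list \<Rightarrow> 'a \<Rightarrow> real"
  assumes "\<And>w. w \<in> set ws \<Longrightarrow> norm (D w y) \<le> C * norm_prod w" "C \<ge> 0"
  shows "norm (\<Prod>w\<leftarrow>ws. D w y) \<le> C ^ length ws * norm_prod (concat ws)"
  using assms(1)
proof (induction ws)
  case (Cons w ws)
  have "norm (D w y * (\<Prod>w\<leftarrow>ws. D w y)) \<le> (C * norm_prod w) * (C ^ length ws * norm_prod (concat ws))"
    unfolding norm_mult using Cons assms(2)
    by (intro mult_mono) (auto intro!: mult_nonneg_nonneg norm_prod_nonneg)
  then show ?case by (simp add: mult_ac)
qed auto

lemma finitely_many_locally_bounded:
  fixes G :: "nat \<Rightarrow> 'a::metric_space \<Rightarrow> real"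
  assumes "\<And>j. isCont (G j) x"
  shows "\<exists>r>0. \<exists>B\<ge>0. \<forall>y. dist y x < r \<longrightarrow> (\<forall>j\<le>k. \<bar>G j y\<bar> \<le> B)"
proof -
  have "isCont (\<lambda>y. \<Sum>j\<le>k. \<bar>G j y\<bar>) x" using assms by (intro continuous_intros) auto
  then obtain r where r: "r > 0" "\<And>y. dist y x < r \<Longrightarrow> dist (\<Sum>j\<le>k. \<bar>G j y\<bar>) (\<Sum>j\<le>k. \<bar>G j x\<bar>) < 1"
    unfolding continuous_at_eps_delta dist_real_def by (metis zero_less_one)
  have "\<bar>G j y\<bar> \<le> (\<Sum>j\<le>k. \<bar>G j x\<bar>) + 1" if "dist y x < r" "j \<le> k" for j y
  proof -
    have "\<bar>G j y\<bar> \<le> (\<Sum>j\<le>k. \<bar>G j y\<bar>)" using that by (intro member_le_sum) auto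
    then show ?thesis using r(2)[OF that(1)] by (simp add: dist_real_def)
  qed
  moreover have "(\<Sum>j\<le>k. \<bar>G j x\<bar>) + 1 \<ge> 0" by (intro add_nonneg_nonneg sum_nonneg) auto
  ultimately show ?thesis using r(1) by blast
qed

lemma smooth_compose:
  fixes f :: "'a::real_normed_vector \<Rightarrow> real"
  assumes \<Phi>: "derivative_sequence \<Phi>" and "smooth f"
  shows "smooth (\<lambda>x. \<Phi> 0 (f x))"
proof -
  obtain D where D: "derivative_family D" "D [] = f"
    using assms by (auto simp: smooth_def)
  define P where "P vs x = (\<Sum>ws\<leftarrow>block_partitions vs. \<Phi> (length ws) (f x) * (\<Prod>w\<leftarrow>ws. D w x))" for vs x
  have df: "(f has_derivative (\<lambda>h. D [h] x)) (at x)" for x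
    using derivative_family_has_derivative[OF D(1), of "[]"] D(2) by simp
  have d\<Phi>: "((\<lambda>x. \<Phi> n (f x)) has_derivative (\<lambda>h. \<Phi> (Suc n) (f x) * D [h] x)) (at x)" for n x
  proof -
    have "(\<Phi> n has_derivative (*) (\<Phi> (Suc n) (f x))) (at (f x))"
      using \<Phi> by (auto simp: derivative_sequence_def has_field_derivative_def)
    from has_derivative_compose[OF df this] show ?thesis by simp
  qed
  have "derivative_family P"
    unfolding derivative_family_def
  proof (intro conjI allI)
    fix vs x
    have "(P vs has_derivative (\<lambda>h. \<Sum>ws\<leftarrow>block_partitions vs.
        \<Phi> (length ws) (f x) * (\<Sum>ws'\<leftarrow>join_block h ws. \<Prod>w\<leftarrow>ws'. D w x) +
        \<Phi> (Suc (length ws)) (f x) * D [h] x * (\<Prod>w\<leftarrow>ws. D w x))) (at x)"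
      unfolding P_def
      by (intro has_derivative_sum_list has_derivative_mult d\<Phi> has_derivative_prod_blocks D)
    also have "(\<lambda>h. \<Sum>ws\<leftarrow>block_partitions vs.
        \<Phi> (length ws) (f x) * (\<Sum>ws'\<leftarrow>join_block h ws. \<Prod>w\<leftarrow>ws'. D w x) +
        \<Phi> (Suc (length ws)) (f x) * D [h] x * (\<Prod>w\<leftarrow>ws. D w x)) = (\<lambda>h. P (h # vs) x)"
    proof
      fix h
      have j: "\<Phi> (length ws) (f x) * (\<Sum>ws'\<leftarrow>join_block h ws. \<Prod>w\<leftarrow>ws'. D w x)
          = (\<Sum>ws'\<leftarrow>join_block h ws. \<Phi> (length ws') (f x) * (\<Prod>w\<leftarrow>ws'. D w x))" for ws
      proof -
        have "map (\<lambda>ws'. \<Phi> (length ws') (f x) * (\<Prod>w\<leftarrow>ws'. D w x)) (join_block h ws)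
            = map (\<lambda>ws'. \<Phi> (length ws) (f x) * (\<Prod>w\<leftarrow>ws'. D w x)) (join_block h ws)"
          by (intro map_cong refl) (simp add: join_block_length)
        then show ?thesis by (simp only: sum_list_const_mult)
      qed
      have concat: "(\<Sum>z\<leftarrow>concat (map (\<lambda>ws. ([h] # ws) # join_block h ws) wss). T z)
          = (\<Sum>ws\<leftarrow>wss. T ([h] # ws) + (\<Sum>ws'\<leftarrow>join_block h ws. T ws'))" for T :: "'a list list \<Rightarrow> real" and wss
        by (induction wss) (auto simp: add_ac)
      show "(\<Sum>ws\<leftarrow>block_partitions vs.
        \<Phi> (length ws) (f x) * (\<Sum>ws'\<leftarrow>join_block h ws. \<Prod>w\<leftarrow>ws'. D w x) +
        \<Phi> (Suc (length ws)) (f x) * D [h] x * (\<Prod>w\<leftarrow>ws. D w x)) = P (h # vs) x"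
        unfolding P_def block_partitions.simps concat j by (simp add: mult_ac add_ac)
    qed
    finally show "(P vs has_derivative (\<lambda>h. P (h # vs) x)) (at x)" .
    fix k
    obtain r C where rC: "r > 0" "C \<ge> 0" "\<And>y vs. dist y x < r \<Longrightarrow> length vs \<le> k \<Longrightarrow>
        norm (D vs y) \<le> C * norm_prod vs"
      using derivative_family_bound[OF D(1), of x k] by metis
    have "\<And>j. isCont (\<lambda>y. \<Phi> j (f y)) x" using d\<Phi> has_derivative_continuous by blast
    then obtain r' B where rB: "r' > 0" "B \<ge> 0" "\<And>y j. dist y x < r' \<Longrightarrow> j \<le> k \<Longrightarrow> \<bar>\<Phi> j (f y)\<bar> \<le> B"
      using finitely_many_locally_bounded[where G = "\<lambda>j y. \<Phi> j (f y)" and x = x and k = k] by metis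
    \<comment> \<open>Partitions may have fewer than \<open>k\<close> blocks; the base
      \<open>C + 1\<close> is at least 1, so its \<open>k\<close>-th power dominates every
      \<open>C ^ length ws\<close>.\<close>
    define M where "M = B * (C + 1) ^ k"
    have M: "M \<ge> 0" using rB rC by (simp add: M_def)
    have "norm (P vs y) \<le> (fact k * M) * norm_prod vs"
      if y: "dist y x < min r r'" and vs: "length vs = k" for y vs
    proof -
      have "norm (P vs y) \<le> real (length (block_partitions vs)) * (M * norm_prod vs)"
        unfolding P_def
      proof (rule norm_sum_list_le)
        fix ws assume "ws \<in> set (block_partitions vs)"
        then have ws: "length ws \<le> k" "\<And>w. w \<in> set ws \<Longrightarrow> length w \<le> k"
          "norm_prod (concat ws) = norm_prod vs"
          using block_partitions_props[of ws vs] vs by auto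
        have "norm (\<Prod>w\<leftarrow>ws. D w y) \<le> C ^ length ws * norm_prod (concat ws)"
          using rC ws y by (intro prod_list_block_bound) auto
        also have "\<dots> \<le> (C + 1) ^ k * norm_prod vs"
        proof -
          have "C ^ length ws \<le> (C + 1) ^ length ws" using rC by (intro power_mono) auto
          also have "\<dots> \<le> (C + 1) ^ k" using rC ws by (intro power_increasing) auto
          finally show ?thesis unfolding ws(3) by (intro mult_right_mono norm_prod_nonneg)
        qed
        finally have "norm (\<Prod>w\<leftarrow>ws. D w y) \<le> (C + 1) ^ k * norm_prod vs" .
        then have "norm (\<Phi> (length ws) (f y) * (\<Prod>w\<leftarrow>ws. D w y)) \<le> B * ((C + 1) ^ k * norm_prod vs)"
          unfolding norm_mult using rB ws y by (intro mult_mono) auto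
        then show "norm (\<Phi> (length ws) (f y) * (\<Prod>w\<leftarrow>ws. D w y)) \<le> M * norm_prod vs"
          by (simp add: M_def mult_ac)
      qed
      also have "\<dots> \<le> fact k * (M * norm_prod vs)"
      proof (rule mult_right_mono)
        have "real (length (block_partitions vs)) \<le> real (fact (length vs))"
          using length_block_partitions[of vs] of_nat_mono by blast
        then show "real (length (block_partitions vs)) \<le> fact k" using vs by simp
      qed (use M in \<open>auto intro!: mult_nonneg_nonneg norm_prod_nonneg\<close>)
      finally show ?thesis by (simp add: mult_ac)
    qed
    then show "\<exists>r>0. \<exists>C. \<forall>y vs. dist y x < r \<longrightarrow> length vs = k \<longrightarrow>
        norm (P vs y) \<le> C * norm_prod vs"
      using rC rB by (intro exI[of _ "min r r'"] conjI exI[of _ "fact k * M"]) auto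
  qed
  moreover have "P [] = (\<lambda>x. \<Phi> 0 (f x))" by (auto simp: P_def)
  ultimately show ?thesis by (auto simp: smooth_def)
qed

section \<open>Real profiles\<close>

text \<open>On the real line all directions are multiples of 1, so the values of the family at
  \<open>replicate n 1\<close> form a sequence of ordinary derivatives, to which the composition
  formula applies.\<close>

lemma smooth_compose_real:
  fixes g :: "real \<Rightarrow> real"
  assumes "smooth g" "smooth f"
  shows "smooth (\<lambda>x. g (f x))"
proof -
  obtain D where D: "derivative_family D" "D [] = g"
    using assms by (auto simp: smooth_def)
  have "derivative_sequence (\<lambda>n. D (replicate n 1))"
    unfolding derivative_sequence_def
  proof (intro allI)
    fix n x
    have lin: "D (h # replicate n 1) x = D (1 # replicate n 1) x * h" for h
      using linear_scale[OF derivative_family_linear[OF D(1), of "[]" "replicate n 1" x], of h 1] by (simp add: mult.commute)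
    have "(\<lambda>h. D (h # replicate n 1) x) = (*) (D (replicate (Suc n) 1) x)"
      by (rule ext, subst lin) simp
    then show "(D (replicate n 1) has_real_derivative D (replicate (Suc n) 1) x) (at x)"
      using derivative_family_has_derivative[OF D(1), of "replicate n 1" x]
      by (simp add: has_field_derivative_def)
  qed
  from smooth_compose[OF this assms(2)] show ?thesis by (simp add: D)
qed

lemma smooth_id: "smooth (\<lambda>x. x)"
  by (rule smooth_linear[OF bounded_linear_ident])

lemma derivative_sequence_smooth:
  "derivative_sequence \<Phi> \<Longrightarrow> smooth (\<Phi> 0)"
  using smooth_compose[OF _ smooth_id] by simp

lemma smooth_exp: "smooth (exp :: real \<Rightarrow> real)"
  using derivative_sequence_smooth[of "\<lambda>n. exp"]
  by (auto simp: derivative_sequence_def intro!: derivative_eq_intros)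

lemma smooth_cos: "smooth (cos :: real \<Rightarrow> real)"
proof -
  have "- sin (x + real n * (pi / 2)) = cos (x + real (Suc n) * (pi / 2))" for x n
  proof -
    have "cos (x + real (Suc n) * (pi / 2)) = cos ((x + real n * (pi / 2)) + pi / 2)"
      by (simp add: algebra_simps add_divide_distrib)
    then show ?thesis by (simp only: cos_add sin_pi_half cos_pi_half)
  qed
  then have "derivative_sequence (\<lambda>n x. cos (x + real n * (pi / 2)))"
    unfolding derivative_sequence_def by (auto intro!: derivative_eq_intros)
  from derivative_sequence_smooth[OF this] show ?thesis by simp
qed

section \<open>Flat functions\<close>

definition flat :: "real poly \<Rightarrow> real \<Rightarrow> real" where
  "flat p x = (if x \<le> 0 then 0 else poly p (1 / x) * exp (- 1 / x))"

lemma flat_nonpos [simp]: "x \<le> 0 \<Longrightarrow> flat p x = 0"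
  by (simp add: flat_def)

lemma tendsto_poly_exp_minus: "((\<lambda>y::real. poly p y * exp (- y)) \<longlongrightarrow> 0) at_top"
proof -
  have "((\<lambda>y. \<Sum>i\<le>degree p. coeff p i * (y ^ i / exp y)) \<longlongrightarrow> (\<Sum>i\<le>degree p. coeff p i * 0)) at_top"
    by (intro tendsto_sum tendsto_mult tendsto_const tendsto_power_div_exp_0)
  then show ?thesis
    by (simp add: poly_altdef sum_distrib_right exp_minus divide_inverse mult.assoc)
qed

text \<open>The class is closed under differentiation: with \<open>y = 1 / x\<close>, the derivative
  of \<open>p(y) * exp (- y)\<close> in \<open>x\<close> is
  \<open>y^2 * (p - p')(y) * exp (- y)\<close>. A polynomial parameter thus describes all
  derivatives at once.\<close>

lemma DERIV_flat:
  "(flat p has_real_derivative flat (pCons 0 (pCons 0 (p - pderiv p))) x) (at x)"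
proof (cases x "0::real" rule: linorder_cases)
  case less
  have "((\<lambda>_. 0) has_real_derivative 0) (at x)" by simp
  then have "(flat p has_real_derivative 0) (at x)"
    by (rule has_field_derivative_transform_within_open[of _ _ _ "{..<0}"]) (use less in auto)
  then show ?thesis using less by simp
next
  case equal
  \<comment> \<open>With \<open>h = 1 / y\<close> the difference quotient at 0 becomes
    \<open>y * p(y) * exp (- y)\<close>.\<close>
  have "((\<lambda>h. flat p h / h) \<longlongrightarrow> 0) (at_right 0)"
    unfolding filterlim_at_right_to_top
  proof (rule Lim_transform_eventually)
    show "((\<lambda>y. poly (pCons 0 p) y * exp (- y)) \<longlongrightarrow> 0) at_top" by (rule tendsto_poly_exp_minus)
    show "\<forall>\<^sub>F y in at_top. poly (pCons 0 p) y * exp (- y) = flat p (inverse y) / inverse y"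
      using eventually_gt_at_top[of 0] by eventually_elim (simp add: flat_def field_simps)
  qed
  moreover have "((\<lambda>h. flat p h / h) \<longlongrightarrow> 0) (at_left 0)"
    by (rule Lim_transform_eventually[OF tendsto_const[of 0]])
      (auto simp: eventually_at_left_field intro: exI[of _ "-1"])
  ultimately have "((\<lambda>h. flat p h / h) \<longlongrightarrow> 0) (at 0)"
    by (simp add: filterlim_split_at)
  then show ?thesis using equal by (simp add: DERIV_def)
next
  case greater
  have "((\<lambda>x. poly p (1 / x) * exp (- 1 / x)) has_real_derivative
      poly (pCons 0 (pCons 0 (p - pderiv p))) (1 / x) * exp (- 1 / x)) (at x)"
    using greater
    by (auto intro!: derivative_eq_intros simp: field_simps power2_eq_square)
  then have "(flat p has_real_derivative poly (pCons 0 (pCons 0 (p - pderiv p))) (1 / x) * exp (- 1 / x)) (at x)"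
    by (rule has_field_derivative_transform_within_open[of _ _ _ "{0<..}"]) (use greater in \<open>auto simp: flat_def\<close>)
  then show ?thesis using greater by (simp add: flat_def)
qed

lemma DERIV_flat_compose [derivative_intros]:
  "(f has_real_derivative f') (at x) \<Longrightarrow>
     ((\<lambda>x. flat p (f x)) has_real_derivative flat (pCons 0 (pCons 0 (p - pderiv p))) (f x) * f') (at x)"
  by (rule DERIV_chain2[OF DERIV_flat])

lemma derivative_sequence_flat:
  "derivative_sequence (\<lambda>n. flat (((\<lambda>p. pCons 0 (pCons 0 (p - pderiv p))) ^^ n) p))"
  unfolding derivative_sequence_def using DERIV_flat by simp

lemma smooth_flat: "smooth (flat p)"
  using derivative_sequence_smooth[OF derivative_sequence_flat[of p]] by simp

section \<open>A smooth positive part with slopes between 0 and 1\<close>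

definition smooth_pos :: "real \<Rightarrow> real" where
  "smooth_pos x = x * flat 1 x"

lemma smooth_smooth_pos: "smooth smooth_pos"
  unfolding smooth_pos_def
  by (intro smooth_mult smooth_id smooth_flat)

lemma smooth_pos_nonpos [simp]: "x \<le> 0 \<Longrightarrow> smooth_pos x = 0"
  by (simp add: smooth_pos_def)

lemma smooth_pos_pos: "x > 0 \<Longrightarrow> smooth_pos x = x * exp (- 1 / x)"
  by (simp add: smooth_pos_def flat_def)

lemma DERIV_smooth_pos: "(smooth_pos has_real_derivative flat [:1, 1:] x) (at x)"
proof -
  have "((\<lambda>x. x * flat 1 x) has_real_derivative
      1 * flat 1 x + flat (pCons 0 (pCons 0 (1 - pderiv 1))) x * x) (at x)"
    by (rule DERIV_mult[OF DERIV_ident DERIV_flat])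
  moreover have "1 * flat 1 x + flat (pCons 0 (pCons 0 (1 - pderiv 1))) x * x = flat [:1, 1:] x"
    by (simp add: flat_def field_simps)
  moreover have "smooth_pos = (\<lambda>x. x * flat 1 x)" by (auto simp: smooth_pos_def)
  ultimately show ?thesis by simp
qed

lemma DERIV_smooth_pos_compose [derivative_intros]:
  "(f has_real_derivative f') (at x) \<Longrightarrow>
     ((\<lambda>x. smooth_pos (f x)) has_real_derivative flat [:1, 1:] (f x) * f') (at x)"
  by (rule DERIV_chain2[OF DERIV_smooth_pos])

text \<open>Bounded distance to the positive part means that a combination of such functions is
  bounded as soon as its piecewise linear counterpart is.\<close>

lemma smooth_pos_approx: "\<bar>smooth_pos x - max x 0\<bar> \<le> 1"
proof (cases "x > 0")
  case True
  have "1 - 1 / x \<le> exp (- 1 / x)" using exp_ge_add_one_self[of "- 1 / x"] by simp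
  moreover have "exp (- 1 / x) \<le> 1" using True by simp
  ultimately have "x * (1 - 1 / x) \<le> x * exp (- 1 / x)" "x * exp (- 1 / x) \<le> x * 1"
    using True by (intro mult_left_mono; simp)+
  then show ?thesis using True by (simp add: smooth_pos_pos right_diff_distrib)
qed auto

lemma flat_11_nonneg: "0 \<le> flat [:1, 1:] x"
  by (auto simp: flat_def intro!: mult_nonneg_nonneg add_nonneg_nonneg)

text \<open>This is the slope of \<open>smooth_pos\<close>. Since it never exceeds 1, slopes can be
  added and removed with \<open>smooth_pos\<close> without overshooting a prescribed Lipschitz
  constant.\<close>

lemma flat_11_le_1: "flat [:1, 1:] x \<le> 1"
proof (cases "x > 0")
  case True
  have "(1 + 1 / x) * exp (- 1 / x) \<le> exp (1 / x) * exp (- 1 / x)"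
    by (intro mult_right_mono exp_ge_add_one_self) auto
  also have "\<dots> = 1" by (simp flip: exp_add)
  finally show ?thesis using True by (simp add: flat_def)
qed auto

lemma flat_11_ge: "x > 0 \<Longrightarrow> 1 - 1 / x ^ 2 \<le> flat [:1, 1:] x"
proof -
  assume x: "x > 0"
  have "(1 + 1 / x) * (1 + - 1 / x) \<le> (1 + 1 / x) * exp (- 1 / x)"
    using x by (intro mult_left_mono exp_ge_add_one_self) auto
  moreover have "(1 + 1 / x) * (1 + - 1 / x) = 1 - 1 / x ^ 2"
    using x by (simp add: field_simps power2_eq_square)
  ultimately show ?thesis using x by (simp add: flat_def)
qed

text \<open>The derivative is \<open>y^3 * exp (- y)\<close> with \<open>y = 1 / x\<close>, so
  \<open>smooth_pos\<close> is convex.\<close>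

lemma flat_11_mono: "x \<le> y \<Longrightarrow> flat [:1, 1:] x \<le> flat [:1, 1:] y"
proof (rule DERIV_nonneg_imp_nondecreasing[of x y])
  fix z
  have "flat (pCons 0 (pCons 0 ([:1, 1:] - pderiv [:1, 1:]))) z \<ge> 0"
    by (auto simp: flat_def pderiv_pCons)
  then show "\<exists>d. (flat [:1, 1:] has_real_derivative d) (at z) \<and> 0 \<le> d"
    using DERIV_flat by blast
qed

lemma smooth_pos_mono: "x \<le> y \<Longrightarrow> smooth_pos x \<le> smooth_pos y"
  by (rule DERIV_nonneg_imp_nondecreasing[of x y]) (use DERIV_smooth_pos flat_11_nonneg in blast)+

lemma lipschitz_on_DERIV:
  fixes g :: "real \<Rightarrow> real"
  assumes "\<And>x. (g has_real_derivative g' x) (at x)" "\<And>x. \<bar>g' x\<bar> \<le> M" "0 \<le> M"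
  shows "M-lipschitz_on UNIV g"
proof (rule lipschitz_onI)
  fix x y
  have "norm (g x - g y) \<le> M * norm (x - y)"
    by (rule field_differentiable_bound[of UNIV g g']) (use assms in auto)
  then show "dist (g x) (g y) \<le> M * dist x y" by (simp add: dist_norm)
qed (use assms in auto)

text \<open>The slope of \<open>g\<close> stays in \<open>[-M, M]\<close>, but has to come down from above \<open>l\<close> to nearly \<open>-M\<close>
  at the equilibrium 1.  The graph first leaves the line of slope \<open>l\<close> upwards with small
  excess slope, and the bend that brings it back to this line at 1 is made sharp by the small
  scale \<open>\<sigma>\<close>.\<close>

lemma exists_profile:
  fixes l M d :: real
  assumes l: "0 < l" "l < M" and d: "0 \<le> d" "d < M"
  obtains g \<gamma> K where "smooth g" "\<And>s. -1 \<le> s \<Longrightarrow> s \<le> 0 \<Longrightarrow> g s = l * s" "g 1 = l"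
    "(g has_real_derivative l) (at 0)" "(g has_real_derivative \<gamma>) (at 1)"
    "- M \<le> \<gamma>" "\<gamma> + 2 * d \<le> M" "M-lipschitz_on UNIV g" "\<And>s. \<bar>g s\<bar> \<le> K"
proof -
  \<comment> \<open>\<open>c\<close> is the excess slope. The slope \<open>l + c\<close> may not
    exceed \<open>M\<close>, and the slope at 1 will be at most \<open>2 * c - M\<close>, so that
    \<open>c + d \<le> M\<close> gives the bound required of \<open>\<gamma>\<close>.\<close>
  define c where "c = min (M - l) (M - d)"
  have c: "c > 0" "l + c \<le> M" "c + d \<le> M" "c \<le> M" using l d by (auto simp: c_def)
  \<comment> \<open>\<open>C\<close> is the total drop of slope in the bend, from
    \<open>l + c\<close> towards \<open>c - M\<close>.\<close>
  define C where "C = l + M"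
  have C: "C > 0" "c \<le> C" using l c by (auto simp: C_def)
  \<comment> \<open>At the scaled argument \<open>x\<close> the bend has completed all but the
    fraction \<open>c / C\<close> of its drop.\<close>
  define x where "x = 1 + C / c"
  have x: "x \<ge> 1" using C c by (simp add: x_def)
  have "1 / x ^ 2 \<le> 1 / x" using x by (simp add: field_simps power2_eq_square)
  also have "\<dots> \<le> c / C" using c C by (simp add: x_def field_simps)
  finally have hx: "flat [:1, 1:] x \<ge> 1 - c / C" using flat_11_ge[of x] x by linarith
  \<comment> \<open>\<open>\<sigma>\<close> balances the excess gained against the loss in the bend,
    so that \<open>g 1 = l\<close>. The bend starts at \<open>s1\<close> below, placed so that the
    point 1 has the scaled argument \<open>x\<close>.\<close>
  define \<sigma> where "\<sigma> = c * smooth_pos 1 / (C * smooth_pos x)"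
  have h1: "smooth_pos 1 > 0" by (simp add: smooth_pos_pos)
  have hx0: "smooth_pos x > 0" using x by (simp add: smooth_pos_pos)
  have \<sigma>0: "\<sigma> > 0" unfolding \<sigma>_def using c C h1 hx0 by simp
  have "c * smooth_pos 1 \<le> C * smooth_pos x"
    using c C h1 x by (intro mult_mono smooth_pos_mono) auto
  then have \<sigma>1: "\<sigma> \<le> 1" unfolding \<sigma>_def using C hx0 by (simp add: divide_le_eq_1)
  have "c * exp (- 1) \<le> C * exp (- 1 / x)"
    using c C x by (intro mult_mono) auto
  then have \<sigma>x: "\<sigma> * x \<le> 1" unfolding \<sigma>_def using C x by (simp add: smooth_pos_pos field_simps)
  define s1 where "s1 = 1 - \<sigma> * x"
  have s1: "0 \<le> s1" "s1 \<le> 1" using \<sigma>x \<sigma>0 x by (auto simp: s1_def)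
  \<comment> \<open>The last two terms compensate the slope far to the right and far to the left,
    which makes \<open>g\<close> bounded.\<close>
  define g where "g s = l * s + c * smooth_pos s - C * \<sigma> * smooth_pos ((s - s1) / \<sigma>)
      + (M - c) * smooth_pos (s - 3) + l * smooth_pos (- s - 1)" for s
  define g' where "g' s = l + c * flat [:1, 1:] s - C * flat [:1, 1:] ((s - s1) / \<sigma>)
      + (M - c) * flat [:1, 1:] (s - 3) - l * flat [:1, 1:] (- s - 1)" for s
  have aff: "smooth (\<lambda>s. smooth_pos (a * s + b))" for a b
    by (intro smooth_compose_real[OF smooth_smooth_pos]
        smooth_add smooth_mult smooth_const smooth_id)
  have g_eq: "g = (\<lambda>s. l * s + c * smooth_pos (1 * s + 0) + (- C * \<sigma>) * smooth_pos ((1 / \<sigma>) * s + (- s1 / \<sigma>))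
      + (M - c) * smooth_pos (1 * s + (-3)) + l * smooth_pos ((-1) * s + (-1)))"
    by (auto simp: g_def diff_divide_distrib)
  have 1: "smooth g"
    unfolding g_eq by (intro smooth_add smooth_mult
      smooth_const smooth_id aff)
  have Dg: "(g has_real_derivative g' s) (at s)" for s
    unfolding g_def g'_def using \<sigma>0
    by (auto intro!: derivative_eq_intros simp: field_simps)
  note hp = flat_11_nonneg flat_11_le_1
  have b: "\<bar>g' s\<bar> \<le> M" for s
  proof -
    consider "s \<le> 0" | "0 < s" "s \<le> 3" | "3 < s" by linarith
    then show ?thesis
    proof cases
      case 1
      then have "(s - s1) / \<sigma> \<le> 0" using s1 \<sigma>0 by (simp add: divide_le_0_iff)
      then have "g' s = l * (1 - flat [:1, 1:] (- s - 1))" using 1 by (simp add: g'_def right_diff_distrib)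
      moreover have "0 \<le> l * (1 - flat [:1, 1:] (- s - 1))" using l hp by simp
      moreover have "l * (1 - flat [:1, 1:] (- s - 1)) \<le> l * 1" using l hp by (intro mult_left_mono) auto
      ultimately show ?thesis using l by linarith
    next
      case 2
      then have e: "g' s = l + c * flat [:1, 1:] s - C * flat [:1, 1:] ((s - s1) / \<sigma>)" by (simp add: g'_def)
      have "c * flat [:1, 1:] s \<le> c" "0 \<le> c * flat [:1, 1:] s"
        "C * flat [:1, 1:] ((s - s1) / \<sigma>) \<le> C" "0 \<le> C * flat [:1, 1:] ((s - s1) / \<sigma>)"
        using c C hp by (auto simp: mult_left_le)
      then show ?thesis unfolding e using c l C_def by linarith
    next
      case 3
      \<comment> \<open>The correction at 3 starts later and is less sharp than the bend, so it
        never gives back more than the bend has subtracted.\<close>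
      define A B where "A = flat [:1, 1:] ((s - s1) / \<sigma>)" and "B = flat [:1, 1:] (s - 3)"
      have e: "g' s = l + c * flat [:1, 1:] s - C * A + (M - c) * B" using 3 by (simp add: g'_def A_def B_def)
      have "s - s1 \<le> (s - s1) / \<sigma>" using \<sigma>0 \<sigma>1 3 s1 by (simp add: le_divide_eq mult_left_le)
      then have AB: "B \<le> A" unfolding A_def B_def using s1 by (intro flat_11_mono) auto
      have "(M - c) * B \<le> C * A" "0 \<le> (M - c) * B" "C * A \<le> C"
        using AB c C l hp by (auto intro!: mult_mono simp: C_def A_def B_def mult_left_le)
      moreover have "c * flat [:1, 1:] s \<le> c" "0 \<le> c * flat [:1, 1:] s"
        using c hp by (auto simp: mult_left_le)
      ultimately show ?thesis unfolding e using c l C_def by linarith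
    qed
  qed
  \<comment> \<open>\<open>m\<close> is the piecewise linear skeleton of \<open>g\<close>; the two
    differ by at most the sum of the coefficients of the \<open>smooth_pos\<close> terms.\<close>
  define m where "m s = l * s + c * max s 0 - C * max (s - s1) 0 + (M - c) * max (s - 3) 0 + l * max (- s - 1) 0" for s
  have m: "\<bar>m s\<bar> \<le> 3 * (l + c) + 3 * C + C + 3 * M" for s
  proof -
    consider "s \<le> -1" | "-1 \<le> s" "s \<le> 0" | "0 \<le> s" "s \<le> s1" | "s1 \<le> s" "s \<le> 3" | "3 \<le> s" by linarith
    then show ?thesis
    proof cases
      case 1
      then have "m s = - l" using s1 by (auto simp: m_def max_def algebra_simps)
      then show ?thesis using l c C by simp
    next
      case 2
      then have "m s = l * s" using s1 by (simp add: m_def max_def)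
      moreover have "l * s \<le> 0" "l * (- 1) \<le> l * s"
        using l 2 mult_left_mono[of "-1" s l] by (auto simp: mult_le_0_iff)
      ultimately show ?thesis using l c C unfolding abs_le_iff by simp
    next
      case 3
      then have "m s = (l + c) * s" using s1 by (simp add: m_def max_def algebra_simps)
      moreover have "0 \<le> (l + c) * s" "(l + c) * s \<le> l + c" using l c 3 s1 by (auto simp: mult_left_le)
      ultimately show ?thesis using l c C unfolding abs_le_iff distrib_right by (auto simp: algebra_simps)
    next
      case 4
      define X Y where "X = (l + c) * s" and "Y = C * (s - s1)"
      have "m s = X - Y" using 4 s1 by (simp add: m_def max_def X_def Y_def algebra_simps)
      moreover have "0 \<le> X" "X \<le> (l + c) * 3" "0 \<le> Y" "Y \<le> C * 3"
        using l c C 4 s1 mult_left_mono[of s 3 "l + c"] mult_left_mono[of "s - s1" 3 C]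
        by (auto simp: X_def Y_def)
      ultimately show ?thesis using l c C unfolding abs_le_iff by simp
    next
      case 5
      define X where "X = C * s1"
      have "m s = X - 3 * (M - c)" using 5 s1 by (simp add: m_def max_def C_def X_def algebra_simps)
      moreover have "0 \<le> X" "X \<le> C" using C s1 by (auto simp: X_def mult_left_le)
      ultimately show ?thesis using l c C unfolding abs_le_iff by simp
    qed
  qed
  have bd: "\<bar>g s\<bar> \<le> (3 * (l + c) + 3 * C + C + 3 * M) + (c + C * \<sigma> + (M - c) + l)" for s
  proof -
    have *: "\<bar>a * smooth_pos t - a * max t 0\<bar> \<le> a" if "a \<ge> 0" for a t
      using mult_left_mono[OF smooth_pos_approx[of t] that] that by (simp add: abs_mult flip: right_diff_distrib)
    have sc: "C * \<sigma> * max ((s - s1) / \<sigma>) 0 = C * max (s - s1) 0"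
      using \<sigma>0 by (simp add: max_def divide_le_0_iff)
    define q where "q a t = a * smooth_pos t - a * max t 0" for a t
    have q: "q a t \<le> a" "- a \<le> q a t" if "a \<ge> 0" for a t
      using *[OF that, of t] by (simp_all add: q_def abs_le_iff)
    have e: "g s = m s + q c s - q (C * \<sigma>) ((s - s1) / \<sigma>) + q (M - c) (s - 3) + q l (- s - 1)"
      unfolding g_def m_def q_def sc by simp
    have "C * \<sigma> \<ge> 0" "c \<ge> 0" "M - c \<ge> 0" "l \<ge> 0" using c C l \<sigma>0 by auto
    then show ?thesis
      using q[of c s] q[of "C * \<sigma>" "(s - s1) / \<sigma>"] q[of "M - c" "s - 3"] q[of l "- s - 1"] m[of s]
      unfolding e abs_le_iff by linarith
  qed
  have xs: "(1 - s1) / \<sigma> = x" using \<sigma>0 by (simp add: s1_def)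
  have g1: "g 1 = l"
    unfolding g_def xs using C hx0 by (simp add: \<sigma>_def)
  have g'1: "g' 1 = l + c * flat [:1, 1:] 1 - C * flat [:1, 1:] x" unfolding g'_def xs by simp
  show ?thesis
  proof (rule that[OF 1 _ g1 _ Dg _ _ lipschitz_on_DERIV[OF Dg b] bd])
    show "g s = l * s" if "-1 \<le> s" "s \<le> 0" for s
    proof -
      have "(s - s1) / \<sigma> \<le> 0" using s1 \<sigma>0 that by (simp add: divide_le_0_iff)
      then show ?thesis using that by (simp add: g_def)
    qed
    have "(0 - s1) / \<sigma> \<le> 0" using s1 \<sigma>0 by (simp add: divide_le_0_iff)
    then have "g' 0 = l" by (simp add: g'_def)
    then show "(g has_real_derivative l) (at 0)" using Dg[of 0] by simp
    show "- M \<le> g' 1" using b[of 1] by linarith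
    have "c * flat [:1, 1:] 1 \<le> c" using c hp by (auto simp: mult_left_le)
    moreover have "C * (1 - c / C) \<le> C * flat [:1, 1:] x" using hx C by (intro mult_left_mono) auto
    moreover have "C * (1 - c / C) = C - c" using C by (simp add: right_diff_distrib)
    ultimately have "g' 1 \<le> 2 * c - M" unfolding g'1 by (simp add: C_def)
    then show "g' 1 + 2 * d \<le> M" using c by linarith
    show "0 \<le> M" using l by simp
  qed
qed

text \<open>Multiplied by \<open>\<beta>\<close>, the slope 1 at 1 supplies the entry of the
  rotation at \<open>e 0\<close> that leads from mode 0 to mode 1. The zeros preserve the equilibria
  on the first axis, and the flatness at 0 keeps mode 0 uncoupled there.\<close>

lemma exists_flat_bump:
  obtains k :: "real \<Rightarrow> real" and C where "smooth k" "\<And>s. s \<le> 0 \<Longrightarrow> k s = 0" "k 1 = 0"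
    "(k has_real_derivative 0) (at 0)" "(k has_real_derivative 1) (at 1)"
    "C-lipschitz_on UNIV k" "\<And>s. \<bar>k s\<bar> \<le> C"
proof -
  \<comment> \<open>\<open>b\<close> makes the two flat functions cancel at 1, and \<open>a\<close>
    normalises the slope there, which is \<open>a * exp (- 1) / 2\<close>.\<close>
  define a :: real where "a = 2 * exp 1"
  have a: "a \<ge> 0" by (simp add: a_def)
  define b :: real where "b = exp (- 1 / 2)"
  have b: "0 \<le> b" "b \<le> 1" by (auto simp: b_def)
  define k where "k s = a * (flat 1 s + (- b) * flat 1 (2 * s))" for s
  define p :: "real poly" where "p = pCons 0 (pCons 0 (1 - pderiv 1))"
  define k' where "k' s = a * (flat p s + (- b) * (2 * flat p (2 * s)))" for s
  have 1: "smooth k"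
    unfolding k_def
    by (intro smooth_add smooth_mult smooth_const
        smooth_id smooth_flat
        smooth_compose_real[OF smooth_flat])
  have Dk: "(k has_real_derivative k' s) (at s)" for s
    unfolding k_def k'_def p_def
    by (auto intro!: derivative_eq_intros simp: algebra_simps)
  have f: "0 \<le> flat 1 s" "flat 1 s \<le> 1" for s by (auto simp: flat_def)
  have fp: "0 \<le> flat p s" "flat p s \<le> 4" for s
  proof -
    show "0 \<le> flat p s" by (auto simp: flat_def p_def)
    show "flat p s \<le> 4"
    proof (cases "s > 0")
      case True
      define y where "y = 1 / s"
      have y: "y > 0" using True by (simp add: y_def)
      have "y / 2 \<le> exp (y / 2)" using exp_ge_add_one_self[of "y / 2"] by linarith
      then have "(y / 2) ^ 2 \<le> exp (y / 2) ^ 2" using y by (intro power_mono) auto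
      also have "exp (y / 2) ^ 2 = exp y" by (simp flip: exp_double)
      finally have "y * y \<le> 4 * exp y" by (simp add: power2_eq_square)
      then have "y * y * exp (- y) \<le> 4 * exp y * exp (- y)" by (intro mult_right_mono) auto
      also have "\<dots> = 4" by (simp add: mult.assoc flip: exp_add)
      finally show ?thesis using True by (simp add: flat_def p_def y_def)
    qed auto
  qed
  have k'b: "\<bar>k' s\<bar> \<le> 12 * a" for s
  proof -
    have "0 \<le> b * (2 * flat p (2 * s))" "b * (2 * flat p (2 * s)) \<le> 1 * 8"
      using b fp[of "2 * s"] mult_mono[of b 1 "2 * flat p (2 * s)" 8] by auto
    then have "\<bar>flat p s + (- b) * (2 * flat p (2 * s))\<bar> \<le> 12"
      using fp[of s] by (simp add: abs_le_iff)
    then show ?thesis unfolding k'_def abs_mult using a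
      by (metis abs_of_nonneg mult.commute mult_left_mono)
  qed
  have kb: "\<bar>k s\<bar> \<le> 12 * a" for s
  proof -
    have "0 \<le> b * flat 1 (2 * s)" "b * flat 1 (2 * s) \<le> 1 * 1"
      using b f[of "2 * s"] by (auto intro!: mult_nonneg_nonneg mult_le_one)
    then have "\<bar>flat 1 s + (- b) * flat 1 (2 * s)\<bar> \<le> 12"
      using f[of s] by (simp add: abs_le_iff)
    then show ?thesis unfolding k_def abs_mult using a
      by (metis abs_of_nonneg mult.commute mult_left_mono)
  qed
  have bb: "b * b = exp (- 1)" "b * exp (- (1 / 2)) = exp (- 1)" by (auto simp: b_def simp flip: exp_add)
  show ?thesis
  proof (rule that[OF 1 _ _ _ _ lipschitz_on_DERIV[OF Dk k'b] kb])
    show "k s = 0" if "s \<le> 0" for s using that by (simp add: k_def)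
    show "k 1 = 0" using bb by (simp add: k_def flat_def)
    show "(k has_real_derivative 0) (at 0)" using Dk[of 0] by (simp add: k'_def)
    have "k' 1 = a * (exp (- 1) - b * exp (- (1 / 2)) / 2)" by (simp add: k'_def flat_def p_def)
    also have "\<dots> = exp 1 * exp (- 1)" unfolding bb by (simp add: a_def)
    finally have "k' 1 = 1" by (simp flip: exp_add)
    then show "(k has_real_derivative 1) (at 1)" using Dk[of 1] by simp
  qed (use a in auto)
qed

section \<open>Coordinates in the eigenbasis\<close>

locale eigenbasis =
  fixes e :: "nat \<Rightarrow> 'a::{real_inner,complete_space}" and lam :: "nat \<Rightarrow> real"
  assumes spectral: "spectral_data e lam"
begin

lemma inner_e: "e i \<bullet> e j = (if i = j then 1 else 0)"
  and closure_span_e: "closure (span (range e)) = UNIV"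
  and lam0_pos: "0 < lam 0"
  and mono_lam: "mono lam"
  and lam_at_top: "filterlim lam at_top sequentially"
  using spectral by (auto simp: spectral_data_def)

lemma lam_pos: "0 < lam n"
  using monoD[OF mono_lam, of 0 n] lam0_pos by simp

lemma norm_e [simp]: "norm (e n) = 1"
  by (simp add: norm_eq_sqrt_inner inner_e)

lemma orthogonal_all_imp_0:
  assumes "\<And>n. z \<bullet> e n = 0"
  shows "z = 0"
proof -
  have "span (range e) \<subseteq> {w. z \<bullet> w = 0}"
    by (rule span_minimal) (auto simp: assms subspace_def inner_right_distrib)
  then have "closure (span (range e)) \<subseteq> {w. z \<bullet> w = 0}"
    by (rule closure_minimal) (intro closed_Collect_eq continuous_intros)
  then have "z \<bullet> z = 0" unfolding closure_span_e by blast
  then show ?thesis by simp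
qed

lemma coord_eqI:
  assumes "\<And>n. x \<bullet> e n = y \<bullet> e n"
  shows "x = y"
  using orthogonal_all_imp_0[of "x - y"] assms by (simp add: inner_diff_left)

lemma inner_sum_e:
  assumes "finite I"
  shows "(\<Sum>i\<in>I. c i *\<^sub>R e i) \<bullet> e n = (if n \<in> I then c n else 0)"
  using assms by (simp add: inner_sum_left inner_e if_distrib sum.delta cong: if_cong)

lemma norm_sum_e:
  assumes "finite I"
  shows "norm (\<Sum>i\<in>I. c i *\<^sub>R e i) = L2_set c I"
proof -
  have "(\<Sum>i\<in>I. c i *\<^sub>R e i) \<bullet> (\<Sum>i\<in>I. c i *\<^sub>R e i) = (\<Sum>i\<in>I. (c i)\<^sup>2)"
    unfolding inner_sum_right using assms by (auto intro!: sum.cong simp: inner_sum_e power2_eq_square)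
  then show ?thesis by (simp add: norm_eq_sqrt_inner L2_set_def)
qed

lemma bessel:
  assumes "finite I"
  shows "L2_set (\<lambda>i. x \<bullet> e i) I \<le> norm x"
proof -
  define y where "y = (\<Sum>i\<in>I. (x \<bullet> e i) *\<^sub>R e i)"
  have "y \<bullet> x = (\<Sum>i\<in>I. (x \<bullet> e i)\<^sup>2)"
    unfolding y_def inner_sum_left by (simp add: power2_eq_square inner_commute)
  also have "\<dots> = (norm y)\<^sup>2"
    using assms by (simp add: y_def norm_sum_e L2_set_def sum_nonneg)
  finally have "norm y * norm y \<le> norm y * norm x"
    using norm_cauchy_schwarz[of y x] by (simp add: power2_eq_square)
  then have "norm y \<le> norm x" by (cases "norm y = 0") auto
  then show ?thesis using assms by (simp add: y_def norm_sum_e)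
qed

lemma riesz_fischer:
  assumes "\<And>N. L2_set c {..<N} \<le> M"
  obtains x where "\<And>n. x \<bullet> e n = c n" "norm x \<le> M" "(\<lambda>N. \<Sum>n<N. c n *\<^sub>R e n) \<longlonglongrightarrow> x"
proof -
  define S where "S N = (\<Sum>n<N. c n *\<^sub>R e n)" for N
  have "summable (\<lambda>n. (c n)\<^sup>2)"
  proof (rule summableI_nonneg_bounded)
    fix N
    have "L2_set c {..<N} \<ge> 0" "L2_set c {..<N} \<le> M" using assms by (auto simp: L2_set_nonneg)
    then have "(L2_set c {..<N})\<^sup>2 \<le> M\<^sup>2" by (intro power_mono)
    then show "(\<Sum>n<N. (c n)\<^sup>2) \<le> M\<^sup>2" by (simp add: L2_set_def sum_nonneg)
  qed auto
  then have "Cauchy (\<lambda>N. \<Sum>n<N. (c n)\<^sup>2)"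
    by (simp add: summable_iff_convergent Cauchy_convergent_iff)
  have S_diff: "(norm (S n - S m))\<^sup>2 = (\<Sum>i<n. (c i)\<^sup>2) - (\<Sum>i<m. (c i)\<^sup>2)" if "m \<le> n" for m n
  proof -
    have "S n - S m = (\<Sum>i=m..<n. c i *\<^sub>R e i)"
      using that sum_diff_nat_ivl[of 0 m n "\<lambda>i. c i *\<^sub>R e i"] by (simp add: S_def atLeast0LessThan)
    moreover have "(\<Sum>i<n. (c i)\<^sup>2) - (\<Sum>i<m. (c i)\<^sup>2) = (\<Sum>i=m..<n. (c i)\<^sup>2)"
      using that sum_diff_nat_ivl[of 0 m n "\<lambda>i. (c i)\<^sup>2"] by (simp add: atLeast0LessThan)
    ultimately show ?thesis by (simp add: norm_sum_e L2_set_def sum_nonneg)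
  qed
  have "Cauchy S"
  proof (rule CauchyI')
    fix \<epsilon> :: real assume "\<epsilon> > 0"
    then obtain N where N: "\<And>m n. m \<ge> N \<Longrightarrow> n \<ge> N \<Longrightarrow> dist (\<Sum>i<m. (c i)\<^sup>2) (\<Sum>i<n. (c i)\<^sup>2) < \<epsilon>\<^sup>2"
      using \<open>Cauchy (\<lambda>N. \<Sum>n<N. (c n)\<^sup>2)\<close> unfolding Cauchy_def by (metis zero_less_power)
    have "dist (S m) (S n) < \<epsilon>" if "m \<ge> N" "n > m" for m n
    proof -
      have "(norm (S n - S m))\<^sup>2 < \<epsilon>\<^sup>2"
        using S_diff[of m n] N[of n m] that by (simp add: dist_real_def)
      then show ?thesis using \<open>\<epsilon> > 0\<close> by (simp add: dist_norm norm_minus_commute power2_less_imp_less)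
    qed
    then show "\<exists>N. \<forall>m\<ge>N. \<forall>n>m. dist (S m) (S n) < \<epsilon>" by blast
  qed
  then obtain x where x: "S \<longlonglongrightarrow> x" by (auto simp: Cauchy_convergent_iff convergent_def)
  show ?thesis
  proof (rule that)
    fix n
    have "(\<lambda>N. S N \<bullet> e n) \<longlonglongrightarrow> x \<bullet> e n" by (intro tendsto_inner x tendsto_const)
    moreover have "eventually (\<lambda>N. S N \<bullet> e n = c n) sequentially"
      using eventually_gt_at_top[of n] by eventually_elim (simp add: S_def inner_sum_e)
    ultimately show "x \<bullet> e n = c n"
      by (metis LIMSEQ_unique tendsto_eventually)
  next
    show "norm x \<le> M"
      by (rule LIMSEQ_le_const2[OF tendsto_norm[OF x]]) (use assms in \<open>auto simp: S_def norm_sum_e\<close>)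
    show "(\<lambda>N. \<Sum>n<N. c n *\<^sub>R e n) \<longlonglongrightarrow> x" using x by (simp add: S_def[abs_def])
  qed
qed

lemma norm_le_coords:
  assumes "\<And>N. L2_set (\<lambda>n. x \<bullet> e n) {..<N} \<le> M"
  shows "norm x \<le> M"
  by (rule riesz_fischer[OF assms]) (metis coord_eqI)

lemma expansion_tendsto: "(\<lambda>N. \<Sum>n<N. (x \<bullet> e n) *\<^sub>R e n) \<longlonglongrightarrow> x"
proof -
  have "\<And>N. L2_set (\<lambda>n. x \<bullet> e n) {..<N} \<le> norm x" by (rule bessel) auto
  from riesz_fischer[OF this] show ?thesis by (metis coord_eqI)
qed

lemma norm_tail_le:
  assumes "\<And>K. L2_set (\<lambda>n. x \<bullet> e n) {N..<K} \<le> \<epsilon>"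
  shows "norm (x - (\<Sum>n<N. (x \<bullet> e n) *\<^sub>R e n)) \<le> \<epsilon>"
proof (rule norm_le_coords)
  fix K
  have "(\<Sum>i<K. ((x - (\<Sum>n<N. (x \<bullet> e n) *\<^sub>R e n)) \<bullet> e i)\<^sup>2) = (\<Sum>i=N..<K. (x \<bullet> e i)\<^sup>2)"
    by (rule sum.mono_neutral_cong_right) (auto simp: inner_diff_left inner_sum_e)
  then show "L2_set (\<lambda>i. (x - (\<Sum>n<N. (x \<bullet> e n) *\<^sub>R e n)) \<bullet> e i) {..<K} \<le> \<epsilon>"
    using assms[of K] by (simp add: L2_set_def)
qed

lemma tail_tendsto: "(\<lambda>N. norm (x - (\<Sum>n<N. (x \<bullet> e n) *\<^sub>R e n))) \<longlonglongrightarrow> 0"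
  using tendsto_norm[OF tendsto_diff[OF tendsto_const[of x] expansion_tendsto[of x]]] by simp

lemma L2_tail_le: "L2_set (\<lambda>n. x \<bullet> e n) {N..<K} \<le> norm (x - (\<Sum>n<N. (x \<bullet> e n) *\<^sub>R e n))"
proof -
  have "L2_set (\<lambda>i. x \<bullet> e i) {N..<K} = L2_set (\<lambda>i. (x - (\<Sum>n<N. (x \<bullet> e n) *\<^sub>R e n)) \<bullet> e i) {N..<K}"
    by (intro L2_set_cong) (auto simp: inner_diff_left inner_sum_e)
  then show ?thesis using bessel[of "{N..<K}"] by simp
qed

section \<open>Weighted permutations of coordinates and compactness by tails\<close>

definition weighted_permutation :: "(nat \<Rightarrow> real) \<Rightarrow> (nat \<Rightarrow> nat) \<Rightarrow> 'a \<Rightarrow> 'a" where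
  "weighted_permutation m \<sigma> u = (THE x. \<forall>n. x \<bullet> e n = m n * (u \<bullet> e (\<sigma> n)))"

text \<open>Riesz-Fischer produces the vector, since injectivity of \<open>\<sigma>\<close> lets
  Bessel's inequality bound the permuted coordinates. Diagonal operators, rotations by a right angle
  in planes of two modes and the quarter-turn operators are all of this form.\<close>

lemma weighted_permutation:
  assumes "inj \<sigma>" "\<And>n. \<bar>m n\<bar> \<le> M"
  shows weighted_permutation_coord: "weighted_permutation m \<sigma> u \<bullet> e n = m n * (u \<bullet> e (\<sigma> n))"
    and norm_weighted_permutation_le: "norm (weighted_permutation m \<sigma> u) \<le> M * norm u"
proof -
  have M: "M \<ge> 0" using assms(2)[of 0] by linarith
  have b: "L2_set (\<lambda>n. m n * (u \<bullet> e (\<sigma> n))) {..<N} \<le> M * norm u" for N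
  proof -
    have "L2_set (\<lambda>n. m n * (u \<bullet> e (\<sigma> n))) {..<N} = L2_set (\<lambda>n. \<bar>m n * (u \<bullet> e (\<sigma> n))\<bar>) {..<N}"
      by (simp add: L2_set_def)
    also have "\<dots> \<le> L2_set (\<lambda>n. M * \<bar>u \<bullet> e (\<sigma> n)\<bar>) {..<N}"
      by (intro L2_set_mono) (auto simp: abs_mult intro!: mult_right_mono assms)
    also have "\<dots> = M * L2_set (\<lambda>n. u \<bullet> e (\<sigma> n)) {..<N}"
      using M by (simp add: L2_set_def power_mult_distrib real_sqrt_mult flip: sum_distrib_left)
    also have "L2_set (\<lambda>n. u \<bullet> e (\<sigma> n)) {..<N} = L2_set (\<lambda>n. u \<bullet> e n) (\<sigma> ` {..<N})"
      unfolding L2_set_def by (subst sum.reindex) (auto intro: inj_on_subset[OF assms(1)])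
    also have "\<dots> \<le> norm u" by (rule bessel) auto
    finally show ?thesis using M by (simp add: mult_left_mono)
  qed
  obtain x where x: "\<And>n. x \<bullet> e n = m n * (u \<bullet> e (\<sigma> n))" "norm x \<le> M * norm u"
    using riesz_fischer[OF b] by metis
  then have "weighted_permutation m \<sigma> u = x"
    unfolding weighted_permutation_def by (intro the_equality) (auto intro: coord_eqI)
  then show "weighted_permutation m \<sigma> u \<bullet> e n = m n * (u \<bullet> e (\<sigma> n))"
    "norm (weighted_permutation m \<sigma> u) \<le> M * norm u"
    using x by auto
qed

lemma bounded_linear_weighted_permutation:
  assumes "inj \<sigma>" "\<And>n. \<bar>m n\<bar> \<le> M"
  shows "bounded_linear (weighted_permutation m \<sigma>)"
proof (rule bounded_linear_intro[where K = M])
  note c = weighted_permutation_coord[OF assms]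
  fix x y r
  show "weighted_permutation m \<sigma> (x + y) = weighted_permutation m \<sigma> x + weighted_permutation m \<sigma> y"
    by (rule coord_eqI) (simp add: c inner_add_left distrib_left)
  show "weighted_permutation m \<sigma> (r *\<^sub>R x) = r *\<^sub>R weighted_permutation m \<sigma> x"
    by (rule coord_eqI) (simp add: c)
  show "norm (weighted_permutation m \<sigma> x) \<le> norm x * M"
    using norm_weighted_permutation_le[OF assms] by (simp add: mult.commute)
qed

text \<open>On basis vectors the claim is the sign rule for \<open>m\<close>; it extends to
  \<open>u\<close> through the expansion of \<open>u\<close> and continuity. At a fixed point of
  \<open>\<sigma>\<close> the sign rule makes the weight 0.\<close>

lemma weighted_permutation_antisymmetric:
  assumes \<sigma>: "\<And>n. \<sigma> (\<sigma> n) = n" and m: "\<And>n. \<bar>m n\<bar> \<le> M" and anti: "\<And>n. m (\<sigma> n) = - m n"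
  shows "weighted_permutation m \<sigma> u \<bullet> v = - (u \<bullet> weighted_permutation m \<sigma> v)"
proof -
  have inj: "inj \<sigma>" using \<sigma> by (metis injI)
  define V where "V = weighted_permutation m \<sigma>"
  have c: "V u \<bullet> e n = m n * (u \<bullet> e (\<sigma> n))" for u n
    unfolding V_def by (rule weighted_permutation_coord[OF inj m])
  have bl: "bounded_linear V" unfolding V_def by (rule bounded_linear_weighted_permutation[OF inj m])
  have Ve: "V (e n) = m (\<sigma> n) *\<^sub>R e (\<sigma> n)" for n
    by (rule coord_eqI) (auto simp: c inner_e \<sigma>)
  have "V (\<Sum>n<N. (u \<bullet> e n) *\<^sub>R e n) \<bullet> v = - ((\<Sum>n<N. (u \<bullet> e n) *\<^sub>R e n) \<bullet> V v)" for N
    by (simp add: linear_sum[OF bounded_linear.linear[OF bl]] linear_scale[OF bounded_linear.linear[OF bl]] Ve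
        inner_sum_left sum_negf[symmetric] inner_commute[of "e _"] c anti mult.assoc)
  moreover have "(\<lambda>N. V (\<Sum>n<N. (u \<bullet> e n) *\<^sub>R e n) \<bullet> v) \<longlonglongrightarrow> V u \<bullet> v"
    by (intro tendsto_inner tendsto_const bounded_linear.tendsto[OF bl] expansion_tendsto)
  moreover have "(\<lambda>N. - ((\<Sum>n<N. (u \<bullet> e n) *\<^sub>R e n) \<bullet> V v)) \<longlonglongrightarrow> - (u \<bullet> V v)"
    by (intro tendsto_minus tendsto_inner tendsto_const expansion_tendsto)
  ultimately show ?thesis unfolding V_def[symmetric] by (simp add: LIMSEQ_unique)
qed

text \<open>Uniformly small tails reduce total boundedness to that of a finite-dimensional box of
  coordinates.\<close>

lemma compact_uniform_tails:
  assumes bounded: "\<And>x. x \<in> X \<Longrightarrow> norm x \<le> R" and "closed X"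
    and tails: "\<And>\<epsilon>. \<epsilon> > 0 \<Longrightarrow> \<exists>N. \<forall>x\<in>X. norm (x - (\<Sum>n<N. (x \<bullet> e n) *\<^sub>R e n)) \<le> \<epsilon>"
  shows "compact X"
  unfolding compact_eq_totally_bounded
proof (intro conjI allI impI)
  show "complete X" using \<open>closed X\<close> by (simp add: complete_eq_closed)
  \<comment> \<open>The box is a sum of segments, one for each coordinate, hence compact by
    induction.\<close>
  have box: "compact {(\<Sum>n<N. c n *\<^sub>R e n) | c. \<forall>n<N. \<bar>c n\<bar> \<le> R}" for N
  proof (induction N)
    case (Suc N)
    have "compact ((\<lambda>r. r *\<^sub>R e N) ` {-R..R})"
      by (intro compact_continuous_image continuous_intros compact_Icc)
    from compact_sums[OF Suc this]
    have "compact {x + y |x y. x \<in> {(\<Sum>n<N. c n *\<^sub>R e n) | c. \<forall>n<N. \<bar>c n\<bar> \<le> R} \<and> y \<in> (\<lambda>r. r *\<^sub>R e N) ` {-R..R}}" .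
    also have "{x + y |x y. x \<in> {(\<Sum>n<N. c n *\<^sub>R e n) | c. \<forall>n<N. \<bar>c n\<bar> \<le> R} \<and> y \<in> (\<lambda>r. r *\<^sub>R e N) ` {-R..R}}
       = {(\<Sum>n<Suc N. c n *\<^sub>R e n) | c. \<forall>n<Suc N. \<bar>c n\<bar> \<le> R}" (is "?A = ?B")
    proof
      show "?A \<subseteq> ?B"
      proof
        fix z assume "z \<in> ?A"
        then obtain c r where z: "z = (\<Sum>n<N. c n *\<^sub>R e n) + r *\<^sub>R e N" "\<forall>n<N. \<bar>c n\<bar> \<le> R" "\<bar>r\<bar> \<le> R"
          by (auto simp: abs_le_iff)
        have "z = (\<Sum>n<Suc N. (c(N := r)) n *\<^sub>R e n)" using z by simp
        moreover have "\<forall>n<Suc N. \<bar>(c(N := r)) n\<bar> \<le> R" using z by (auto simp: less_Suc_eq)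
        ultimately show "z \<in> ?B" by blast
      qed
      show "?B \<subseteq> ?A"
      proof
        fix z assume "z \<in> ?B"
        then obtain c where c: "z = (\<Sum>n<N. c n *\<^sub>R e n) + c N *\<^sub>R e N" "\<forall>n<Suc N. \<bar>c n\<bar> \<le> R" by auto
        then have "\<bar>c N\<bar> \<le> R" by simp
        then have "c N *\<^sub>R e N \<in> (\<lambda>r. r *\<^sub>R e N) ` {-R..R}"
          by (intro imageI) (simp add: abs_le_iff)
        moreover have "(\<Sum>n<N. c n *\<^sub>R e n) \<in> {(\<Sum>n<N. c n *\<^sub>R e n) | c. \<forall>n<N. \<bar>c n\<bar> \<le> R}"
          using c(2) less_SucI by blast
        ultimately show "z \<in> ?A" using c(1) by blast
      qed
    qed
    finally show ?case .
  qed auto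
  fix \<epsilon> :: real assume "\<epsilon> > 0"
  then obtain N where N: "\<And>x. x \<in> X \<Longrightarrow> norm (x - (\<Sum>n<N. (x \<bullet> e n) *\<^sub>R e n)) \<le> \<epsilon> / 2"
    using tails[of "\<epsilon> / 2"] by auto
  from box[of N] obtain k where k: "finite k"
    "{(\<Sum>n<N. c n *\<^sub>R e n) | c. \<forall>n<N. \<bar>c n\<bar> \<le> R} \<subseteq> (\<Union>x\<in>k. ball x (\<epsilon> / 2))"
    unfolding compact_eq_totally_bounded using \<open>\<epsilon> > 0\<close> half_gt_zero by meson
  have "X \<subseteq> (\<Union>x\<in>k. ball x \<epsilon>)"
  proof
    fix x assume x: "x \<in> X"
    define p where "p = (\<Sum>n<N. (x \<bullet> e n) *\<^sub>R e n)"
    have "\<bar>x \<bullet> e n\<bar> \<le> R" for n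
      using Cauchy_Schwarz_ineq2[of x "e n"] bounded[OF x] by simp
    then have "p \<in> {(\<Sum>n<N. c n *\<^sub>R e n) | c. \<forall>n<N. \<bar>c n\<bar> \<le> R}" unfolding p_def by (intro CollectI exI[of _ "\<lambda>n. x \<bullet> e n"]) simp
    then obtain y where y: "y \<in> k" "dist y p < \<epsilon> / 2" using k(2) by auto
    have "dist x p \<le> \<epsilon> / 2" using N[OF x] by (simp add: p_def dist_norm)
    then have "dist y x < \<epsilon>" using y dist_triangle[of y x p] by (simp add: dist_commute)
    then show "x \<in> (\<Union>x\<in>k. ball x \<epsilon>)" using y by auto
  qed
  then show "\<exists>k. finite k \<and> X \<subseteq> (\<Union>x\<in>k. ball x \<epsilon>)" using k(1) by blast
qed

section \<open>Mild solutions\<close>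

text \<open>\<open>G\<close> is an arbitrary forcing rather than \<open>F\<close> along a solution:
  differences of solutions and deviations from an equilibrium then have the same form.\<close>

definition duhamel_coord :: "'a \<Rightarrow> (real \<Rightarrow> 'a) \<Rightarrow> nat \<Rightarrow> real \<Rightarrow> real" where
  "duhamel_coord a G n t = exp (- lam n * t) * (a \<bullet> e n)
     + integral {0..t} (\<lambda>s. exp (- lam n * (t - s)) * (G s \<bullet> e n))"

lemma duhamel_coord_0 [simp]: "duhamel_coord a G n 0 = a \<bullet> e n"
  by (simp add: duhamel_coord_def)

lemma duhamel_coord_cong:
  "(\<And>s. 0 \<le> s \<Longrightarrow> s \<le> t \<Longrightarrow> G s = H s) \<Longrightarrow> duhamel_coord a G n t = duhamel_coord a H n t"
  unfolding duhamel_coord_def by (intro arg_cong2[of _ _ _ _ "(+)"] refl integral_cong) auto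

lemma duhamel_coord_integrable:
  assumes "continuous_on {0..t} G"
  shows "(\<lambda>s. exp (- lam n * (t - s)) * (G s \<bullet> e n)) integrable_on {0..t}"
  by (intro integrable_continuous_interval continuous_intros assms)

lemma duhamel_coord_diff:
  assumes "continuous_on {0..t} G" "continuous_on {0..t} H"
  shows "duhamel_coord a G n t - duhamel_coord b H n t = duhamel_coord (a - b) (\<lambda>s. G s - H s) n t"
  unfolding duhamel_coord_def
  using integral_diff[OF duhamel_coord_integrable[OF assms(1), of n] duhamel_coord_integrable[OF assms(2), of n]]
  by (simp add: inner_diff_left right_diff_distrib)

text \<open>With the factor \<open>exp (- lam n * t)\<close> outside, the integrand no longer
  depends on \<open>t\<close>, and the fundamental theorem of calculus gives the derivative.\<close>

lemma duhamel_coord_alt: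
  "duhamel_coord a G n t = exp (- lam n * t) * (a \<bullet> e n + integral {0..t} (\<lambda>s. exp (lam n * s) * (G s \<bullet> e n)))"
proof -
  have "(\<lambda>s. exp (- lam n * (t - s)) * (G s \<bullet> e n)) = (\<lambda>s. exp (- lam n * t) * (exp (lam n * s) * (G s \<bullet> e n)))"
    by (auto simp: algebra_simps simp flip: exp_add)
  then show ?thesis by (simp add: duhamel_coord_def distrib_left)
qed

lemma DERIV_duhamel_coord:
  assumes "continuous_on {0..T} G" "t \<in> {0..T}"
  shows "(duhamel_coord a G n has_real_derivative - lam n * duhamel_coord a G n t + G t \<bullet> e n) (at t within {0..T})"
proof -
  have "((\<lambda>t. integral {0..t} (\<lambda>s. exp (lam n * s) * (G s \<bullet> e n))) has_real_derivative exp (lam n * t) * (G t \<bullet> e n)) (at t within {0..T})"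
    by (intro integral_has_real_derivative continuous_intros assms)
  then show ?thesis
    unfolding duhamel_coord_alt[abs_def]
    by (auto intro!: derivative_eq_intros simp: algebra_simps simp flip: exp_add)
qed

lemma continuous_on_duhamel_coord:
  "continuous_on {0..T} G \<Longrightarrow> continuous_on {0..T} (duhamel_coord a G n)"
  by (rule DERIV_continuous_on) (rule DERIV_duhamel_coord)

text \<open>All modes in \<open>I\<close> decay at least as fast as mode \<open>N\<close>. The
  weights \<open>c\<close> will be the Duhamel coordinates themselves.\<close>

lemma L2_weighted:
  assumes "finite I" "\<And>n. n \<in> I \<Longrightarrow> N \<le> n" "0 \<le> \<tau>"
  shows "(\<Sum>n\<in>I. c n * (exp (- lam n * \<tau>) * (x \<bullet> e n))) \<le> L2_set c I * (exp (- lam N * \<tau>) * L2_set (\<lambda>n. x \<bullet> e n) I)"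
proof -
  have "(\<Sum>n\<in>I. c n * (exp (- lam n * \<tau>) * (x \<bullet> e n))) \<le> (\<Sum>n\<in>I. \<bar>c n\<bar> * \<bar>exp (- lam N * \<tau>) * (x \<bullet> e n)\<bar>)"
  proof (rule sum_mono)
    fix n assume n: "n \<in> I"
    have "lam N * \<tau> \<le> lam n * \<tau>"
      using monoD[OF mono_lam assms(2)[OF n]] assms(3) by (intro mult_right_mono) auto
    then have "exp (- lam n * \<tau>) * \<bar>x \<bullet> e n\<bar> \<le> exp (- lam N * \<tau>) * \<bar>x \<bullet> e n\<bar>"
      by (intro mult_right_mono) auto
    then have "\<bar>c n\<bar> * (exp (- lam n * \<tau>) * \<bar>x \<bullet> e n\<bar>) \<le> \<bar>c n\<bar> * (exp (- lam N * \<tau>) * \<bar>x \<bullet> e n\<bar>)"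
      by (intro mult_left_mono) auto
    moreover have "c n * (exp (- lam n * \<tau>) * (x \<bullet> e n)) \<le> \<bar>c n\<bar> * (exp (- lam n * \<tau>) * \<bar>x \<bullet> e n\<bar>)"
      using abs_ge_self[of "c n * (exp (- lam n * \<tau>) * (x \<bullet> e n))"] by (simp only: abs_mult abs_exp_cancel)
    ultimately show "c n * (exp (- lam n * \<tau>) * (x \<bullet> e n)) \<le> \<bar>c n\<bar> * \<bar>exp (- lam N * \<tau>) * (x \<bullet> e n)\<bar>"
      by (simp only: abs_mult abs_exp_cancel)
  qed
  also have "\<dots> \<le> L2_set c I * L2_set (\<lambda>n. exp (- lam N * \<tau>) * (x \<bullet> e n)) I"
    by (rule L2_set_mult_ineq)
  also have "L2_set (\<lambda>n. exp (- lam N * \<tau>) * (x \<bullet> e n)) I = exp (- lam N * \<tau>) * L2_set (\<lambda>n. x \<bullet> e n) I"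
    by (rule L2_set_right_distrib[symmetric]) simp
  finally show ?thesis .
qed

lemma has_integral_exp_convolution:
  fixes p \<kappa> t :: real
  assumes "0 \<le> t" "0 < \<kappa> + p"
  shows "((\<lambda>s. exp (- p * (t - s)) * exp (\<kappa> * s)) has_integral (exp (\<kappa> * t) - exp (- p * t)) / (\<kappa> + p)) {0..t}"
proof -
  have "((\<lambda>s. exp (- p * (t - s)) * exp (\<kappa> * s)) has_integral
      exp ((\<kappa> + p) * t - p * t) / (\<kappa> + p) - exp ((\<kappa> + p) * 0 - p * t) / (\<kappa> + p)) {0..t}"
  proof (rule fundamental_theorem_of_calculus[OF assms(1)])
    fix s
    have "((\<lambda>s. exp ((\<kappa> + p) * s - p * t) / (\<kappa> + p)) has_real_derivative
        exp ((\<kappa> + p) * s - p * t) * (\<kappa> + p) / (\<kappa> + p)) (at s within {0..t})"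
      by (auto intro!: derivative_eq_intros)
    also have "exp ((\<kappa> + p) * s - p * t) * (\<kappa> + p) / (\<kappa> + p) = exp (- p * (t - s)) * exp (\<kappa> * s)"
    proof -
      have "(\<kappa> + p) * s - p * t = - p * (t - s) + \<kappa> * s" by (simp add: algebra_simps)
      then show ?thesis using assms(2) by (simp flip: exp_add)
    qed
    finally show "((\<lambda>s. exp ((\<kappa> + p) * s - p * t) / (\<kappa> + p)) has_vector_derivative
        exp (- p * (t - s)) * exp (\<kappa> * s)) (at s within {0..t})"
      by (simp add: has_real_derivative_iff_has_vector_derivative)
  qed
  then show ?thesis by (simp add: algebra_simps diff_divide_distrib)
qed

text \<open>An energy-type argument with scalar integrals: the squared norm of the coordinates is
  expanded by Duhamel's formula in one factor, Cauchy-Schwarz is applied under the integral, and the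
  common factor is divided out. The rate \<open>\<kappa> = 0\<close> serves bounds and tails,
  \<open>\<kappa> = 2 * L\<close> serves Gronwall and Picard.\<close>

lemma L2_duhamel_coord_le:
  assumes t: "0 \<le> t" and G: "continuous_on {0..t} G" and m: "\<And>s. 0 \<le> s \<Longrightarrow> s \<le> t \<Longrightarrow> norm (G s) \<le> m * exp (\<kappa> * s)"
    and \<kappa>: "0 \<le> \<kappa>" and I: "finite I" "\<And>n. n \<in> I \<Longrightarrow> N \<le> n"
  shows "L2_set (\<lambda>n. duhamel_coord a G n t) I
     \<le> exp (- lam N * t) * L2_set (\<lambda>n. a \<bullet> e n) I + m * ((exp (\<kappa> * t) - exp (- lam N * t)) / (\<kappa> + lam N))"
proof -
  define c where "c n = duhamel_coord a G n t" for n
  define S where "S = L2_set c I"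
  define J where "J = (exp (\<kappa> * t) - exp (- lam N * t)) / (\<kappa> + lam N)"
  have S: "S \<ge> 0" by (simp add: S_def L2_set_nonneg)
  have m0: "m \<ge> 0" using order_trans[OF norm_ge_zero m[of 0]] t by simp
  have kl: "\<kappa> + lam N > 0" using \<kappa> lam_pos[of N] by simp
  have "exp (- lam N * t) \<le> exp (\<kappa> * t)"
  proof -
    have "- lam N * t \<le> 0" "0 \<le> \<kappa> * t" using t \<kappa> lam_pos[of N] by auto
    then show ?thesis by simp
  qed
  then have J: "J \<ge> 0" unfolding J_def using kl by simp
  have "S\<^sup>2 = (\<Sum>n\<in>I. c n * c n)"
    by (simp add: S_def L2_set_def sum_nonneg power2_eq_square)
  also have "\<dots> = (\<Sum>n\<in>I. c n * (exp (- lam n * t) * (a \<bullet> e n))) +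
      (\<Sum>n\<in>I. c n * integral {0..t} (\<lambda>s. exp (- lam n * (t - s)) * (G s \<bullet> e n)))"
    by (subst (2) c_def) (simp add: duhamel_coord_def distrib_left sum.distrib)
  also have "(\<Sum>n\<in>I. c n * (exp (- lam n * t) * (a \<bullet> e n))) \<le> S * (exp (- lam N * t) * L2_set (\<lambda>n. a \<bullet> e n) I)"
    unfolding S_def by (rule L2_weighted[OF I t])
  also have "(\<Sum>n\<in>I. c n * integral {0..t} (\<lambda>s. exp (- lam n * (t - s)) * (G s \<bullet> e n))) =
      integral {0..t} (\<lambda>s. \<Sum>n\<in>I. c n * (exp (- lam n * (t - s)) * (G s \<bullet> e n)))"
    by (subst integral_sum) (use I in \<open>auto intro!: integrable_continuous_interval continuous_intros G\<close>)
  also have "\<dots> \<le> integral {0..t} (\<lambda>s. (S * m) * (exp (- lam N * (t - s)) * exp (\<kappa> * s)))"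
  proof (rule integral_le)
    show "(\<lambda>s. \<Sum>n\<in>I. c n * (exp (- lam n * (t - s)) * (G s \<bullet> e n))) integrable_on {0..t}"
      by (intro integrable_continuous_interval continuous_intros G)
    show "(\<lambda>s. (S * m) * (exp (- lam N * (t - s)) * exp (\<kappa> * s))) integrable_on {0..t}"
      by (intro integrable_continuous_interval continuous_intros)
    fix s assume s: "s \<in> {0..t}"
    have "(\<Sum>n\<in>I. c n * (exp (- lam n * (t - s)) * (G s \<bullet> e n))) \<le> S * (exp (- lam N * (t - s)) * L2_set (\<lambda>n. G s \<bullet> e n) I)"
      unfolding S_def by (rule L2_weighted[OF I]) (use s in auto)
    also have "\<dots> \<le> S * (exp (- lam N * (t - s)) * (m * exp (\<kappa> * s)))"
      using m[of s] s bessel[OF I(1), of "G s"] S by (intro mult_left_mono) auto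
    finally show "(\<Sum>n\<in>I. c n * (exp (- lam n * (t - s)) * (G s \<bullet> e n))) \<le> (S * m) * (exp (- lam N * (t - s)) * exp (\<kappa> * s))"
      by (simp add: mult_ac)
  qed
  also have "\<dots> = S * m * J"
    unfolding J_def using has_integral_mult_right[OF has_integral_exp_convolution[OF t kl], of "S * m"]
    by (rule integral_unique)
  finally have "S * S \<le> S * (exp (- lam N * t) * L2_set (\<lambda>n. a \<bullet> e n) I + m * J)"
    by (simp add: power2_eq_square distrib_left mult_ac)
  then have "S \<le> exp (- lam N * t) * L2_set (\<lambda>n. a \<bullet> e n) I + m * J"
    using S J m0 by (cases "S = 0") (auto simp: mult_le_cancel_left intro!: add_nonneg_nonneg mult_nonneg_nonneg L2_set_nonneg)
  then show ?thesis by (simp add: S_def c_def[abs_def] J_def)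
qed

lemma norm_duhamel_le:
  assumes "0 \<le> t" "continuous_on {0..t} G" "\<And>s. 0 \<le> s \<Longrightarrow> s \<le> t \<Longrightarrow> norm (G s) \<le> m * exp (\<kappa> * s)"
    and "0 \<le> \<kappa>" and x: "\<And>n. x \<bullet> e n = duhamel_coord a G n t"
  shows "norm x \<le> exp (- lam 0 * t) * norm a + m * ((exp (\<kappa> * t) - exp (- lam 0 * t)) / (\<kappa> + lam 0))"
proof (rule norm_le_coords)
  fix N
  have "L2_set (\<lambda>n. x \<bullet> e n) {..<N} \<le> exp (- lam 0 * t) * L2_set (\<lambda>n. a \<bullet> e n) {..<N} + m * ((exp (\<kappa> * t) - exp (- lam 0 * t)) / (\<kappa> + lam 0))"
    unfolding x by (rule L2_duhamel_coord_le[OF assms(1-4)]) auto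
  also have "exp (- lam 0 * t) * L2_set (\<lambda>n. a \<bullet> e n) {..<N} \<le> exp (- lam 0 * t) * norm a"
    by (intro mult_left_mono bessel) auto
  finally show "L2_set (\<lambda>n. x \<bullet> e n) {..<N} \<le> exp (- lam 0 * t) * norm a + m * ((exp (\<kappa> * t) - exp (- lam 0 * t)) / (\<kappa> + lam 0))"
    by simp
qed

text \<open>The forcing contributes at most \<open>m / lam N\<close> to the tail, whatever
  \<open>t\<close> is. As \<open>lam N\<close> tends to infinity, this yields continuity in time and
  compactness of the attractor.\<close>

lemma norm_duhamel_tail_le:
  assumes t: "0 \<le> t" and "continuous_on {0..t} G" and m: "\<And>s. 0 \<le> s \<Longrightarrow> s \<le> t \<Longrightarrow> norm (G s) \<le> m"
    and x: "\<And>n. x \<bullet> e n = duhamel_coord a G n t"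
  shows "norm (x - (\<Sum>n<N. (x \<bullet> e n) *\<^sub>R e n)) \<le> exp (- lam N * t) * norm (a - (\<Sum>n<N. (a \<bullet> e n) *\<^sub>R e n)) + m / lam N"
proof (rule norm_tail_le)
  fix K
  have m0: "m \<ge> 0" using order_trans[OF norm_ge_zero m[of 0]] t by simp
  have "L2_set (\<lambda>n. x \<bullet> e n) {N..<K} \<le> exp (- lam N * t) * L2_set (\<lambda>n. a \<bullet> e n) {N..<K} + m * ((exp (0 * t) - exp (- lam N * t)) / (0 + lam N))"
    unfolding x by (rule L2_duhamel_coord_le[OF assms(1-2)]) (use m in auto)
  also have "exp (- lam N * t) * L2_set (\<lambda>n. a \<bullet> e n) {N..<K} \<le> exp (- lam N * t) * norm (a - (\<Sum>n<N. (a \<bullet> e n) *\<^sub>R e n))"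
    by (intro mult_left_mono L2_tail_le) auto
  also have "m * ((exp (0 * t) - exp (- lam N * t)) / (0 + lam N)) \<le> m * (1 / lam N)"
    using m0 lam_pos[of N] by (intro mult_left_mono) (auto intro!: divide_right_mono)
  finally show "L2_set (\<lambda>n. x \<bullet> e n) {N..<K} \<le> exp (- lam N * t) * norm (a - (\<Sum>n<N. (a \<bullet> e n) *\<^sub>R e n)) + m / lam N"
    by simp
qed

text \<open>\<open>max t 0\<close> makes the curve constantly equal to \<open>a\<close> at negative
  times, in accordance with the normalisation of mild solutions.\<close>

definition duhamel :: "'a \<Rightarrow> (real \<Rightarrow> 'a) \<Rightarrow> real \<Rightarrow> 'a" where
  "duhamel a G t = (THE x. \<forall>n. x \<bullet> e n = duhamel_coord a G n (max t 0))"

lemma bounded_on_interval: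
  fixes G :: "real \<Rightarrow> 'b::real_normed_vector"
  assumes "continuous_on {0..t} G"
  obtains m where "\<And>s. 0 \<le> s \<Longrightarrow> s \<le> t \<Longrightarrow> norm (G s) \<le> m"
proof -
  have "bounded (G ` {0..t})" by (intro compact_imp_bounded compact_continuous_image assms compact_Icc)
  then show ?thesis using that unfolding bounded_iff by (metis atLeastAtMost_iff imageI)
qed

lemma duhamel_inner:
  assumes "0 \<le> t" "continuous_on {0..t} G"
  shows "duhamel a G t \<bullet> e n = duhamel_coord a G n t"
proof -
  obtain m where m: "\<And>s. 0 \<le> s \<Longrightarrow> s \<le> t \<Longrightarrow> norm (G s) \<le> m"
    using bounded_on_interval[OF assms(2)] by blast
  have "L2_set (\<lambda>n. duhamel_coord a G n t) {..<N} \<le> exp (- lam 0 * t) * norm a + m * ((exp (0 * t) - exp (- lam 0 * t)) / (0 + lam 0))" for N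
  proof -
    have "L2_set (\<lambda>n. duhamel_coord a G n t) {..<N} \<le> exp (- lam 0 * t) * L2_set (\<lambda>n. a \<bullet> e n) {..<N} + m * ((exp (0 * t) - exp (- lam 0 * t)) / (0 + lam 0))"
      by (rule L2_duhamel_coord_le[OF assms]) (use m in auto)
    moreover have "exp (- lam 0 * t) * L2_set (\<lambda>n. a \<bullet> e n) {..<N} \<le> exp (- lam 0 * t) * norm a"
      by (intro mult_left_mono bessel) auto
    ultimately show ?thesis by linarith
  qed
  from riesz_fischer[OF this] obtain x where x: "\<And>n. x \<bullet> e n = duhamel_coord a G n t" by metis
  have "duhamel a G t = x"
    unfolding duhamel_def using assms(1) x by (intro the_equality) (auto intro: coord_eqI simp: max_def)
  then show ?thesis using x by simp
qed

lemma duhamel_nonpos [simp]: "t \<le> 0 \<Longrightarrow> duhamel a G t = a"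
  unfolding duhamel_def by (intro the_equality) (auto intro: coord_eqI simp: max_def)

lemma continuous_on_halfline:
  fixes f :: "real \<Rightarrow> 'b::topological_space"
  assumes "\<And>T. 0 \<le> T \<Longrightarrow> continuous_on {0..T} f"
  shows "continuous_on {0..} f"
  unfolding continuous_on_eq_continuous_within
proof
  fix t :: real assume t: "t \<in> {0..}"
  have "at t within {0..} = at t within {0..t + 1}"
    by (rule at_within_nhd[of _ "{..<t + 1}"]) auto
  then show "continuous (at t within {0..}) f"
    using assms[of "t + 1"] t unfolding continuous_on_eq_continuous_within by (simp add: continuous_def)
qed

text \<open>On a bounded interval the tail estimate is uniform in time, so the curve is a uniform
  limit of finite sums with continuous coordinates.\<close>

lemma continuous_on_duhamel:
  assumes G: "continuous_on {0..} G"
  shows "continuous_on {0..} (duhamel a G)"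
proof (rule continuous_on_halfline)
  fix T :: real assume T: "0 \<le> T"
  have GT: "continuous_on {0..t} G" for t using G by (rule continuous_on_subset) auto
  obtain m where m: "\<And>s. 0 \<le> s \<Longrightarrow> s \<le> T \<Longrightarrow> norm (G s) \<le> m"
    using bounded_on_interval[OF GT] by blast
  show "continuous_on {0..T} (duhamel a G)"
  proof (rule uniform_limit_theorem)
    show "\<forall>\<^sub>F N in sequentially. continuous_on {0..T} (\<lambda>t. \<Sum>n<N. duhamel_coord a G n t *\<^sub>R e n)"
      by (intro always_eventually allI continuous_intros continuous_on_duhamel_coord GT)
    have lim: "(\<lambda>N. norm (a - (\<Sum>n<N. (a \<bullet> e n) *\<^sub>R e n)) + m / lam N) \<longlonglongrightarrow> 0 + 0"
      by (intro tendsto_add tail_tendsto tendsto_divide_0[OF tendsto_const filterlim_at_top_imp_at_infinity[OF lam_at_top]])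
    show "uniform_limit {0..T} (\<lambda>N t. \<Sum>n<N. duhamel_coord a G n t *\<^sub>R e n) (duhamel a G) sequentially"
    proof (rule uniform_limitI)
      fix \<epsilon> :: real assume "\<epsilon> > 0"
      then have "\<forall>\<^sub>F N in sequentially. norm (a - (\<Sum>n<N. (a \<bullet> e n) *\<^sub>R e n)) + m / lam N < \<epsilon>"
        using order_tendstoD(2)[OF lim] by simp
      then show "\<forall>\<^sub>F N in sequentially. \<forall>t\<in>{0..T}. dist (\<Sum>n<N. duhamel_coord a G n t *\<^sub>R e n) (duhamel a G t) < \<epsilon>"
      proof eventually_elim
        case (elim N)
        show ?case
        proof
          fix t assume t: "t \<in> {0..T}"
          have i: "duhamel a G t \<bullet> e n = duhamel_coord a G n t" for n
            using t by (intro duhamel_inner GT) auto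
          have "norm (duhamel a G t - (\<Sum>n<N. (duhamel a G t \<bullet> e n) *\<^sub>R e n))
              \<le> exp (- lam N * t) * norm (a - (\<Sum>n<N. (a \<bullet> e n) *\<^sub>R e n)) + m / lam N"
            by (rule norm_duhamel_tail_le[OF _ GT _ i]) (use t m in auto)
          also have "exp (- lam N * t) * norm (a - (\<Sum>n<N. (a \<bullet> e n) *\<^sub>R e n)) \<le> 1 * norm (a - (\<Sum>n<N. (a \<bullet> e n) *\<^sub>R e n))"
            using t lam_pos[of N] by (intro mult_right_mono) auto
          finally show "dist (\<Sum>n<N. duhamel_coord a G n t *\<^sub>R e n) (duhamel a G t) < \<epsilon>"
            using elim by (simp add: i dist_norm norm_minus_commute)
        qed
      qed
    qed
  qed simp
qed

text \<open>Gronwall's inequality, by absorption in the norm weighted with \<open>exp (- 2 * L * t)\<close>.\<close>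

lemma duhamel_gronwall:
  assumes L: "L > 0" and q: "q \<ge> 0" and cont: "continuous_on {0..} u" "continuous_on {0..} v"
    "continuous_on {0..} G" "continuous_on {0..} H"
    and u: "\<And>t n. 0 \<le> t \<Longrightarrow> u t \<bullet> e n = duhamel_coord a G n t"
    and v: "\<And>t n. 0 \<le> t \<Longrightarrow> v t \<bullet> e n = duhamel_coord b H n t"
    and T: "0 \<le> T"
    and GH: "\<And>t. 0 \<le> t \<Longrightarrow> t \<le> T \<Longrightarrow> norm (G t - H t) \<le> L * norm (u t - v t) + q * exp (2 * L * t)"
  shows "norm (u T - v T) \<le> exp (2 * L * T) * (2 * norm (a - b) + q / L)"
proof -
  have sub: "continuous_on {0..t} u" "continuous_on {0..t} v" "continuous_on {0..t} G" "continuous_on {0..t} H" for t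
    using cont by (auto intro: continuous_on_subset)
  define w where "w t = exp (- 2 * L * t) * norm (u t - v t)" for t
  have "continuous_on {0..T} w" unfolding w_def by (intro continuous_intros sub)
  then obtain r where r: "r \<in> {0..T}" "\<And>t. t \<in> {0..T} \<Longrightarrow> w t \<le> w r"
    using continuous_attains_sup[of "{0..T}" w] T by auto
  have uv: "norm (u t - v t) = w t * exp (2 * L * t)" for t
    by (simp add: w_def mult_ac flip: exp_add)
  have GHr: "norm (G t - H t) \<le> (L * w r + q) * exp (2 * L * t)" if "0 \<le> t" "t \<le> T" for t
  proof -
    have "L * (w t * exp (2 * L * t)) \<le> L * (w r * exp (2 * L * t))"
      using r(2)[of t] that L by (intro mult_left_mono mult_right_mono) auto
    then show ?thesis using GH[OF that] unfolding uv by (simp add: distrib_right mult_ac)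
  qed
  have w0: "w r \<ge> 0" by (simp add: w_def)
  have "norm (u r - v r) \<le> exp (- lam 0 * r) * norm (a - b) + (L * w r + q) * ((exp (2 * L * r) - exp (- lam 0 * r)) / (2 * L + lam 0))"
  proof (rule norm_duhamel_le)
    show "continuous_on {0..r} (\<lambda>s. G s - H s)" by (intro continuous_intros sub)
    show "(u r - v r) \<bullet> e n = duhamel_coord (a - b) (\<lambda>s. G s - H s) n r" for n
      using r u v by (simp add: inner_diff_left duhamel_coord_diff[OF sub(3,4), symmetric])
  qed (use r L GHr in auto)
  also have "exp (- lam 0 * r) * norm (a - b) \<le> exp (2 * L * r) * norm (a - b)"
  proof -
    have "- lam 0 * r \<le> 0" "0 \<le> 2 * L * r" using r lam0_pos L by auto
    then show ?thesis by (intro mult_right_mono) auto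
  qed
  also have "(L * w r + q) * ((exp (2 * L * r) - exp (- lam 0 * r)) / (2 * L + lam 0)) \<le> (L * w r + q) * (exp (2 * L * r) / (2 * L))"
    using L w0 q lam0_pos by (intro mult_left_mono frac_le) auto
  finally have "w r * exp (2 * L * r) \<le> exp (2 * L * r) * (norm (a - b) + (L * w r + q) / (2 * L))"
    unfolding uv by (simp add: distrib_left mult_ac)
  then have "w r \<le> norm (a - b) + (L * w r + q) / (2 * L)" by (simp add: mult.commute)
  \<comment> \<open>The weight with rate \<open>2 * L\<close> leaves only half of \<open>w r\<close>
    on the right, and this half is absorbed.\<close>
  also have "\<dots> = norm (a - b) + w r / 2 + q / L / 2" using L by (simp add: field_simps)
  finally have "w r \<le> 2 * norm (a - b) + q / L" by simp
  then have "w T \<le> 2 * norm (a - b) + q / L" using r(2)[of T] T by simp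
  then show ?thesis unfolding uv by (simp add: mult.commute)
qed

section \<open>Well-posedness for Lipschitz nonlinearities\<close>

lemma mild_solution_iff:
  "mild_solution e lam F u0 u \<longleftrightarrow> continuous_on {0..} u \<and> (\<forall>t<0. u t = u0) \<and>
     (\<forall>t\<ge>0. \<forall>n. u t \<bullet> e n = duhamel_coord u0 (\<lambda>s. F (u s)) n t)"
  by (simp add: mild_solution_def duhamel_coord_def)

lemma mild_solution_dist:
  assumes F: "L-lipschitz_on UNIV F" and L: "L > 0"
    and u: "mild_solution e lam F a u" and v: "mild_solution e lam F b v" and t: "0 \<le> t"
  shows "norm (u t - v t) \<le> exp (2 * L * t) * (2 * norm (a - b))"
proof -
  have cF: "continuous_on UNIV F" using F by (rule lipschitz_on_continuous_on)
  have "norm (u t - v t) \<le> exp (2 * L * t) * (2 * norm (a - b) + 0 / L)"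
  proof (rule duhamel_gronwall)
    show "continuous_on {0..} (\<lambda>s. F (u s))" "continuous_on {0..} (\<lambda>s. F (v s))"
      using u v by (auto intro: continuous_on_compose2[OF cF] simp: mild_solution_iff)
    show "norm (F (u s) - F (v s)) \<le> L * norm (u s - v s) + 0 * exp (2 * L * s)" for s
      using lipschitz_onD[OF F, of "u s" "v s"] by (simp add: dist_norm)
  qed (use u v L t in \<open>auto simp: mild_solution_iff\<close>)
  then show ?thesis by simp
qed

text \<open>Picard iteration for the rescaled unknown \<open>exp (- 2 * L * t) *\<^sub>R u t\<close>
  among bounded continuous functions: the weight gives the contraction factor 1/2 on the whole
  half-line at once.\<close>

lemma mild_solution_exists:
  assumes F: "L-lipschitz_on UNIV F" and L: "L > 0"
  shows "\<exists>u. mild_solution e lam F u0 u"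
proof -
  have cF: "continuous_on UNIV F" using F by (rule lipschitz_on_continuous_on)
  define G where "G w s = F (exp (2 * L * s) *\<^sub>R w s)" for w :: "real \<Rightarrow> 'a" and s
  \<comment> \<open>The iterates live on all of the reals; \<open>max t 0\<close> keeps the weight
    equal to 1 at negative times.\<close>
  define \<Psi> where "\<Psi> w t = exp (- 2 * L * max t 0) *\<^sub>R duhamel u0 (G w) t" for w t
  have cG: "continuous_on S (G (apply_bcontfun w))" for w S
    unfolding G_def by (intro continuous_on_compose2[OF cF] continuous_intros) auto
  have inner: "duhamel u0 (G (apply_bcontfun w)) t \<bullet> e n = duhamel_coord u0 (G (apply_bcontfun w)) n t"
    if "t \<ge> 0" for w t n using that cG by (intro duhamel_inner)
  have bc: "\<Psi> (apply_bcontfun w) \<in> bcontfun" for w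
    unfolding bcontfun_def
  proof (intro CollectI conjI)
    have "continuous_on UNIV (\<lambda>t. duhamel u0 (G (apply_bcontfun w)) (max t 0))"
      by (rule continuous_on_compose2[OF continuous_on_duhamel[OF cG]]) (auto intro!: continuous_intros)
    also have "(\<lambda>t. duhamel u0 (G (apply_bcontfun w)) (max t 0)) = duhamel u0 (G (apply_bcontfun w))"
      by (auto simp: max_def)
    finally show "continuous_on UNIV (\<Psi> (apply_bcontfun w))"
      unfolding \<Psi>_def by (intro continuous_intros)
    obtain B where B: "\<And>s. norm (apply_bcontfun w s) \<le> B"
      using bounded_apply_bcontfun[of w] unfolding bounded_iff by auto
    define m where "m = norm (F 0) + L * B"
    have B0: "B \<ge> 0" using B[of 0] norm_ge_zero order_trans by blast
    have m: "m \<ge> 0" using L B0 by (simp add: m_def)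
    have Gm: "norm (G (apply_bcontfun w) s) \<le> m * exp (2 * L * s)" if "s \<ge> 0" for s :: real
    proof -
      have "norm (G (apply_bcontfun w) s - F 0) \<le> L * (exp (2 * L * s) * norm (apply_bcontfun w s))"
        using lipschitz_onD[OF F, of "exp (2 * L * s) *\<^sub>R apply_bcontfun w s" 0] by (simp add: G_def dist_norm)
      also have "\<dots> \<le> L * (exp (2 * L * s) * B)" using B L by (intro mult_left_mono) auto
      finally have "norm (G (apply_bcontfun w) s) \<le> norm (F 0) + L * (exp (2 * L * s) * B)"
        using norm_triangle_ineq2[of "G (apply_bcontfun w) s" "F 0"] by linarith
      also have "norm (F 0) \<le> norm (F 0) * exp (2 * L * s)"
        using that L by (simp add: mult_le_cancel_left1)
      finally show ?thesis by (simp add: m_def algebra_simps)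
    qed
    have "norm (\<Psi> (apply_bcontfun w) t) \<le> norm u0 + m / (2 * L)" for t
    proof (cases "t \<ge> 0")
      case True
      have "norm (duhamel u0 (G (apply_bcontfun w)) t) \<le> exp (- lam 0 * t) * norm u0 + m * ((exp (2 * L * t) - exp (- lam 0 * t)) / (2 * L + lam 0))"
        by (rule norm_duhamel_le[OF True cG _ _ inner[OF True]]) (use Gm L in auto)
      also have "exp (- lam 0 * t) * norm u0 \<le> exp (2 * L * t) * norm u0"
      proof -
        have "- lam 0 * t \<le> 0" "0 \<le> 2 * L * t" using True lam0_pos L by auto
        then show ?thesis by (intro mult_right_mono) auto
      qed
      also have "m * ((exp (2 * L * t) - exp (- lam 0 * t)) / (2 * L + lam 0)) \<le> m * (exp (2 * L * t) / (2 * L))"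
        using L m lam0_pos by (intro mult_left_mono frac_le) auto
      finally have "norm (duhamel u0 (G (apply_bcontfun w)) t) \<le> exp (2 * L * t) * (norm u0 + m / (2 * L))"
        by (simp add: distrib_left mult_ac)
      then have "exp (- (2 * L * t)) * norm (duhamel u0 (G (apply_bcontfun w)) t)
          \<le> exp (- (2 * L * t)) * (exp (2 * L * t) * (norm u0 + m / (2 * L)))"
        by (intro mult_left_mono) auto
      also have "\<dots> = norm u0 + m / (2 * L)" by (simp flip: mult.assoc exp_add)
      finally show ?thesis using True by (simp add: \<Psi>_def max_def)
    next
      case False
      then show ?thesis using m L by (simp add: \<Psi>_def max_def)
    qed
    then show "bounded (range (\<Psi> (apply_bcontfun w)))" unfolding bounded_iff by blast
  qed
  define \<Phi> where "\<Phi> w = Bcontfun (\<Psi> (apply_bcontfun w))" for w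
  have \<Phi>: "apply_bcontfun (\<Phi> w) = \<Psi> (apply_bcontfun w)" for w
    unfolding \<Phi>_def by (rule Bcontfun_inverse[OF bc])
  have "dist (\<Phi> w) (\<Phi> z) \<le> 1 / 2 * dist w z" for w z
  proof (rule dist_bound)
    fix t
    show "dist (apply_bcontfun (\<Phi> w) t) (apply_bcontfun (\<Phi> z) t) \<le> 1 / 2 * dist w z"
    proof (cases "t \<ge> 0")
      case True
      have "norm (duhamel u0 (G (apply_bcontfun w)) t - duhamel u0 (G (apply_bcontfun z)) t)
        \<le> exp (- lam 0 * t) * norm (u0 - u0) + (L * dist w z) * ((exp (2 * L * t) - exp (- lam 0 * t)) / (2 * L + lam 0))"
      proof (rule norm_duhamel_le[OF True, where G = "\<lambda>s. G (apply_bcontfun w) s - G (apply_bcontfun z) s"])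
        fix s :: real assume s: "0 \<le> s"
        have "norm (G (apply_bcontfun w) s - G (apply_bcontfun z) s) \<le> L * (exp (2 * L * s) * dist (apply_bcontfun w s) (apply_bcontfun z s))"
          using lipschitz_onD[OF F, of "exp (2 * L * s) *\<^sub>R apply_bcontfun w s" "exp (2 * L * s) *\<^sub>R apply_bcontfun z s"]
          by (simp add: G_def dist_norm flip: scaleR_diff_right)
        also have "\<dots> \<le> L * (exp (2 * L * s) * dist w z)"
          using L dist_bounded[of w s z] by (intro mult_left_mono) auto
        finally show "norm (G (apply_bcontfun w) s - G (apply_bcontfun z) s) \<le> L * dist w z * exp (2 * L * s)"
          by (simp add: mult_ac)
      next
        show "(duhamel u0 (G (apply_bcontfun w)) t - duhamel u0 (G (apply_bcontfun z)) t) \<bullet> e n =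
          duhamel_coord (u0 - u0) (\<lambda>s. G (apply_bcontfun w) s - G (apply_bcontfun z) s) n t" for n
          unfolding duhamel_coord_diff[OF cG cG, symmetric] using inner[OF True] by (simp add: inner_diff_left)
      qed (use L in \<open>auto intro!: continuous_intros cG\<close>)
      also have "\<dots> \<le> (L * dist w z) * (exp (2 * L * t) / (2 * L))"
      proof -
        have "(exp (2 * L * t) - exp (- lam 0 * t)) / (2 * L + lam 0) \<le> exp (2 * L * t) / (2 * L)"
          using L lam0_pos by (intro frac_le) auto
        then have "(L * dist w z) * ((exp (2 * L * t) - exp (- lam 0 * t)) / (2 * L + lam 0))
            \<le> (L * dist w z) * (exp (2 * L * t) / (2 * L))"
          using L by (intro mult_left_mono) auto
        then show ?thesis by (simp only: diff_self norm_zero mult_zero_right add_0_left)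
      qed
      also have "\<dots> = exp (2 * L * t) * (1 / 2 * dist w z)" using L by simp
      finally have "norm (duhamel u0 (G (apply_bcontfun w)) t - duhamel u0 (G (apply_bcontfun z)) t) \<le> exp (2 * L * t) * (1 / 2 * dist w z)" .
      then have "exp (- (2 * L * t)) * norm (duhamel u0 (G (apply_bcontfun w)) t - duhamel u0 (G (apply_bcontfun z)) t)
          \<le> exp (- (2 * L * t)) * (exp (2 * L * t) * (1 / 2 * dist w z))"
        by (intro mult_left_mono) auto
      also have "\<dots> = 1 / 2 * dist w z" by (simp flip: mult.assoc exp_add)
      finally show ?thesis using True by (simp add: \<Phi> \<Psi>_def max_def dist_norm flip: scaleR_diff_right)
    next
      case False
      then show ?thesis by (simp add: \<Phi> \<Psi>_def)
    qed
  qed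
  then have "\<exists>!w. \<Phi> w = w" by (intro banach_fix_type[of "1 / 2"]) auto
  then obtain w where w: "\<Phi> w = w" by blast
  define u where "u t = duhamel u0 (G (apply_bcontfun w)) t" for t
  have uw: "u t = exp (2 * L * t) *\<^sub>R apply_bcontfun w t" if "t \<ge> 0" for t
  proof -
    have "apply_bcontfun w t = \<Psi> (apply_bcontfun w) t" using \<Phi>[of w] w by simp
    also have "\<dots> = exp (- (2 * L * t)) *\<^sub>R u t" using that by (simp add: \<Psi>_def u_def max_def)
    finally have "apply_bcontfun w t = exp (- (2 * L * t)) *\<^sub>R u t" .
    then show ?thesis by (simp flip: exp_add)
  qed
  have "mild_solution e lam F u0 u"
    unfolding mild_solution_iff
  proof (intro conjI allI impI)
    show "continuous_on {0..} u" unfolding u_def by (rule continuous_on_duhamel[OF cG])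
    show "u t = u0" if "t < 0" for t using that by (simp add: u_def)
    show "u t \<bullet> e n = duhamel_coord u0 (\<lambda>s. F (u s)) n t" if "t \<ge> 0" for t n
    proof -
      have "duhamel_coord u0 (\<lambda>s. F (u s)) n t = duhamel_coord u0 (G (apply_bcontfun w)) n t"
        by (rule duhamel_coord_cong) (simp add: uw G_def)
      then show ?thesis using inner[OF that] by (simp add: u_def)
    qed
  qed
  then show ?thesis by blast
qed

lemma mild_solution_unique:
  assumes F: "L-lipschitz_on UNIV F" and L: "L > 0"
    and u: "mild_solution e lam F a u" and v: "mild_solution e lam F a v"
  shows "u = v"
proof
  fix t
  show "u t = v t"
  proof (cases "t \<ge> 0")
    case True
    then show ?thesis using mild_solution_dist[OF assms True] by simp
  next
    case False
    then show ?thesis using u v by (simp add: mild_solution_def)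
  qed
qed

lemma lipschitz_well_posed:
  assumes "L-lipschitz_on UNIV F" "L > 0"
  shows "well_posed e lam F"
  unfolding well_posed_def using mild_solution_exists[OF assms] mild_solution_unique[OF assms] by blast

end

section \<open>Attractors and linearisation at equilibria\<close>

lemma decreasing_compact_Inter_nonempty:
  fixes C :: "nat \<Rightarrow> 'b::metric_space set"
  assumes compact: "\<And>n. compact (C n)" and ne: "\<And>n. C n \<noteq> {}" and dec: "decseq C"
  obtains x where "\<And>n. x \<in> C n"
proof -
  have "\<forall>n. \<exists>x. x \<in> C n" using ne by blast
  then obtain f where f: "\<And>n. f n \<in> C n" by metis
  have "f n \<in> C 0" for n using f[of n] decseqD[OF dec, of 0 n] by auto
  then obtain l r where l: "strict_mono r" "(f \<circ> r) \<longlonglongrightarrow> l"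
    using compact[of 0] unfolding compact_def by metis
  have "l \<in> C m" for m
  proof (rule Lim_in_closed_set[OF compact_imp_closed[OF compact] _ _ l(2)])
    show "\<forall>\<^sub>F n in sequentially. (f \<circ> r) n \<in> C m"
      using eventually_ge_at_top[of m]
    proof eventually_elim
      case (elim n)
      then have "m \<le> r n" using seq_suble[OF l(1), of n] by simp
      then show ?case using f[of "r n"] decseqD[OF dec] by (auto simp: o_def)
    qed
  qed simp
  then show ?thesis using that by blast
qed

text \<open>The attractor is the omega-limit set of a compact absorbing set. Invariance of
  \<open>K\<close> makes its images decrease in time; nested nonempty compact sets then supply
  preimages under \<open>S t\<close>, and also contradict a failure of attraction.\<close>

lemma global_attractor_exists:
  fixes S :: "real \<Rightarrow> 'b::metric_space \<Rightarrow> 'b"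
  assumes sg: "\<And>t r x. 0 \<le> t \<Longrightarrow> 0 \<le> r \<Longrightarrow> S (t + r) x = S t (S r x)"
    and cont: "\<And>t. 0 \<le> t \<Longrightarrow> continuous_on UNIV (S t)"
    and K: "compact K" "K \<noteq> {}" and inv: "\<And>t. 0 \<le> t \<Longrightarrow> S t ` K \<subseteq> K"
    and absorb: "\<And>B. bounded B \<Longrightarrow> \<exists>T\<ge>0. \<forall>t\<ge>T. S t ` B \<subseteq> K"
  shows "global_attractor S (\<Inter>n. S (real n) ` K)"
proof -
  define C where "C n = S (real n) ` K" for n
  have comp: "compact (C n)" for n
    unfolding C_def by (rule compact_continuous_image[OF continuous_on_subset[OF cont] K(1)]) auto
  have mono: "S s ` K \<subseteq> S r ` K" if "0 \<le> r" "r \<le> s" for r s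
  proof -
    have "S s ` K = S r ` (S (s - r) ` K)" using sg[of r "s - r"] that by (auto simp: image_image)
    also have "\<dots> \<subseteq> S r ` K" using that by (intro image_mono inv) auto
    finally show ?thesis .
  qed
  have dec: "decseq C" unfolding decseq_def C_def by (intro allI impI mono) auto
  have ne: "C n \<noteq> {}" for n using K by (simp add: C_def)
  define A where "A = (\<Inter>n. C n)"
  have "global_attractor S A"
    unfolding global_attractor_def
  proof (intro conjI allI impI)
    have "closed A" unfolding A_def by (intro closed_INT ballI compact_imp_closed comp)
    then show "compact A" using compact_Int_closed[OF comp[of 0]] by (metis A_def INT_lower Int_absorb1 UNIV_I)
    obtain x where "\<And>n. x \<in> C n" using decreasing_compact_Inter_nonempty[OF comp ne dec] by blast
    then show "A \<noteq> {}" by (auto simp: A_def)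
    fix t :: real assume t: "t \<ge> 0"
    show "S t ` A = A"
    proof
      show "S t ` A \<subseteq> A"
      proof clarify
        fix x assume x: "x \<in> A"
        show "S t x \<in> A" unfolding A_def
        proof
          fix n
          obtain k where k: "k \<in> K" "x = S (real n) k" using x by (auto simp: A_def C_def)
          then have "S t x = S (real n) (S t k)" using sg[of t "real n" k] sg[of "real n" t k] t by (simp add: add.commute)
          then show "S t x \<in> C n" using inv[OF t] k by (auto simp: C_def)
        qed
      qed
      show "A \<subseteq> S t ` A"
      proof
        fix y assume y: "y \<in> A"
        define E where "E n = C n \<inter> S t -` {y}" for n
        have "compact (E n)" for n
          unfolding E_def
          by (intro compact_Int_closed comp continuous_closed_vimage closed_singleton)
            (use cont[OF t] in \<open>simp add: continuous_on_eq_continuous_at\<close>)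
        moreover have "E n \<noteq> {}" for n
        proof -
          \<comment> \<open>\<open>y\<close> lies in the image at a time beyond
            \<open>t + real n\<close>, and the images decrease, so \<open>y\<close> has a preimage
            under \<open>S t\<close> in \<open>C n\<close>.\<close>
          obtain m :: nat where m: "t + real n \<le> real m" using real_arch_simple by blast
          have "y \<in> S (real m) ` K" using y by (auto simp: A_def C_def)
          then have "y \<in> S (t + real n) ` K" using mono[OF _ m] t by auto
          then show ?thesis using sg[of t "real n"] t by (auto simp: E_def C_def)
        qed
        moreover have "decseq E" using dec by (force simp: E_def decseq_def)
        ultimately obtain x where "\<And>n. x \<in> E n" using decreasing_compact_Inter_nonempty by blast
        then show "y \<in> S t ` A" by (auto simp: E_def A_def)
      qed
    qed
  next
    fix B :: "'b set" and \<epsilon> :: real assume B: "bounded B" and \<epsilon>: "\<epsilon> > 0"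
    have "\<exists>n. \<forall>x\<in>C n. infdist x A < \<epsilon>"
    proof (rule ccontr)
      assume *: "\<not> ?thesis"
      define E where "E n = C n \<inter> {x. \<epsilon> \<le> infdist x A}" for n
      have "compact (E n)" for n
        unfolding E_def by (intro compact_Int_closed comp closed_Collect_le continuous_intros)
      moreover have "E n \<noteq> {}" for n using * by (auto simp: E_def not_less)
      moreover have "decseq E" using dec by (force simp: E_def decseq_def)
      ultimately obtain x where "\<And>n. x \<in> E n" using decreasing_compact_Inter_nonempty by blast
      then have "x \<in> C n \<and> \<epsilon> \<le> infdist x A" for n by (auto simp: E_def)
      then have "\<And>n. x \<in> C n" and inf: "\<epsilon> \<le> infdist x A" by blast+
      then have "x \<in> A" by (simp add: A_def)
      then show False using \<epsilon> inf infdist_zero[of x A] by simp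
    qed
    then obtain n where n: "\<And>x. x \<in> C n \<Longrightarrow> infdist x A < \<epsilon>" by blast
    obtain T where T: "T \<ge> 0" "\<And>t. t \<ge> T \<Longrightarrow> S t ` B \<subseteq> K" using absorb[OF B] by blast
    show "\<exists>T. \<forall>t\<ge>T. \<forall>b\<in>B. infdist (S t b) A < \<epsilon>"
    proof (intro exI[of _ "T + real n"] allI impI ballI)
      fix t b assume t: "T + real n \<le> t" and b: "b \<in> B"
      have "S t b = S (real n) (S (t - real n) b)" using sg[of "real n" "t - real n" b] t T by simp
      moreover have "S (t - real n) b \<in> K" using T(2)[of "t - real n"] t b by auto
      ultimately show "infdist (S t b) A < \<epsilon>" by (intro n) (auto simp: C_def)
    qed
  qed
  then show ?thesis by (simp add: A_def C_def)
qed

text \<open>A point that does not move can be attracted only by a closed set that contains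
  it.\<close>

lemma global_attractor_equilibrium:
  assumes "global_attractor S A" "\<And>t. 0 \<le> t \<Longrightarrow> S t p = p"
  shows "p \<in> A"
proof -
  have cA: "compact A" "A \<noteq> {}" using assms(1) by (auto simp: global_attractor_def)
  have "bounded {p}" by simp
  then have att: "\<exists>T. \<forall>t\<ge>T. \<forall>b\<in>{p}. infdist (S t b) A < \<epsilon>" if "\<epsilon> > 0" for \<epsilon>
    using assms(1) that unfolding global_attractor_def by blast
  have "infdist p A \<le> 0"
  proof (rule field_le_epsilon)
    fix \<epsilon> :: real assume "\<epsilon> > 0"
    then obtain T where T: "\<And>t. t \<ge> T \<Longrightarrow> infdist (S t p) A < \<epsilon>" using att by blast
    show "infdist p A \<le> 0 + \<epsilon>" using T[of "max T 0"] assms(2)[of "max T 0"] by simp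
  qed
  then show ?thesis using cA in_closed_iff_infdist_zero[OF compact_imp_closed[OF cA(1)] cA(2), of p] infdist_nonneg[of p A] by simp
qed

section \<open>The semigroup of a Lipschitz equation\<close>

locale lipschitz_equation = eigenbasis +
  fixes F :: "'a \<Rightarrow> 'a" and L :: real
  assumes lipschitz: "L-lipschitz_on UNIV F" and L_pos: "L > 0"
begin

abbreviation "S \<equiv> solution_semigroup e lam F"

lemma F_continuous: "continuous_on UNIV F"
  using lipschitz by (rule lipschitz_on_continuous_on)

lemma norm_F_diff: "norm (F x - F y) \<le> L * norm (x - y)"
  using lipschitz_onD[OF lipschitz, of x y] by (simp add: dist_norm)

lemma S_eqI: "mild_solution e lam F a u \<Longrightarrow> S t a = u t"
  unfolding solution_semigroup_def
  using mild_solution_unique[OF lipschitz L_pos] by (metis the_equality)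

lemma mild_solution_S: "mild_solution e lam F a (\<lambda>t. S t a)"
proof -
  obtain u where u: "mild_solution e lam F a u" using mild_solution_exists[OF lipschitz L_pos] by blast
  then have "(\<lambda>t. S t a) = u" using S_eqI by blast
  then show ?thesis using u by simp
qed

lemma S_coord: "0 \<le> t \<Longrightarrow> S t a \<bullet> e n = duhamel_coord a (\<lambda>s. F (S s a)) n t"
  using mild_solution_S by (simp add: mild_solution_iff)

lemma S_0 [simp]: "S 0 a = a"
  by (rule coord_eqI) (simp add: S_coord)

lemma continuous_on_S: "continuous_on {0..} (\<lambda>t. S t a)"
  using mild_solution_S by (simp add: mild_solution_iff)

lemma continuous_on_F_S: "continuous_on {0..} (\<lambda>t. F (S t a))"
  by (rule continuous_on_compose2[OF F_continuous continuous_on_S]) simp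

lemma continuous_on_F_S_interval: "continuous_on {0..t} (\<lambda>s. F (S s a))"
  using continuous_on_F_S by (rule continuous_on_subset) auto

text \<open>The shifted trajectory is a mild solution from \<open>S r a\<close>, because the Duhamel
  integral splits at \<open>r\<close>; uniqueness identifies it.\<close>

lemma S_add:
  assumes "0 \<le> t" "0 \<le> r"
  shows "S (t + r) a = S t (S r a)"
proof -
  \<comment> \<open>At negative times the normalisation of mild solutions demands the initial value
    \<open>S r a\<close>, not the earlier part of the trajectory.\<close>
  define u where "u s = (if s < 0 then S r a else S (s + r) a)" for s
  have "mild_solution e lam F (S r a) u"
    unfolding mild_solution_iff
  proof (intro conjI allI impI)
    have "continuous_on {0..} (\<lambda>s. S (s + r) a)"
      by (rule continuous_on_compose2[OF continuous_on_S]) (use assms in \<open>auto intro!: continuous_intros\<close>)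
    then show "continuous_on {0..} u" by (rule continuous_on_eq) (auto simp: u_def)
    fix s :: real and n assume s: "0 \<le> s"
    define f where "f z = exp (lam n * z) * (F (S z a) \<bullet> e n)" for z
    have fc: "continuous_on {0..x} f" for x unfolding f_def by (intro continuous_intros continuous_on_F_S_interval)
    have f1: "integral {0..s} (\<lambda>z. exp (lam n * z) * (F (u z) \<bullet> e n)) = exp (- lam n * r) * integral {r..s + r} f"
    proof -
      have "integral {r..s + r} f = integral {0..s} (f \<circ> (+) r)"
        using integral_shift_Icc_real[of 0 s f r] by simp
      also have "\<dots> = integral {0..s} (\<lambda>z. exp (lam n * r) * (exp (lam n * z) * (F (u z) \<bullet> e n)))"
        by (rule integral_cong) (auto simp: f_def u_def distrib_left exp_add add.commute)
      also have "\<dots> = exp (lam n * r) * integral {0..s} (\<lambda>z. exp (lam n * z) * (F (u z) \<bullet> e n))"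
        by simp
      finally show ?thesis by (simp flip: mult.assoc exp_add)
    qed
    have f2: "integral {0..r} f + integral {r..s + r} f = integral {0..s + r} f"
      by (rule Henstock_Kurzweil_Integration.integral_combine) (use assms s fc in \<open>auto intro: integrable_continuous_interval\<close>)
    have "u s \<bullet> e n = exp (- lam n * (s + r)) * (a \<bullet> e n + integral {0..s + r} f)"
      using s assms by (simp add: u_def S_coord duhamel_coord_alt f_def[abs_def])
    also have "\<dots> = exp (- lam n * s) * (exp (- lam n * r) * (a \<bullet> e n + integral {0..r} f) + exp (- lam n * r) * integral {r..s + r} f)"
    proof -
      have "exp (- lam n * (s + r)) = exp (- lam n * s) * exp (- lam n * r)"
        by (simp add: algebra_simps flip: exp_add)
      then show ?thesis unfolding f2[symmetric] by (simp add: distrib_left mult_ac)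
    qed
    also have "\<dots> = duhamel_coord (S r a) (\<lambda>z. F (u z)) n s"
      unfolding duhamel_coord_alt f1 using assms by (simp add: S_coord duhamel_coord_alt f_def[abs_def])
    finally show "u s \<bullet> e n = duhamel_coord (S r a) (\<lambda>z. F (u z)) n s" .
  qed (simp add: u_def)
  from S_eqI[OF this, of t] show ?thesis using assms by (simp add: u_def)
qed

lemma S_lipschitz: "0 \<le> t \<Longrightarrow> norm (S t a - S t b) \<le> exp (2 * L * t) * (2 * norm (a - b))"
  using mild_solution_dist[OF lipschitz L_pos mild_solution_S mild_solution_S] .

lemma continuous_on_S_initial:
  assumes "0 \<le> t"
  shows "continuous_on UNIV (S t)"
proof (rule lipschitz_on_continuous_on)
  show "(exp (2 * L * t) * 2)-lipschitz_on UNIV (S t)"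
    using S_lipschitz[OF assms] by (intro lipschitz_onI) (auto simp: dist_norm mult.assoc)
qed

text \<open>Stationarity is tested in coordinates: the constant forcing
  \<open>lam n * (p \<bullet> e n)\<close> integrates to
  \<open>(1 - exp (- lam n * t)) * (p \<bullet> e n)\<close>, exactly what the decay
  removes.\<close>

lemma S_equilibrium:
  assumes F: "\<And>n. F p \<bullet> e n = lam n * (p \<bullet> e n)" and t: "0 \<le> t"
  shows "S t p = p"
proof -
  have "mild_solution e lam F p (\<lambda>_. p)"
    unfolding mild_solution_iff
  proof (intro conjI allI impI)
    fix t :: real and n assume t: "0 \<le> t"
    have "((\<lambda>s. exp (- lam n * (t - s)) * exp (0 * s) * (F p \<bullet> e n)) has_integral
        (exp (0 * t) - exp (- lam n * t)) / (0 + lam n) * (F p \<bullet> e n)) {0..t}"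
      using has_integral_mult_left[OF has_integral_exp_convolution[OF t, of 0 "lam n"], of "F p \<bullet> e n"] lam_pos[of n]
      by simp
    then have "integral {0..t} (\<lambda>s. exp (- lam n * (t - s)) * (F p \<bullet> e n)) = (1 - exp (- lam n * t)) * (p \<bullet> e n)"
      using lam_pos[of n] by (auto simp: F dest: integral_unique)
    then show "p \<bullet> e n = duhamel_coord p (\<lambda>s. F p) n t" by (simp add: duhamel_coord_def algebra_simps)
  qed auto
  from S_eqI[OF this] show ?thesis .
qed

context
  fixes K :: real
  assumes bounded_F: "\<And>x. norm (F x) \<le> K"
begin

text \<open>The bound is a weighted mean of \<open>norm a\<close> and \<open>K / lam 0\<close>, so
  balls around 0 of radius at least \<open>K / lam 0\<close> are invariant.\<close>

lemma norm_S_le: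
  assumes "0 \<le> t"
  shows "norm (S t a) \<le> exp (- lam 0 * t) * norm a + (1 - exp (- lam 0 * t)) * (K / lam 0)"
proof -
  have "norm (S t a) \<le> exp (- lam 0 * t) * norm a + K * ((exp (0 * t) - exp (- lam 0 * t)) / (0 + lam 0))"
    by (rule norm_duhamel_le[OF assms continuous_on_F_S_interval]) (use bounded_F S_coord[OF assms] in auto)
  then show ?thesis by (simp add: mult.commute)
qed

lemma S_tail_le:
  assumes "0 \<le> t"
  shows "norm (S t a - (\<Sum>n<N. (S t a \<bullet> e n) *\<^sub>R e n)) \<le> exp (- lam N * t) * norm a + K / lam N"
proof -
  have "norm (S t a - (\<Sum>n<N. (S t a \<bullet> e n) *\<^sub>R e n)) \<le> exp (- lam N * t) * norm (a - (\<Sum>n<N. (a \<bullet> e n) *\<^sub>R e n)) + K / lam N"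
    by (rule norm_duhamel_tail_le[OF assms continuous_on_F_S_interval]) (use bounded_F S_coord[OF assms] in auto)
  moreover have "norm (a - (\<Sum>n<N. (a \<bullet> e n) *\<^sub>R e n)) \<le> norm a"
  proof (rule norm_tail_le)
    show "L2_set (\<lambda>n. a \<bullet> e n) {N..<M} \<le> norm a" for M by (rule bessel) simp
  qed
  ultimately show ?thesis using mult_left_mono[of _ _ "exp (- lam N * t)"] by (smt (verit) exp_ge_zero)
qed

lemma global_attractor_S: "\<exists>A. global_attractor S A"
proof -
  have K0: "K \<ge> 0" using bounded_F[of 0] norm_ge_zero order_trans by blast
  \<comment> \<open>The summand 1 makes the ball absorbing in finite time.\<close>
  define R where "R = K / lam 0 + 1"
  have R: "R \<ge> 1" "K / lam 0 \<le> R" using K0 lam0_pos by (auto simp: R_def)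
  have inv: "S t a \<in> cball 0 R" if "0 \<le> t" "a \<in> cball 0 R" for t a
  proof -
    have E: "0 \<le> exp (- lam 0 * t)" "exp (- lam 0 * t) \<le> 1" using that lam0_pos by auto
    have "exp (- lam 0 * t) * norm a \<le> exp (- lam 0 * t) * R"
      "(1 - exp (- lam 0 * t)) * (K / lam 0) \<le> (1 - exp (- lam 0 * t)) * R"
      using that(2) E R by (intro mult_left_mono; simp)+
    then have "norm (S t a) \<le> exp (- lam 0 * t) * R + (1 - exp (- lam 0 * t)) * R"
      using norm_S_le[OF that(1), of a] by linarith
    then show ?thesis by (simp add: algebra_simps)
  qed
  define D where "D = S 1 ` cball 0 R"
  define tail where "tail N x = norm (x - (\<Sum>n<N. (x \<bullet> e n) *\<^sub>R e n))" for N x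
  \<comment> \<open>\<open>Y\<close> records, as closed conditions, what the flow has achieved after
    unit time: a norm bound and tail bounds that tend to 0.\<close>
  define Y where "Y = {x. norm x \<le> R \<and> (\<forall>N. tail N x \<le> exp (- lam N) * R + K / lam N)}"
  have Y_closed: "closed Y"
    unfolding Y_def tail_def
    by (intro closed_Collect_conj closed_Collect_all closed_Collect_le continuous_intros)
  have "compact Y"
  proof (rule compact_uniform_tails[OF _ Y_closed])
    show "norm x \<le> R" if "x \<in> Y" for x using that by (simp add: Y_def)
    fix \<epsilon> :: real assume "\<epsilon> > 0"
    have "(\<lambda>N. exp (- lam N) * R + K / lam N) \<longlonglongrightarrow> 0 * R + 0"
      by (intro tendsto_add tendsto_mult tendsto_const
          tendsto_divide_0[OF tendsto_const filterlim_at_top_imp_at_infinity[OF lam_at_top]]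
          filterlim_compose[OF exp_at_bot] filterlim_compose[OF filterlim_uminus_at_bot_at_top lam_at_top])
    then have "\<forall>\<^sub>F N in sequentially. exp (- lam N) * R + K / lam N < \<epsilon>"
      using order_tendstoD(2) \<open>\<epsilon> > 0\<close> by fastforce
    then obtain N where "exp (- lam N) * R + K / lam N < \<epsilon>"
      using eventually_happens'[OF sequentially_bot] by blast
    moreover have "tail N x \<le> exp (- lam N) * R + K / lam N" if "x \<in> Y" for x
      using that by (simp add: Y_def)
    ultimately have "\<forall>x\<in>Y. tail N x \<le> \<epsilon>" by force
    then show "\<exists>N. \<forall>x\<in>Y. norm (x - (\<Sum>n<N. (x \<bullet> e n) *\<^sub>R e n)) \<le> \<epsilon>"
      unfolding tail_def by blast
  qed
  have "D \<subseteq> Y"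
  proof
    fix x assume "x \<in> D"
    then obtain a where a: "norm a \<le> R" "x = S 1 a" by (auto simp: D_def)
    have "tail N x \<le> exp (- lam N) * R + K / lam N" for N
    proof -
      have "tail N x \<le> exp (- lam N * 1) * norm a + K / lam N"
        unfolding tail_def a(2) by (rule S_tail_le) simp
      moreover have "exp (- lam N * 1) * norm a \<le> exp (- lam N) * R" using a by simp
      ultimately show ?thesis by linarith
    qed
    then show "x \<in> Y" using inv[of 1 a] a by (simp add: Y_def)
  qed
  then have "closure D \<subseteq> Y" using Y_closed by (rule closure_minimal)
  then have "Y \<inter> closure D = closure D" by blast
  then have "compact (closure D)" using compact_Int_closed[OF \<open>compact Y\<close> closed_closure, of D] by simp
  moreover have "closure D \<noteq> {}" using R by (auto simp: D_def)
  moreover have "S t ` closure D \<subseteq> closure D" if t: "0 \<le> t" for t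
  proof -
    have "S t ` D \<subseteq> D"
    proof
      fix x assume "x \<in> S t ` D"
      then obtain a where a: "a \<in> cball 0 R" "x = S t (S 1 a)" by (auto simp: D_def)
      then have "x = S 1 (S t a)" using S_add[of t 1 a] S_add[of 1 t a] t by (simp add: add.commute)
      then show "x \<in> D" using inv[OF t a(1)] by (auto simp: D_def)
    qed
    then have "S t ` D \<subseteq> closure D" using closure_subset by blast
    then show ?thesis
      by (intro image_closure_subset) (use continuous_on_S_initial[OF t] in \<open>auto intro: continuous_on_subset\<close>)
  qed
  moreover have "\<exists>T\<ge>0. \<forall>t\<ge>T. S t ` B \<subseteq> closure D" if "bounded B" for B
  proof -
    obtain b where b: "b > 0" "\<And>x. x \<in> B \<Longrightarrow> norm x \<le> b" using \<open>bounded B\<close> bounded_pos by metis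
    \<comment> \<open>By \<open>1 + x \<le> exp x\<close>, this time brings the contribution of the
      initial value down to at most 1; the further unit of time below is spent on entering
      \<open>D\<close>.\<close>
    define T where "T = b / lam 0"
    have T: "T \<ge> 0" using b lam0_pos by (simp add: T_def)
    have "S t x \<in> D" if t: "t \<ge> T + 1" and x: "x \<in> B" for t x
    proof -
      define s where "s = t - 1"
      have s: "s \<ge> T" "s \<ge> 0" using t T by (auto simp: s_def)
      have "b \<le> lam 0 * s" using s lam0_pos by (simp add: T_def field_simps)
      then have "b \<le> exp (lam 0 * s)" using exp_ge_add_one_self[of "lam 0 * s"] by linarith
      then have "exp (- lam 0 * s) * b \<le> 1" by (simp add: exp_minus field_simps)
      moreover have "exp (- lam 0 * s) * norm x \<le> exp (- lam 0 * s) * b" using b(2)[OF x] by simp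
      moreover have "(1 - exp (- lam 0 * s)) * (K / lam 0) \<le> 1 * (K / lam 0)"
        using K0 lam0_pos by (intro mult_right_mono) auto
      ultimately have "norm (S s x) \<le> R" using norm_S_le[OF s(2), of x] unfolding R_def by linarith
      moreover have "S t x = S 1 (S s x)" using S_add[of 1 s x] s by (simp add: s_def)
      ultimately show ?thesis by (auto simp: D_def)
    qed
    then show ?thesis using T closure_subset by (intro exI[of _ "T + 1"]) auto
  qed
  ultimately show ?thesis
    using global_attractor_exists[of S "closure D"] S_add continuous_on_S_initial by blast
qed

end

end

section \<open>Differentiability of the semigroup at an equilibrium\<close>

context eigenbasis
begin

text \<open>The deviation from \<open>p\<close> and the linear flow start from the same
  \<open>h\<close>. Their forcings differ by at most \<open>L\<close> times their distance plus the
  Taylor remainder of \<open>F\<close>, which is small relative to \<open>norm h\<close>, and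
  Gronwall closes the estimate.\<close>

lemma solution_semigroup_linearization:
  assumes F: "L-lipschitz_on UNIV F" and B: "L-lipschitz_on UNIV B" and L: "L > 0"
    and eq: "\<And>n. F p \<bullet> e n = lam n * (p \<bullet> e n)" and D: "(F has_derivative B) (at p)"
    and t: "0 \<le> t" and V: "bounded_linear V" "\<And>h. solution_semigroup e lam B t h = V h"
  shows "(solution_semigroup e lam F t has_derivative V) (at p)"
proof -
  interpret F: lipschitz_equation e lam F L by unfold_locales (use F L in auto)
  interpret B: lipschitz_equation e lam B L by unfold_locales (use B L in auto)
  have lin: "linear B" using has_derivative_linear[OF D] .
  show ?thesis
    unfolding has_derivative_at_alt
  proof (intro conjI allI impI V(1))
    fix \<epsilon> :: real assume "\<epsilon> > 0"
    define M where "M = 2 * exp (2 * L * t)"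
    have M: "M > 0" by (simp add: M_def)
    \<comment> \<open>Gronwall multiplies the remainder by \<open>M / L\<close>, so that exactly
      \<open>\<epsilon>\<close> comes out.\<close>
    define \<epsilon>' where "\<epsilon>' = \<epsilon> * L / M"
    have \<epsilon>': "\<epsilon>' > 0" using \<open>\<epsilon> > 0\<close> L M by (simp add: \<epsilon>'_def)
    then obtain \<delta> where \<delta>: "\<delta> > 0" "\<And>y. norm (y - p) < \<delta> \<Longrightarrow> norm (F y - F p - B (y - p)) \<le> \<epsilon>' * norm (y - p)"
      using D unfolding has_derivative_at_alt by blast
    show "\<exists>d>0. \<forall>y. norm (y - p) < d \<longrightarrow> norm (F.S t y - F.S t p - V (y - p)) \<le> \<epsilon> * norm (y - p)"
    \<comment> \<open>Trajectories spread by at most the factor \<open>M\<close> up to time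
      \<open>t\<close>, so all of them stay within \<open>\<delta>\<close> of \<open>p\<close>,
      where the remainder of \<open>F\<close> is controlled.\<close>
    proof (intro exI[of _ "\<delta> / M"] conjI allI impI)
      show "\<delta> / M > 0" using \<delta> M by simp
      fix y assume y: "norm (y - p) < \<delta> / M"
      define h where "h = y - p"
      define w where "w s = F.S s y - p" for s
      have Sp: "F.S s p = p" if "0 \<le> s" for s using F.S_equilibrium[OF eq that] .
      have w: "norm (w s) \<le> 2 * exp (2 * L * s) * norm h" if "0 \<le> s" for s
        using F.S_lipschitz[OF that, of y p] Sp[OF that] by (simp add: w_def h_def)
      have wcoord: "w s \<bullet> e n = duhamel_coord h (\<lambda>z. F (F.S z y) - F p) n s" if s: "0 \<le> s" for s n
      proof -
        have "w s \<bullet> e n = duhamel_coord y (\<lambda>z. F (F.S z y)) n s - duhamel_coord p (\<lambda>z. F (F.S z p)) n s"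
          using F.S_coord[OF s] Sp[OF s] by (metis inner_diff_left w_def)
        also have "duhamel_coord p (\<lambda>z. F (F.S z p)) n s = duhamel_coord p (\<lambda>z. F p) n s"
          by (rule duhamel_coord_cong) (simp add: Sp)
        finally show ?thesis unfolding h_def by (simp add: duhamel_coord_diff F.continuous_on_F_S_interval)
      qed
      have "norm (w t - B.S t h) \<le> exp (2 * L * t) * (2 * norm (h - h) + (2 * \<epsilon>' * norm h) / L)"
      proof (rule duhamel_gronwall[OF L _ _ _ _ _ wcoord B.S_coord t])
        show "0 \<le> 2 * \<epsilon>' * norm h" using \<epsilon>' by simp
        show "continuous_on {0..} w" unfolding w_def by (intro continuous_intros F.continuous_on_S)
        show "continuous_on {0..} (\<lambda>s. B.S s h)" by (rule B.continuous_on_S)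
        show "continuous_on {0..} (\<lambda>z. F (F.S z y) - F p)" by (intro continuous_intros F.continuous_on_F_S)
        show "continuous_on {0..} (\<lambda>s. B (B.S s h))" by (rule B.continuous_on_F_S)
        fix s assume s: "0 \<le> s" "s \<le> t"
        have "norm (w s) \<le> M * norm h"
        proof -
          have "2 * L * s \<le> 2 * L * t" using s L by simp
          then have "2 * exp (2 * L * s) * norm h \<le> M * norm h" unfolding M_def by (intro mult_right_mono) auto
          then show ?thesis using w[OF s(1)] by linarith
        qed
        also have "\<dots> < \<delta>" using y M by (simp add: h_def field_simps)
        finally have "norm (F (F.S s y) - F p - B (w s)) \<le> \<epsilon>' * norm (w s)" using \<delta>(2)[of "F.S s y"] by (simp add: w_def)
        also have "\<dots> \<le> \<epsilon>' * (2 * exp (2 * L * s) * norm h)" using w[OF s(1)] \<epsilon>' by (intro mult_left_mono) auto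
        finally have 1: "norm (F (F.S s y) - F p - B (w s)) \<le> 2 * \<epsilon>' * norm h * exp (2 * L * s)" by (simp add: mult_ac)
        have "norm (F (F.S s y) - F p - B (B.S s h)) \<le> norm (F (F.S s y) - F p - B (w s)) + norm (B (w s) - B (B.S s h))"
          using norm_triangle_ineq[of "F (F.S s y) - F p - B (w s)" "B (w s) - B (B.S s h)"] by simp
        then show "norm (F (F.S s y) - F p - B (B.S s h)) \<le> L * norm (w s - B.S s h) + 2 * \<epsilon>' * norm h * exp (2 * L * s)"
          using 1 B.norm_F_diff[of "w s" "B.S s h"] by linarith
      qed
      also have "\<dots> = \<epsilon> * norm h" using L M by (simp add: \<epsilon>'_def M_def)
      finally show "norm (F.S t y - F.S t p - V (y - p)) \<le> \<epsilon> * norm (y - p)"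
        using Sp[OF t] V(2)[of h] by (simp add: w_def h_def)
    qed
  qed
qed

end

section \<open>Tangent directions and parity\<close>

lemma orthonormal_basis_exists:
  fixes B :: "'a::real_inner set"
  assumes "finite B"
  obtains C where "finite C" "span C = span B" "pairwise orthogonal C" "\<And>c. c \<in> C \<Longrightarrow> norm c = 1" "independent C"
proof -
  obtain C0 where C0: "finite C0" "span C0 = span B" "pairwise orthogonal C0"
    using basis_orthogonal[OF assms] by blast
  define C where "C = (\<lambda>c. c /\<^sub>R norm c) ` (C0 - {0})"
  have fin: "finite C" using C0 by (simp add: C_def)
  have spn: "span C = span C0"
  proof
    show "span C \<subseteq> span C0"
      by (rule span_minimal) (auto simp: C_def intro: span_scale span_base)
    have "c \<in> span C" if "c \<in> C0" for c
    proof (cases "c = 0")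
      case False
      then have "c /\<^sub>R norm c \<in> C" using that by (auto simp: C_def)
      then have "norm c *\<^sub>R (c /\<^sub>R norm c) \<in> span C" by (intro span_scale span_base)
      then show ?thesis using False by simp
    qed (simp add: span_zero)
    then show "span C0 \<subseteq> span C" by (intro span_minimal) auto
  qed
  have orth: "pairwise orthogonal C"
    unfolding pairwise_def C_def
  proof safe
    fix x y assume xy: "x \<in> C0" "y \<in> C0" "x /\<^sub>R norm x \<noteq> y /\<^sub>R norm y"
    then have "orthogonal x y" using C0(3) by (auto simp: pairwise_def)
    then show "orthogonal (x /\<^sub>R norm x) (y /\<^sub>R norm y)" by (simp add: orthogonal_def)
  qed
  have nrm: "norm c = 1" if c: "c \<in> C" for c
  proof -
    obtain x where "c = x /\<^sub>R norm x" "x \<noteq> 0" using c by (auto simp: C_def)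
    then show ?thesis by simp
  qed
  have "independent C"
    by (rule pairwise_orthogonal_independent[OF orth]) (use nrm in force)
  with fin orth nrm show ?thesis using spn C0(2) by (intro that[of C]) auto
qed

lemma orthonormal_expand:
  fixes C :: "'a::real_inner set"
  assumes C: "finite C" "pairwise orthogonal C" "\<And>c. c \<in> C \<Longrightarrow> norm c = 1" and x: "x \<in> span C"
  shows "(\<Sum>c\<in>C. (x \<bullet> c) *\<^sub>R c) = x"
proof -
  have "span C \<subseteq> {x. (\<Sum>c\<in>C. (x \<bullet> c) *\<^sub>R c) = x}"
  proof (rule span_minimal)
    show "subspace {x. (\<Sum>c\<in>C. (x \<bullet> c) *\<^sub>R c) = x}"
      by (auto simp: subspace_def inner_add_left scaleR_left_distrib sum.distrib simp flip: scaleR_sum_right scaleR_scaleR)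
    show "C \<subseteq> {x. (\<Sum>c\<in>C. (x \<bullet> c) *\<^sub>R c) = x}"
    proof
      fix d assume d: "d \<in> C"
      have "(\<Sum>c\<in>C. (d \<bullet> c) *\<^sub>R c) = (\<Sum>c\<in>C. if c = d then d else 0)"
      proof (rule sum.cong[OF refl])
        fix c assume c: "c \<in> C"
        have "d \<bullet> d = 1" using C(3)[OF d] by (simp add: norm_eq_sqrt_inner)
        moreover have "d \<bullet> c = 0" if "c \<noteq> d"
          using C(2) c d that by (auto simp: pairwise_def orthogonal_def)
        ultimately show "(d \<bullet> c) *\<^sub>R c = (if c = d then d else 0)" by auto
      qed
      then show "d \<in> {x. (\<Sum>c\<in>C. (x \<bullet> c) *\<^sub>R c) = x}" using C(1) d by (simp add: sum.delta)
    qed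
  qed
  then show ?thesis using x by blast
qed

text \<open>Elimination of a pair of indices with a nonzero entry (a Schur complement) keeps a matrix
  antisymmetric and lowers the dimension by 2.\<close>

lemma antisymmetric_odd_kernel:
  fixes a :: "'i \<Rightarrow> 'i \<Rightarrow> real"
  assumes "finite I" "odd (card I)" "\<And>i j. i \<in> I \<Longrightarrow> j \<in> I \<Longrightarrow> a i j = - a j i"
  shows "\<exists>v. (\<exists>i\<in>I. v i \<noteq> 0) \<and> (\<forall>i\<in>I. (\<Sum>j\<in>I. a i j * v j) = 0)"
  using assms
proof (induction "card I" arbitrary: I a rule: less_induct)
  case less
  note anti = less.prems(3)
  show ?case
  proof (cases "\<forall>i\<in>I. \<forall>j\<in>I. a i j = 0")
    case True
    have "I \<noteq> {}" using less.prems by auto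
    then show ?thesis using True by (intro exI[of _ "\<lambda>_. 1"]) auto
  next
    case False
    then obtain p q where pq: "p \<in> I" "q \<in> I" "a p q \<noteq> 0" by blast
    have "a p p = 0" "a q q = 0" using anti[of p p] anti[of q q] pq by auto
    then have "p \<noteq> q" using pq by auto
    have qp: "a q p = - a p q" using anti[of q p] pq by simp
    define J where "J = I - {p, q}"
    define b where "b i j = a i j + (a i p * a q j - a i q * a p j) / a p q" for i j
    have I: "I = insert p (insert q J)" "p \<notin> insert q J" "q \<notin> J" "finite J"
      using pq less.prems(1) \<open>p \<noteq> q\<close> by (auto simp: J_def)
    then have card: "card I = Suc (Suc (card J))" by simp
    have b: "b i j = - b j i" if "i \<in> J" "j \<in> J" for i j
      using anti[of i j] anti[of i p] anti[of i q] anti[of j p] anti[of j q] that pq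
      by (simp add: b_def J_def diff_divide_distrib mult.commute)
    have "\<exists>v. (\<exists>i\<in>J. v i \<noteq> 0) \<and> (\<forall>i\<in>J. (\<Sum>j\<in>J. b i j * v j) = 0)"
    proof (rule less.hyps)
      show "card J < card I" using card by simp
      show "odd (card J)" using less.prems(2) card by simp
    qed (fact I(4), rule b)
    then obtain v where v: "\<exists>i\<in>J. v i \<noteq> 0" "\<And>i. i \<in> J \<Longrightarrow> (\<Sum>j\<in>J. b i j * v j) = 0"
      by blast
    define X where "X i = (\<Sum>j\<in>J. a i j * v j)" for i
    \<comment> \<open>The entries at \<open>p\<close> and \<open>q\<close> solve the rows
      \<open>q\<close> and \<open>p\<close> respectively; the remaining rows then reduce to the
      Schur complement \<open>b\<close>.\<close>
    define w where "w i = (if i = p then X q / a p q else if i = q then - X p / a p q else v i)" for i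
    have sumI: "(\<Sum>j\<in>I. a i j * w j) = a i p * (X q / a p q) + (a i q * (- X p / a p q) + X i)" for i
    proof -
      have "(\<Sum>j\<in>J. a i j * w j) = X i" unfolding X_def
        by (rule sum.cong) (use I in \<open>auto simp: w_def\<close>)
      then show ?thesis using I \<open>p \<noteq> q\<close> unfolding I(1) by (simp add: w_def)
    qed
    have "(\<Sum>j\<in>I. a i j * w j) = 0" if i: "i \<in> I" for i
    proof -
      consider "i = p" | "i = q" | "i \<in> J" using i I(1) by blast
      then show ?thesis
      proof cases
        case 3
        have "(\<Sum>j\<in>J. b i j * v j) = X i + (a i p * X q - a i q * X p) / a p q"
          by (simp add: b_def X_def algebra_simps sum.distrib diff_divide_distrib
              sum_subtractf sum_distrib_left sum_divide_distrib)
        then show ?thesis unfolding sumI using v(2)[OF 3] by (simp add: diff_divide_distrib)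
      qed (use pq qp \<open>a p p = 0\<close> \<open>a q q = 0\<close> in \<open>auto simp: sumI\<close>)
    qed
    moreover have "\<exists>i\<in>I. w i \<noteq> 0" using v(1) I by (auto simp: w_def)
    ultimately show ?thesis by blast
  qed
qed

text \<open>In an orthonormal basis the matrix of \<open>V\<close> is antisymmetric; for odd size it
  would annihilate a nonzero coefficient vector, against injectivity.\<close>

lemma antisymmetric_injective_even_card:
  fixes V :: "'a::real_inner \<Rightarrow> 'a"
  assumes C: "finite C" "pairwise orthogonal C" "\<And>c. c \<in> C \<Longrightarrow> norm c = 1"
    and V: "linear V" "\<And>x. x \<in> span C \<Longrightarrow> V x \<in> span C" "\<And>x. x \<in> span C \<Longrightarrow> V x = 0 \<Longrightarrow> x = 0"
    and anti: "\<And>x y. V x \<bullet> y = - (x \<bullet> V y)"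
  shows "even (card C)"
proof (rule ccontr)
  assume "odd (card C)"
  moreover have "V d \<bullet> c = - (V c \<bullet> d)" for c d using anti[of d c] by (simp add: inner_commute)
  ultimately obtain v where v: "\<exists>i\<in>C. v i \<noteq> 0" "\<And>c. c \<in> C \<Longrightarrow> (\<Sum>d\<in>C. (V d \<bullet> c) * v d) = 0"
    using antisymmetric_odd_kernel[OF C(1), of "\<lambda>c d. V d \<bullet> c"] by blast
  define x where "x = (\<Sum>d\<in>C. v d *\<^sub>R d)"
  have x: "x \<in> span C" unfolding x_def by (intro span_sum span_scale span_base)
  have "V x \<bullet> c = 0" if "c \<in> C" for c
    using v(2)[OF that] by (simp add: x_def linear_sum[OF V(1)] linear_scale[OF V(1)] inner_sum_left mult.commute)
  then have "V x = 0" using orthonormal_expand[OF C V(2)[OF x]] by simp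
  then have "x = 0" using V(3) x by blast
  have "v c = 0" if c: "c \<in> C" for c
  proof -
    have "x \<bullet> c = (\<Sum>d\<in>C. if d = c then v c else 0)"
      unfolding x_def inner_sum_left
    proof (rule sum.cong[OF refl])
      fix d assume d: "d \<in> C"
      have "c \<bullet> c = 1" using C(3)[OF c] by (simp add: norm_eq_sqrt_inner)
      moreover have "d \<bullet> c = 0" if "d \<noteq> c"
        using C(2) c d that by (auto simp: pairwise_def orthogonal_def)
      ultimately show "v d *\<^sub>R d \<bullet> c = (if d = c then v c else 0)" by auto
    qed
    then show ?thesis using \<open>x = 0\<close> C(1) c by (simp add: sum.delta)
  qed
  then show False using v(1) by blast
qed

text \<open>The sequential (Bouligand) tangent cone, free of charts so that the derivative of a map
  transports it directly.\<close>

definition tangent_directions :: "'a::real_normed_vector set \<Rightarrow> 'a \<Rightarrow> 'a set" where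
  "tangent_directions M p = {z. \<exists>q r. (\<forall>k::nat. q k \<in> M) \<and> (\<forall>k. r k > 0) \<and> r \<longlonglongrightarrow> 0 \<and>
     (\<lambda>k. (q k - p) /\<^sub>R r k) \<longlonglongrightarrow> z}"

lemma tangent_directionsI:
  "(\<And>k. q k \<in> M) \<Longrightarrow> (\<And>k. r k > 0) \<Longrightarrow> r \<longlonglongrightarrow> 0 \<Longrightarrow>
     (\<lambda>k::nat. (q k - p) /\<^sub>R r k) \<longlonglongrightarrow> z \<Longrightarrow> z \<in> tangent_directions M p"
  unfolding tangent_directions_def by blast

text \<open>The cone is the range of the derivative of the parametrisation on \<open>span B\<close>.
  In the harder inclusion the inverse chart is merely continuous, so the increment of the parameter
  is first bounded by the increment on the manifold, using injectivity of the derivative. A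
  projection onto the range then shows that the limit direction lies in it.\<close>

lemma C1_submanifold_tangent_directions:
  fixes M :: "'a::real_inner set"
  assumes M: "C1_submanifold n M" and p: "p \<in> M"
  obtains C where "finite C" "independent C" "card C = n" "tangent_directions M p = span C"
proof -
  obtain U and B :: "'a set" and W \<phi> \<psi> \<phi>' where chart: "open U \<and> p \<in> U \<and> finite B \<and> independent B \<and> card B = n \<and>
        W \<subseteq> span B \<and> openin (top_of_set (span B)) W \<and> homeomorphism W (M \<inter> U) \<phi> \<psi> \<and>
        (\<forall>w\<in>W. (\<phi> has_derivative \<phi>' w) (at w within W)) \<and>
        (\<forall>w\<in>W. \<forall>v\<in>span B. \<phi>' w v = 0 \<longrightarrow> v = 0) \<and>
        (\<forall>w\<in>W. \<forall>\<epsilon>>0. \<exists>\<delta>>0. \<forall>w'\<in>W. dist w' w < \<delta> \<longrightarrow>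
            (\<forall>v\<in>span B. norm v \<le> 1 \<longrightarrow> norm (\<phi>' w' v - \<phi>' w v) \<le> \<epsilon>))"
    using bspec[OF M[unfolded C1_submanifold_def] p] by (elim exE) (rule that)
  then have U: "open U" "p \<in> U" and B: "finite B" "independent B" "card B = n"
    and W: "W \<subseteq> span B" "openin (top_of_set (span B)) W"
    and hom: "homeomorphism W (M \<inter> U) \<phi> \<psi>"
    and der: "\<forall>w\<in>W. (\<phi> has_derivative \<phi>' w) (at w within W)"
    and inj: "\<forall>w\<in>W. \<forall>v\<in>span B. \<phi>' w v = 0 \<longrightarrow> v = 0"
    by simp_all
  define w0 where "w0 = \<psi> p"
  have w0: "w0 \<in> W" "\<phi> w0 = p" using hom p U by (auto simp: w0_def homeomorphism_def)
  define \<Lambda> where "\<Lambda> = \<phi>' w0"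
  have D: "(\<phi> has_derivative \<Lambda>) (at w0 within W)" unfolding \<Lambda>_def by (rule bspec[OF der w0(1)])
  then have bl: "bounded_linear \<Lambda>" and lin: "linear \<Lambda>"
    using has_derivative_bounded_linear bounded_linear.linear by blast+
  have injB: "inj_on \<Lambda> (span B)"
    using linear_injective_on_subspace_0[OF lin subspace_span[of B]] inj w0(1) unfolding \<Lambda>_def by blast
  define C where "C = \<Lambda> ` B"
  have spanC: "span C = \<Lambda> ` span B" unfolding C_def by (rule linear_span_image[OF lin])
  have C: "finite C" "independent C" "card C = n"
    using B linear_independent_injective_image[OF lin B(2) injB] card_image[OF inj_on_subset[OF injB span_superset]]
    by (auto simp: C_def)
  obtain N where N: "finite N" "span N = span C" "pairwise orthogonal N" "\<And>c. c \<in> N \<Longrightarrow> norm c = 1"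
    using orthonormal_basis_exists[OF C(1)] by metis
  define P where "P x = (\<Sum>c\<in>N. (x \<bullet> c) *\<^sub>R c)" for x
  have P: "P x = x" if "x \<in> span C" for x
    unfolding P_def using orthonormal_expand[OF N(1,3,4)] that N(2) by auto
  have P_in: "P x \<in> span C" for x
    unfolding P_def N(2)[symmetric] by (intro span_sum span_scale span_base)
  have bl_P: "bounded_linear P" unfolding P_def
    by (intro bounded_linear_sum bounded_linear_scaleR_left bounded_linear_compose[OF bounded_linear_scaleR_left] bounded_linear_inner_left)
  obtain g where g: "linear g" "\<And>v. v \<in> span B \<Longrightarrow> g (\<Lambda> v) = v"
    using linear_exists_left_inverse_on[OF lin subspace_span injB] by blast
  \<comment> \<open>\<open>g\<close> is only linear; \<open>l\<close> is \<open>g\<close> after the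
    projection \<open>P\<close> and is bounded, being a finite sum of inner products times
    vectors.\<close>
  define l where "l x = (\<Sum>c\<in>N. (x \<bullet> c) *\<^sub>R g c)" for x
  have "bounded_linear l" unfolding l_def
    by (intro bounded_linear_sum bounded_linear_compose[OF bounded_linear_scaleR_left] bounded_linear_inner_left)
  then obtain K where K: "K > 0" "\<And>x. norm (l x) \<le> norm x * K" using bounded_linear.pos_bounded by blast
  have l: "l (\<Lambda> v) = v" if "v \<in> span B" for v
  proof -
    have "l (\<Lambda> v) = g (P (\<Lambda> v))" by (simp add: l_def P_def linear_sum[OF g(1)] linear_scale[OF g(1)])
    also have "P (\<Lambda> v) = \<Lambda> v" using P spanC that by blast
    finally show ?thesis using g that by simp
  qed
  have D': "\<exists>d>0. \<forall>y\<in>W. norm (y - w0) < d \<longrightarrow> norm (\<phi> y - p - \<Lambda> (y - w0)) \<le> \<epsilon> * norm (y - w0)" if "\<epsilon> > 0" for \<epsilon>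
    using D that unfolding has_derivative_within_alt w0(2) by blast
  show ?thesis
  proof (rule that[OF C], intro set_eqI iffI)
    fix z assume zM: "z \<in> tangent_directions M p"
    obtain q r where q: "\<And>k::nat. q k \<in> M" and r: "\<And>k. r k > 0" "r \<longlonglongrightarrow> 0"
      and z: "(\<lambda>k. (q k - p) /\<^sub>R r k) \<longlonglongrightarrow> z"
      using zM unfolding tangent_directions_def by blast
    define y where "y k = (q k - p) /\<^sub>R r k" for k
    have lim: "(\<lambda>k. p + r k *\<^sub>R y k) \<longlonglongrightarrow> p + 0 *\<^sub>R z" using z unfolding y_def by (intro tendsto_intros r)
    have qy: "q k = p + r k *\<^sub>R y k" for k using r(1)[of k] by (simp add: y_def)
    have q_eq: "(\<lambda>k. p + r k *\<^sub>R y k) = q" using qy by (intro ext) (rule sym)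
    have qp: "q \<longlonglongrightarrow> p" using lim unfolding q_eq scaleR_zero_left add_0_right .
    have qU: "\<forall>\<^sub>F k in sequentially. q k \<in> M \<inter> U"
      using topological_tendstoD[OF qp U] q by simp
    have "(\<lambda>k. \<psi> (q k)) \<longlonglongrightarrow> \<psi> p"
      by (rule continuous_on_tendsto_compose[OF _ qp _ qU]) (use hom p U in \<open>auto simp: homeomorphism_def\<close>)
    then have \<psi>q: "(\<lambda>k. \<psi> (q k) - w0) \<longlonglongrightarrow> 0" unfolding w0_def by (rule LIM_zero)
    obtain Z where Z: "Z > 0" "\<And>k. norm (y k) \<le> Z"
      using convergent_imp_Bseq[of y] z unfolding y_def convergent_def Bseq_def by blast
    define s where "s k = y k - \<Lambda> (\<psi> (q k) - w0) /\<^sub>R r k" for k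
    have "s \<longlonglongrightarrow> 0"
    proof (rule tendstoI)
      fix \<epsilon>0 :: real assume "\<epsilon>0 > 0"
      \<comment> \<open>The second bound lets \<open>norm h\<close> be absorbed into the left-hand
        side below; the first makes the final remainder smaller than
        \<open>\<epsilon>0\<close>.\<close>
      define \<epsilon> where "\<epsilon> = min (\<epsilon>0 / (4 * K * Z)) (1 / (2 * K))"
      have \<epsilon>: "\<epsilon> > 0" "\<epsilon> * K \<le> 1 / 2" "\<epsilon> * (2 * K * Z) < \<epsilon>0"
      proof -
        show "\<epsilon> > 0" using \<open>\<epsilon>0 > 0\<close> K Z by (simp add: \<epsilon>_def)
        have "\<epsilon> \<le> 1 / (2 * K)" by (simp add: \<epsilon>_def)
        then show "\<epsilon> * K \<le> 1 / 2" using K by (simp add: field_simps)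
        have "\<epsilon> \<le> \<epsilon>0 / (4 * K * Z)" by (simp add: \<epsilon>_def)
        then have "\<epsilon> * (4 * K * Z) \<le> \<epsilon>0" using K Z by (simp add: pos_le_divide_eq)
        then show "\<epsilon> * (2 * K * Z) < \<epsilon>0" using \<open>\<epsilon>0 > 0\<close> by (simp add: mult_ac)
      qed
      obtain d where d: "d > 0" "\<And>w. w \<in> W \<Longrightarrow> norm (w - w0) < d \<Longrightarrow> norm (\<phi> w - p - \<Lambda> (w - w0)) \<le> \<epsilon> * norm (w - w0)"
        using D'[OF \<epsilon>(1)] by blast
      have "\<forall>\<^sub>F k in sequentially. norm (\<psi> (q k) - w0) < d"
        using tendstoD[OF \<psi>q d(1)] by (simp add: dist_norm)
      then show "\<forall>\<^sub>F k in sequentially. dist (s k) 0 < \<epsilon>0" using qU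
      proof eventually_elim
        case (elim k)
        define h where "h = \<psi> (q k) - w0"
        have w: "\<psi> (q k) \<in> W" "\<phi> (\<psi> (q k)) = q k" using elim(2) hom by (auto simp: homeomorphism_def)
        then have h: "h \<in> span B" unfolding h_def using W w0 by (intro span_diff) auto
        have rem: "norm (q k - p - \<Lambda> h) \<le> \<epsilon> * norm h" using d(2)[OF w(1) elim(1)] by (simp add: h_def w)
        have "norm h \<le> norm (\<Lambda> h) * K" using K(2)[of "\<Lambda> h"] l[OF h] by simp
        also have "\<dots> \<le> (norm (q k - p) + \<epsilon> * norm h) * K"
        proof (rule mult_right_mono)
          have "norm (\<Lambda> h) \<le> norm (q k - p) + norm (q k - p - \<Lambda> h)"
            using norm_triangle_ineq4[of "q k - p" "q k - p - \<Lambda> h"] by simp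
          then show "norm (\<Lambda> h) \<le> norm (q k - p) + \<epsilon> * norm h" using rem by linarith
        qed (use K in simp)
        also have "\<dots> = norm (q k - p) * K + (\<epsilon> * K) * norm h" by (simp add: algebra_simps)
        also have "(\<epsilon> * K) * norm h \<le> (1 / 2) * norm h" using \<epsilon>(2) by (intro mult_right_mono) auto
        finally have "norm h \<le> 2 * K * norm (q k - p)" by (simp add: mult.commute)
        also have "norm (q k - p) = r k * norm (y k)" using r(1)[of k] by (simp add: qy[of k])
        also have "\<dots> \<le> r k * Z" using Z r(1)[of k] by (intro mult_left_mono) auto
        finally have hr: "norm h \<le> 2 * K * (r k * Z)" using K by simp
        have "s k = (q k - p - \<Lambda> h) /\<^sub>R r k"
          by (simp add: s_def y_def h_def scaleR_diff_right)
        then have "norm (s k) = norm (q k - p - \<Lambda> h) / r k" using r(1)[of k] by (simp add: divide_inverse mult.commute)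
        also have "\<dots> \<le> (\<epsilon> * (2 * K * (r k * Z))) / r k"
          using order_trans[OF rem mult_left_mono[OF hr, of \<epsilon>]] \<epsilon>(1) r(1)[of k] by (intro divide_right_mono) auto
        also have "\<dots> = \<epsilon> * (2 * K * Z)" using r(1)[of k] by simp
        finally show ?case using \<epsilon>(3) by simp
      qed
    qed
    \<comment> \<open>\<open>s k\<close> and \<open>y k\<close> differ by an element of
      \<open>span C\<close>, which \<open>x - P x\<close> annihilates, so convergence of
      \<open>s\<close> to 0 determines the limit of \<open>y k - P (y k)\<close>.\<close>
    have evB: "\<forall>\<^sub>F k in sequentially. s k - P (s k) = y k - P (y k)"
      using qU
    proof eventually_elim
      case (elim k)
      define h where "h = \<psi> (q k) - w0"
      have "\<psi> (q k) \<in> W" using elim hom by (auto simp: homeomorphism_def)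
      then have "h \<in> span B" unfolding h_def using W w0 by (intro span_diff) auto
      then have "\<Lambda> h /\<^sub>R r k \<in> span C" using spanC by (intro span_scale) auto
      then have "P (\<Lambda> h /\<^sub>R r k) = \<Lambda> h /\<^sub>R r k" by (rule P)
      then show ?case by (simp add: s_def h_def linear_diff[OF bounded_linear.linear[OF bl_P]])
    qed
    have "(\<lambda>k. s k - P (s k)) \<longlonglongrightarrow> 0 - P 0"
      by (intro tendsto_diff bounded_linear.tendsto[OF bl_P] \<open>s \<longlonglongrightarrow> 0\<close>)
    then have "(\<lambda>k. y k - P (y k)) \<longlonglongrightarrow> 0 - P 0" by (rule Lim_transform_eventually[OF _ evB])
    moreover have "(\<lambda>k. y k - P (y k)) \<longlonglongrightarrow> z - P z"
      using z unfolding y_def by (intro tendsto_diff bounded_linear.tendsto[OF bl_P])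
    ultimately have "z - P z = 0 - P 0" by (rule LIMSEQ_unique[symmetric])
    then have "z = P z" using linear_0[OF bounded_linear.linear[OF bl_P]] by simp
    then show "z \<in> span C" using P_in by metis
  next
    fix z assume "z \<in> span C"
    then obtain b where b: "b \<in> span B" "z = \<Lambda> b" using spanC by auto
    obtain \<rho> where \<rho>: "\<rho> > 0" "ball w0 \<rho> \<inter> span B \<subseteq> W"
      using W(2) w0(1) unfolding openin_contains_ball by blast
    \<comment> \<open>Step sizes that keep \<open>w0 + r k *\<^sub>R b\<close> inside the ball
      around \<open>w0\<close>; the denominator \<open>norm b + 1\<close> covers
      \<open>b = 0\<close>.\<close>
    define r where "r k = \<rho> / (norm b + 1) * inverse (real (Suc (Suc k)))" for k
    have c: "\<rho> / (norm b + 1) > 0" using \<rho> by (intro divide_pos_pos add_nonneg_pos) auto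
    have r0: "r k > 0" for k unfolding r_def by (intro mult_pos_pos c) simp
    have "(\<lambda>k. \<rho> / (norm b + 1) * inverse (real (Suc (Suc k)))) \<longlonglongrightarrow> \<rho> / (norm b + 1) * 0"
      by (intro tendsto_mult tendsto_const LIMSEQ_Suc[OF LIMSEQ_inverse_real_of_nat])
    then have rlim: "r \<longlonglongrightarrow> 0" by (simp add: r_def[abs_def])
    have wk: "w0 + r k *\<^sub>R b \<in> W" for k
    proof -
      have "inverse (real (Suc (Suc k))) \<le> 1" by (simp add: field_simps)
      then have "r k \<le> \<rho> / (norm b + 1) * 1" unfolding r_def using c by (intro mult_left_mono) auto
      then have "r k * norm b \<le> \<rho> / (norm b + 1) * norm b" by (intro mult_right_mono) auto
      also have "\<dots> < \<rho>" using \<rho>(1) by (simp add: field_simps add_pos_nonneg)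
      finally have "w0 + r k *\<^sub>R b \<in> ball w0 \<rho>" using r0[of k] by (simp add: dist_norm)
      moreover have "w0 + r k *\<^sub>R b \<in> span B" using w0 W b by (intro span_add span_scale) auto
      ultimately show ?thesis using \<rho>(2) by blast
    qed
    define q where "q k = \<phi> (w0 + r k *\<^sub>R b)" for k
    have qM: "q k \<in> M" for k using wk[of k] hom by (auto simp: q_def homeomorphism_def)
    have "(\<lambda>k. (q k - p) /\<^sub>R r k - z) \<longlonglongrightarrow> 0"
    proof (rule tendstoI)
      fix \<epsilon>0 :: real assume "\<epsilon>0 > 0"
      define \<epsilon> where "\<epsilon> = \<epsilon>0 / (norm b + 1)"
      have nb: "norm b + 1 > 0" using norm_ge_zero[of b] by linarith
      have \<epsilon>: "\<epsilon> > 0" using \<open>\<epsilon>0 > 0\<close> nb by (simp add: \<epsilon>_def)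
      have \<epsilon>b: "\<epsilon> * norm b < \<epsilon>0" using \<open>\<epsilon>0 > 0\<close> nb by (simp add: \<epsilon>_def field_simps)
      obtain d where d: "d > 0" "\<And>w. w \<in> W \<Longrightarrow> norm (w - w0) < d \<Longrightarrow> norm (\<phi> w - p - \<Lambda> (w - w0)) \<le> \<epsilon> * norm (w - w0)"
        using D'[OF \<epsilon>(1)] by blast
      have "(\<lambda>k. norm (r k *\<^sub>R b)) \<longlonglongrightarrow> norm (0 *\<^sub>R b)" by (intro tendsto_intros rlim)
      then have "\<forall>\<^sub>F k in sequentially. norm (r k *\<^sub>R b) < d"
        using order_tendstoD(2) d(1) by (metis norm_zero scaleR_zero_left)
      then show "\<forall>\<^sub>F k in sequentially. dist ((q k - p) /\<^sub>R r k - z) 0 < \<epsilon>0"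
      proof eventually_elim
        case (elim k)
        have "norm (q k - p - \<Lambda> (r k *\<^sub>R b)) \<le> \<epsilon> * norm (r k *\<^sub>R b)"
          using d(2)[OF wk[of k]] elim by (simp add: q_def)
        moreover have "(q k - p) /\<^sub>R r k - z = (q k - p - \<Lambda> (r k *\<^sub>R b)) /\<^sub>R r k"
          using r0[of k] by (simp add: b linear_scale[OF lin] scaleR_diff_right)
        ultimately have "norm ((q k - p) /\<^sub>R r k - z) \<le> (\<epsilon> * norm (r k *\<^sub>R b)) / r k"
          using r0[of k] by (simp add: divide_inverse mult.commute mult_right_mono)
        also have "\<dots> = \<epsilon> * norm b" using r0[of k] by simp
        finally show ?case using \<epsilon>b by simp
      qed
    qed
    then have "(\<lambda>k. (q k - p) /\<^sub>R r k) \<longlonglongrightarrow> z" by (rule LIM_zero_cancel)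
    with qM r0 rlim show "z \<in> tangent_directions M p" by (rule tangent_directionsI)
  qed
qed

text \<open>The chain rule for tangent cones: the increments \<open>q k - p\<close> are bounded
  multiples of \<open>r k\<close>, so the remainder of \<open>f\<close> is small relative to
  \<open>r k\<close>.\<close>

lemma tangent_directions_image:
  fixes f :: "'a::real_normed_vector \<Rightarrow> 'b::real_normed_vector"
  assumes D: "(f has_derivative V) (at p)" and z: "z \<in> tangent_directions M p"
  shows "V z \<in> tangent_directions (f ` M) (f p)"
proof -
  obtain q r where q: "\<And>k::nat. q k \<in> M" and r: "\<And>k. r k > 0" "r \<longlonglongrightarrow> 0"
    and z: "(\<lambda>k. (q k - p) /\<^sub>R r k) \<longlonglongrightarrow> z"
    using z unfolding tangent_directions_def by blast
  have bl: "bounded_linear V" using D by (rule has_derivative_bounded_linear)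
  define y where "y k = (q k - p) /\<^sub>R r k" for k
  have lim: "(\<lambda>k. p + r k *\<^sub>R y k) \<longlonglongrightarrow> p + 0 *\<^sub>R z" using z unfolding y_def by (intro tendsto_intros r)
  have qy: "q k = p + r k *\<^sub>R y k" for k using r(1)[of k] by (simp add: y_def)
  have q_eq: "(\<lambda>k. p + r k *\<^sub>R y k) = q" using qy by (intro ext) (rule sym)
  have qp: "q \<longlonglongrightarrow> p" using lim unfolding q_eq scaleR_zero_left add_0_right .
  obtain Z where Z: "Z > 0" "\<And>k. norm (y k) \<le> Z"
    using convergent_imp_Bseq[of y] z unfolding y_def convergent_def Bseq_def by blast
  have "(\<lambda>k. (f (q k) - f p) /\<^sub>R r k - V (y k)) \<longlonglongrightarrow> 0"
  proof (rule tendstoI)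
    fix \<epsilon> :: real assume \<epsilon>: "\<epsilon> > 0"
    then have "\<epsilon> / (2 * Z) > 0" using Z by simp
    then obtain d where d: "d > 0" "\<And>x. norm (x - p) < d \<Longrightarrow> norm (f x - f p - V (x - p)) \<le> \<epsilon> / (2 * Z) * norm (x - p)"
      using D unfolding has_derivative_at_alt by blast
    show "\<forall>\<^sub>F k in sequentially. dist ((f (q k) - f p) /\<^sub>R r k - V (y k)) 0 < \<epsilon>"
      using tendstoD[OF qp d(1)]
    proof eventually_elim
      case (elim k)
      have rk: "r k > 0" by (rule r)
      have qk: "q k - p = r k *\<^sub>R y k" using qy[of k] by simp
      have "norm (f (q k) - f p - V (q k - p)) \<le> \<epsilon> / (2 * Z) * norm (q k - p)"
        using d(2) elim by (simp add: dist_norm)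
      also have "norm (q k - p) = r k * norm (y k)" using rk by (simp add: qk)
      also have "\<epsilon> / (2 * Z) * (r k * norm (y k)) \<le> \<epsilon> / (2 * Z) * (r k * Z)"
        using Z \<epsilon> rk by (intro mult_left_mono) auto
      finally have "norm (f (q k) - f p - V (q k - p)) \<le> r k * (\<epsilon> / 2)" using Z by (simp add: mult.commute)
      moreover have "(f (q k) - f p) /\<^sub>R r k - V (y k) = (f (q k) - f p - V (q k - p)) /\<^sub>R r k"
        using rk by (simp add: qk linear_scale[OF bounded_linear.linear[OF bl]] scaleR_diff_right)
      ultimately have "norm ((f (q k) - f p) /\<^sub>R r k - V (y k)) \<le> inverse (r k) * (r k * (\<epsilon> / 2))"
        using rk by (simp add: mult_left_mono)
      also have "\<dots> = \<epsilon> / 2" using rk by simp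
      finally have "norm ((f (q k) - f p) /\<^sub>R r k - V (y k)) \<le> \<epsilon> / 2" .
      then show ?case using \<epsilon> by simp
    qed
  qed
  moreover have "(\<lambda>k. V (y k)) \<longlonglongrightarrow> V z"
    using z unfolding y_def by (rule bounded_linear.tendsto[OF bl])
  ultimately have "(\<lambda>k. ((f (q k) - f p) /\<^sub>R r k - V (y k)) + V (y k)) \<longlonglongrightarrow> 0 + V z" by (rule tendsto_add)
  then have "(\<lambda>k. (f (q k) - f p) /\<^sub>R r k) \<longlonglongrightarrow> V z" by simp
  with imageI[OF q] r show ?thesis by (rule tangent_directionsI)
qed

section \<open>Parity of the dimension of invariant subspaces\<close>

lemma even_dim_of_antisymmetric:
  fixes V :: "'a::real_inner \<Rightarrow> 'a"
  assumes C: "finite C" "independent C"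
    and V: "linear V" "\<And>x y. V x \<bullet> y = - (x \<bullet> V y)"
    and inv: "\<And>x. x \<in> span C \<Longrightarrow> V x \<in> span C" and inj: "\<And>x. x \<in> span C \<Longrightarrow> V x = 0 \<Longrightarrow> x = 0"
  shows "even (card C)"
proof -
  obtain N where N: "finite N" "span N = span C" "pairwise orthogonal N" "\<And>c. c \<in> N \<Longrightarrow> norm c = 1" "independent N"
    using orthonormal_basis_exists[OF C(1)] by metis
  have "even (card N)"
    by (rule antisymmetric_injective_even_card[OF N(1,3,4) V(1) _ _ V(2)]) (use inv inj N(2) in auto)
  moreover have "card N = card C"
    using dim_eq_card[OF N(2) N(5)] dim_eq_card_independent[OF C(2)] by simp
  ultimately show ?thesis by simp
qed

text \<open>The range of \<open>V\<close> is orthogonal to \<open>w\<close>, so \<open>V\<close>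
  preserves the orthogonal complement of \<open>w\<close> in \<open>span C\<close>. On it
  \<open>V\<close> is injective, so its dimension is even, and \<open>w\<close> adds one.\<close>

lemma odd_dim_of_antisymmetric:
  fixes V :: "'a::real_inner \<Rightarrow> 'a"
  assumes C: "finite C" "independent C"
    and V: "linear V" "\<And>x y. V x \<bullet> y = - (x \<bullet> V y)"
    and inv: "\<And>x. x \<in> span C \<Longrightarrow> V x \<in> span C"
    and w: "w \<in> span C" "norm w = 1" "\<And>x. V x \<bullet> w = 0"
    and inj: "\<And>x. x \<in> span C \<Longrightarrow> x \<bullet> w = 0 \<Longrightarrow> V x = 0 \<Longrightarrow> x = 0"
  shows "odd (card C)"
proof -
  have ww: "w \<bullet> w = 1" using w(2) by (simp add: norm_eq_sqrt_inner)
  define \<pi> where "\<pi> x = x - (x \<bullet> w) *\<^sub>R w" for x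
  have lin: "linear \<pi>"
    by (rule linearI) (auto simp: \<pi>_def inner_add_left algebra_simps)
  have \<pi>_w: "\<pi> x \<bullet> w = 0" for x by (simp add: \<pi>_def inner_diff_left ww)
  have \<pi>_fix: "\<pi> x = x" if "x \<bullet> w = 0" for x using that by (simp add: \<pi>_def)
  have \<pi>_in: "\<pi> x \<in> span C" if "x \<in> span C" for x
    unfolding \<pi>_def using that w by (intro span_diff span_scale)
  have sp: "span (\<pi> ` C) = \<pi> ` span C" by (rule linear_span_image[OF lin])
  obtain N where N: "finite N" "span N = span (\<pi> ` C)" "pairwise orthogonal N" "\<And>c. c \<in> N \<Longrightarrow> norm c = 1" "independent N"
    using orthonormal_basis_exists[of "\<pi> ` C"] C(1) by (metis finite_imageI)
  have Nspan: "x \<in> span N \<longleftrightarrow> x \<in> span C \<and> x \<bullet> w = 0" for x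
    unfolding N(2) sp using \<pi>_w \<pi>_fix \<pi>_in by (metis image_iff)
  have "even (card N)"
    by (rule antisymmetric_injective_even_card[OF N(1,3,4) V(1) _ _ V(2)]) (use inv inj w Nspan in auto)
  moreover have "card C = Suc (card N)"
  proof -
    have orth: "c \<bullet> w = 0" if "c \<in> N" for c using Nspan span_base[OF that] by blast
    then have "w \<notin> N" using ww by force
    have "pairwise orthogonal (insert w N)"
      using N(3) orth unfolding pairwise_insert by (auto simp: orthogonal_def inner_commute)
    moreover have "0 \<notin> insert w N" using N(4) w(2) by force
    ultimately have ind: "independent (insert w N)" by (rule pairwise_orthogonal_independent)
    have "span (insert w N) = span C"
    proof
      have "N \<subseteq> span C" using Nspan span_base by blast
      then show "span (insert w N) \<subseteq> span C" using w by (intro span_minimal) auto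
      show "span C \<subseteq> span (insert w N)"
      proof
        fix x assume "x \<in> span C"
        then have "\<pi> x \<in> span N" using Nspan \<pi>_w \<pi>_in by blast
        then have "\<pi> x \<in> span (insert w N)" using span_mono[of N "insert w N"] by blast
        moreover have "(x \<bullet> w) *\<^sub>R w \<in> span (insert w N)" by (intro span_scale span_base) simp
        ultimately have "\<pi> x + (x \<bullet> w) *\<^sub>R w \<in> span (insert w N)" by (rule span_add)
        then show "x \<in> span (insert w N)" by (simp add: \<pi>_def)
      qed
    qed
    then have "dim C = card (insert w N)" by (rule dim_eq_card[OF _ ind])
    then show ?thesis using dim_eq_card_independent[OF C(2)] N(1) \<open>w \<notin> N\<close> by simp
  qed
  ultimately show ?thesis by simp
qed

section \<open>The nonlinearity\<close>

text \<open>Bounded displacement with Lipschitz constant 1, so that the couplings can be switched off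
  away from the first axis without a cost in the Lipschitz constant.\<close>

definition damp :: "real \<Rightarrow> 'a::real_inner \<Rightarrow> 'a" where
  "damp \<eta> v = exp ((- 1 / \<eta>\<^sup>2) * (v \<bullet> v)) *\<^sub>R v"

lemma damp_0 [simp]: "damp \<eta> 0 = 0"
  by (simp add: damp_def)

lemma has_derivative_damp:
  "(damp \<eta> has_derivative (\<lambda>h. exp ((- 1 / \<eta>\<^sup>2) * (v \<bullet> v)) *\<^sub>R (h - (2 / \<eta>\<^sup>2 * (v \<bullet> h)) *\<^sub>R v))) (at v within X)"
proof -
  have "((\<lambda>v. exp (c * (v \<bullet> v)) *\<^sub>R v) has_derivative (\<lambda>h. exp (c * (v \<bullet> v)) *\<^sub>R (h + (2 * c * (v \<bullet> h)) *\<^sub>R v)))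
      (at v within X)" for c
    by (auto intro!: derivative_eq_intros simp: fun_eq_iff algebra_simps inner_commute)
  from this[of "- 1 / \<eta>\<^sup>2"] show ?thesis by (simp add: damp_def[abs_def])
qed

text \<open>The derivative is \<open>exp (- y)\<close> times a symmetric operator with eigenvalues 1
  and \<open>1 - 2 * y\<close>, where \<open>y = (norm v / \<eta>)^2\<close>. Both are at most
  \<open>exp y\<close> in absolute value, so the factor in front compensates them.\<close>

lemma norm_damp_derivative_le:
  fixes v h :: "'a::real_inner"
  assumes "\<eta> > 0"
  shows "norm (exp ((- 1 / \<eta>\<^sup>2) * (v \<bullet> v)) *\<^sub>R (h - (2 / \<eta>\<^sup>2 * (v \<bullet> h)) *\<^sub>R v)) \<le> norm h"
proof -
  define y where "y = (v \<bullet> v) / \<eta>\<^sup>2"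
  define w where "w = h - (2 / \<eta>\<^sup>2 * (v \<bullet> h)) *\<^sub>R v"
  have y: "y \<ge> 0" by (simp add: y_def)
  have vv: "v \<bullet> v = y * \<eta>\<^sup>2" using assms by (simp add: y_def)
  define q where "q = (v \<bullet> h)\<^sup>2 / \<eta>\<^sup>2"
  have q0: "q \<ge> 0" by (simp add: q_def)
  have "(v \<bullet> h)\<^sup>2 \<le> (v \<bullet> v) * (h \<bullet> h)" by (rule Cauchy_Schwarz_ineq)
  then have q: "q \<le> y * (h \<bullet> h)" using assms by (simp add: q_def vv divide_le_eq mult_ac)
  have "w \<bullet> w = h \<bullet> h + 4 * q * (y - 1)"
  proof -
    have "w \<bullet> w = h \<bullet> h - 2 * (2 / \<eta>\<^sup>2 * (v \<bullet> h)) * (v \<bullet> h) + (2 / \<eta>\<^sup>2 * (v \<bullet> h))\<^sup>2 * (v \<bullet> v)"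
      unfolding w_def by (simp add: inner_diff_left inner_diff_right inner_commute power2_eq_square algebra_simps)
    then show ?thesis unfolding vv q_def using assms by (simp add: field_simps power2_eq_square)
  qed
  also have "\<dots> \<le> (exp y)\<^sup>2 * (h \<bullet> h)"
  proof (cases "y \<le> 1")
    case True
    have "4 * q * (y - 1) \<le> 0" using True q0 by (simp add: mult_le_0_iff)
    moreover have "1 * (h \<bullet> h) \<le> (exp y)\<^sup>2 * (h \<bullet> h)"
      using y by (intro mult_right_mono) auto
    ultimately show ?thesis by linarith
  next
    case False
    have "q * (y - 1) \<le> (y * (h \<bullet> h)) * (y - 1)" using False q by (intro mult_right_mono) auto
    then have "h \<bullet> h + 4 * q * (y - 1) \<le> h \<bullet> h + 4 * ((y * (h \<bullet> h)) * (y - 1))" by linarith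
    also have "\<dots> = (2 * y - 1)\<^sup>2 * (h \<bullet> h)" by (simp add: power2_eq_square algebra_simps)
    also have "\<dots> \<le> (exp y)\<^sup>2 * (h \<bullet> h)"
    proof (intro mult_right_mono power_mono)
      have "2 * y - 1 \<le> 1 + y + y\<^sup>2 / 2"
        using zero_le_power2[of "y - 1"] by (simp add: power2_eq_square algebra_simps)
      then show "2 * y - 1 \<le> exp y" using exp_lower_Taylor_quadratic[OF y] by linarith
    qed (use False in auto)
    finally show ?thesis .
  qed
  also have "\<dots> = (exp y * norm h)\<^sup>2" by (simp add: power_mult_distrib power2_norm_eq_inner)
  finally have "(norm w)\<^sup>2 \<le> (exp y * norm h)\<^sup>2" by (simp add: power2_norm_eq_inner)
  then have "norm w \<le> exp y * norm h" by (rule power2_le_imp_le) simp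
  then have "exp (- y) * norm w \<le> exp (- y) * (exp y * norm h)" by (intro mult_left_mono) auto
  also have "\<dots> = norm h" by (simp flip: mult.assoc exp_add)
  finally show ?thesis by (simp add: w_def y_def)
qed

lemma norm_damp_diff_le:
  fixes v w :: "'a::real_inner"
  assumes "\<eta> > 0"
  shows "norm (damp \<eta> v - damp \<eta> w) \<le> norm (v - w)"
proof -
  have "norm (damp \<eta> v - damp \<eta> w) \<le> 1 * norm (v - w)"
    by (rule differentiable_bound[OF convex_UNIV has_derivative_damp onorm_bound])
      (use norm_damp_derivative_le[OF assms] in auto)
  then show ?thesis by simp
qed

lemma norm_damp_le:
  fixes v :: "'a::real_inner"
  assumes "\<eta> > 0"
  shows "norm (damp \<eta> v) \<le> \<eta>"
proof -
  define r where "r = norm v / \<eta>"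
  have r: "r \<ge> 0" "norm v = r * \<eta>" using assms by (auto simp: r_def)
  have "r \<le> 1 + r\<^sup>2" using zero_le_power2[of "r - 1"] r(1) by (simp add: power2_eq_square algebra_simps)
  also have "\<dots> \<le> exp (r\<^sup>2)" by (rule exp_ge_add_one_self)
  finally have "exp (- r\<^sup>2) * r \<le> exp (- r\<^sup>2) * exp (r\<^sup>2)" by (intro mult_left_mono) auto
  then have "exp (- r\<^sup>2) * r \<le> 1" by (simp flip: exp_add)
  then have "exp (- r\<^sup>2) * r * \<eta> \<le> 1 * \<eta>" using assms by (intro mult_right_mono) auto
  moreover have "(- 1 / \<eta>\<^sup>2) * (v \<bullet> v) = - r\<^sup>2"
    using assms by (simp add: r_def power_divide power2_norm_eq_inner)
  ultimately show ?thesis by (simp add: damp_def r(2) mult.assoc)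
qed

section \<open>Rotations of pairs of modes\<close>

context eigenbasis
begin

text \<open>\<open>paired d \<beta> \<epsilon> \<sigma>\<close> is diagonal with entries \<open>d\<close> plus \<open>\<beta>\<close> times rotations by a
  right angle in the planes spanned by \<open>e n\<close> and \<open>e (\<sigma> n)\<close>; an index with \<open>\<epsilon> n = 0\<close> is unpaired.\<close>

definition paired :: "(nat \<Rightarrow> real) \<Rightarrow> real \<Rightarrow> (nat \<Rightarrow> real) \<Rightarrow> (nat \<Rightarrow> nat) \<Rightarrow> 'a \<Rightarrow> 'a" where
  "paired d \<beta> \<epsilon> \<sigma> u = weighted_permutation d (\<lambda>n. n) u + \<beta> *\<^sub>R weighted_permutation \<epsilon> \<sigma> u"

text \<open>The change of sign within a pair makes the rotation antisymmetric; it forces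
  \<open>\<epsilon> n = 0\<close> wherever \<open>\<sigma>\<close> fixes \<open>n\<close>.\<close>

definition pairing :: "(nat \<Rightarrow> real) \<Rightarrow> (nat \<Rightarrow> nat) \<Rightarrow> bool" where
  "pairing \<epsilon> \<sigma> \<longleftrightarrow> (\<forall>n. \<sigma> (\<sigma> n) = n \<and> \<epsilon> (\<sigma> n) = - \<epsilon> n \<and> (\<epsilon> n)\<^sup>2 = (if \<epsilon> n = 0 then 0 else 1))"

lemma pairingD:
  assumes "pairing \<epsilon> \<sigma>"
  shows "\<sigma> (\<sigma> n) = n" "\<epsilon> (\<sigma> n) = - \<epsilon> n" "\<epsilon> n \<noteq> 0 \<Longrightarrow> \<epsilon> n * \<epsilon> n = 1" "\<bar>\<epsilon> n\<bar> \<le> 1" "inj \<sigma>"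
proof -
  have *: "\<And>n. \<sigma> (\<sigma> n) = n" "\<And>n. \<epsilon> (\<sigma> n) = - \<epsilon> n" "\<And>n. (\<epsilon> n)\<^sup>2 = (if \<epsilon> n = 0 then 0 else 1)"
    using assms unfolding pairing_def by blast+
  show "\<sigma> (\<sigma> n) = n" "\<epsilon> (\<sigma> n) = - \<epsilon> n" "\<epsilon> n \<noteq> 0 \<Longrightarrow> \<epsilon> n * \<epsilon> n = 1"
    using * by (auto simp: power2_eq_square)
  have "(\<epsilon> n)\<^sup>2 \<le> 1" by (simp add: *(3))
  then show "\<bar>\<epsilon> n\<bar> \<le> 1" by (simp add: abs_square_le_1)
  show "inj \<sigma>" using *(1) by (metis injI)
qed

lemma paired:
  assumes p: "pairing \<epsilon> \<sigma>" and d: "\<And>n. \<bar>d n\<bar> \<le> M" and \<beta>: "0 \<le> \<beta>"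
  shows paired_coord: "paired d \<beta> \<epsilon> \<sigma> u \<bullet> e n = d n * (u \<bullet> e n) + \<beta> * (\<epsilon> n * (u \<bullet> e (\<sigma> n)))"
    and bounded_linear_paired: "bounded_linear (paired d \<beta> \<epsilon> \<sigma>)"
    and norm_paired_le: "norm (paired d \<beta> \<epsilon> \<sigma> u) \<le> (M + \<beta>) * norm u"
proof -
  note q = pairingD[OF p]
  have id: "inj (\<lambda>n::nat. n)" by (simp add: inj_on_def)
  show "paired d \<beta> \<epsilon> \<sigma> u \<bullet> e n = d n * (u \<bullet> e n) + \<beta> * (\<epsilon> n * (u \<bullet> e (\<sigma> n)))"
    by (simp add: paired_def inner_add_left weighted_permutation_coord[OF id d] weighted_permutation_coord[OF q(5,4)])
  show "bounded_linear (paired d \<beta> \<epsilon> \<sigma>)"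
    unfolding paired_def
    by (intro bounded_linear_add bounded_linear_const_scaleR bounded_linear_weighted_permutation[OF id d]
        bounded_linear_weighted_permutation[OF q(5,4)])
  have "norm (paired d \<beta> \<epsilon> \<sigma> u) \<le> M * norm u + \<beta> * (1 * norm u)"
    unfolding paired_def
    by (rule norm_triangle_mono[OF norm_weighted_permutation_le[OF id d]])
      (use norm_weighted_permutation_le[OF q(5,4), where u = u] \<beta> in \<open>simp add: mult_left_mono\<close>)
  then show "norm (paired d \<beta> \<epsilon> \<sigma> u) \<le> (M + \<beta>) * norm u" by (simp add: distrib_right)
qed

text \<open>If the diagonal balances the eigenvalues within each pair, the linear equation rotates all
  planes with the same angular velocity \<open>\<beta>\<close>; at the quarter turn the solution operator is
  antisymmetric on the paired modes.\<close>

lemma paired_quarter_turn: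
  assumes p: "pairing \<epsilon> \<sigma>" and d: "\<And>n. \<bar>d n\<bar> \<le> M" and \<beta>: "\<beta> > 0"
    and bal: "\<And>n. lam (\<sigma> n) - d (\<sigma> n) = lam n - d n"
    and lip: "L-lipschitz_on UNIV (paired d \<beta> \<epsilon> \<sigma>)" "L > 0"
  shows "solution_semigroup e lam (paired d \<beta> \<epsilon> \<sigma>) (pi / (2 * \<beta>)) h \<bullet> e n =
    exp (- (lam n - d n) * (pi / (2 * \<beta>))) * (if \<epsilon> n = 0 then h \<bullet> e n else \<epsilon> n * (h \<bullet> e (\<sigma> n)))"
proof -
  interpret lipschitz_equation e lam "paired d \<beta> \<epsilon> \<sigma>" L by unfold_locales (use lip in auto)
  note q = pairingD[OF p]
  define \<tau> where "\<tau> = pi / (2 * \<beta>)"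
  have \<tau>: "\<tau> > 0" "\<beta> * \<tau> = pi / 2" using \<beta> by (auto simp: \<tau>_def)
  define x where "x n t = S t h \<bullet> e n" for n t
  have dx: "(x n has_real_derivative - (lam n - d n) * x n t + \<beta> * \<epsilon> n * x (\<sigma> n) t) (at t within {0..\<tau>})"
    if t: "t \<in> {0..\<tau>}" for n t
  proof -
    have "(duhamel_coord h (\<lambda>s. paired d \<beta> \<epsilon> \<sigma> (S s h)) n has_real_derivative
        - (lam n - d n) * x n t + \<beta> * \<epsilon> n * x (\<sigma> n) t) (at t within {0..\<tau>})"
      using DERIV_duhamel_coord[OF continuous_on_F_S_interval[where a = h] t, where a = h and n = n] S_coord[of t h n] t
      by (simp add: x_def paired_coord[OF p d less_imp_le[OF \<beta>]] algebra_simps)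
    then show ?thesis
      by (rule has_field_derivative_transform_within[where d = 1]) (use t in \<open>auto simp: x_def S_coord\<close>)
  qed
  have const: "f \<tau> = f 0" if "\<And>t. t \<in> {0..\<tau>} \<Longrightarrow> (f has_real_derivative 0) (at t within {0..\<tau>})" for f :: "real \<Rightarrow> real"
    using has_field_derivative_zero_constant[of "{0..\<tau>}" f] that \<tau> by fastforce
  define \<mu> where "\<mu> n = lam n - d n" for n
  have x0: "x n 0 = h \<bullet> e n" for n by (simp add: x_def)
  have "x n \<tau> = exp (- \<mu> n * \<tau>) * (if \<epsilon> n = 0 then h \<bullet> e n else \<epsilon> n * (h \<bullet> e (\<sigma> n)))"
  proof (cases "\<epsilon> n = 0")
    case True
    have "exp (\<mu> n * \<tau>) * x n \<tau> = exp (\<mu> n * 0) * x n 0"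
      by (rule const) (use True in \<open>auto intro!: derivative_eq_intros dx simp: \<mu>_def algebra_simps\<close>)
    then have "exp (- \<mu> n * \<tau>) * (exp (\<mu> n * \<tau>) * x n \<tau>) = exp (- \<mu> n * \<tau>) * (h \<bullet> e n)" by (simp add: x0)
    then show ?thesis using True by (simp flip: mult.assoc exp_add)
  next
    case False
    define m where "m = \<sigma> n"
    have m: "\<epsilon> m \<noteq> 0" "\<sigma> m = n" "\<epsilon> n = - \<epsilon> m" "\<mu> n = \<mu> m" using False q bal by (auto simp: m_def \<mu>_def)
    have ee: "\<epsilon> m * \<epsilon> m = 1" by (rule q(3)[OF m(1)])
    have d1: "(x m has_real_derivative - \<mu> m * x m t + \<beta> * \<epsilon> m * x n t) (at t within {0..\<tau>})"
      and d2: "(x n has_real_derivative - \<mu> m * x n t - \<beta> * \<epsilon> m * x m t) (at t within {0..\<tau>})"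
      if "t \<in> {0..\<tau>}" for t
    proof -
      have dx': "(x j has_real_derivative - \<mu> j * x j t + \<beta> * \<epsilon> j * x (\<sigma> j) t) (at t within {0..\<tau>})" for j
        using dx[OF that, of j] by (simp only: \<mu>_def)
      show "(x m has_real_derivative - \<mu> m * x m t + \<beta> * \<epsilon> m * x n t) (at t within {0..\<tau>})"
        using dx'[of m] by (simp add: m(2))
      show "(x n has_real_derivative - \<mu> m * x n t - \<beta> * \<epsilon> m * x m t) (at t within {0..\<tau>})"
        using dx'[of n] by (simp add: m(3,4) m_def[symmetric])
    qed
    \<comment> \<open>In the frame that undoes decay and rotation the coordinate is constant; at the
      quarter turn only the partner coordinate \<open>x n\<close> is left in it.\<close>
    have "exp (\<mu> m * \<tau>) * (cos (\<beta> * \<tau>) * x m \<tau> - \<epsilon> m * sin (\<beta> * \<tau>) * x n \<tau>) =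
        exp (\<mu> m * 0) * (cos (\<beta> * 0) * x m 0 - \<epsilon> m * sin (\<beta> * 0) * x n 0)"
    proof (rule const)
      fix t assume t: "t \<in> {0..\<tau>}"
      define c s where "c = cos (\<beta> * t)" and "s = sin (\<beta> * t)"
      have "((\<lambda>t. exp (\<mu> m * t) * (cos (\<beta> * t) * x m t - \<epsilon> m * sin (\<beta> * t) * x n t)) has_real_derivative
        exp (\<mu> m * t) * \<mu> m * (c * x m t - \<epsilon> m * s * x n t) +
        exp (\<mu> m * t) * ((- s * \<beta>) * x m t + c * (- \<mu> m * x m t + \<beta> * \<epsilon> m * x n t)
           - (\<epsilon> m * (c * \<beta>) * x n t + \<epsilon> m * s * (- \<mu> m * x n t - \<beta> * \<epsilon> m * x m t)))) (at t within {0..\<tau>})"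
        unfolding c_def s_def
        by (auto intro!: derivative_eq_intros d1[OF t] d2[OF t] simp: algebra_simps)
      also have "exp (\<mu> m * t) * \<mu> m * (c * x m t - \<epsilon> m * s * x n t) +
        exp (\<mu> m * t) * ((- s * \<beta>) * x m t + c * (- \<mu> m * x m t + \<beta> * \<epsilon> m * x n t)
           - (\<epsilon> m * (c * \<beta>) * x n t + \<epsilon> m * s * (- \<mu> m * x n t - \<beta> * \<epsilon> m * x m t)))
        = exp (\<mu> m * t) * s * \<beta> * x m t * (\<epsilon> m * \<epsilon> m - 1)"
        by (simp add: algebra_simps)
      finally show "((\<lambda>t. exp (\<mu> m * t) * (cos (\<beta> * t) * x m t - \<epsilon> m * sin (\<beta> * t) * x n t)) has_real_derivative 0) (at t within {0..\<tau>})"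
        by (simp add: ee)
    qed
    then have "- (exp (\<mu> m * \<tau>) * (\<epsilon> m * x n \<tau>)) = h \<bullet> e m" by (simp add: \<tau>(2) x0)
    then have "- (exp (- \<mu> m * \<tau>) * \<epsilon> m) * (- (exp (\<mu> m * \<tau>) * (\<epsilon> m * x n \<tau>))) = - (exp (- \<mu> m * \<tau>) * \<epsilon> m) * (h \<bullet> e m)"
      by simp
    moreover have "- (exp (- \<mu> m * \<tau>) * \<epsilon> m) * (- (exp (\<mu> m * \<tau>) * (\<epsilon> m * x n \<tau>))) = (exp (- \<mu> m * \<tau>) * exp (\<mu> m * \<tau>)) * (\<epsilon> m * \<epsilon> m) * x n \<tau>"
      by (simp add: mult_ac)
    ultimately have "x n \<tau> = - (exp (- \<mu> m * \<tau>) * \<epsilon> m) * (h \<bullet> e m)" by (simp add: ee flip: exp_add)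
    then show ?thesis using False m by (simp add: m_def)
  qed
  then show ?thesis by (simp add: x_def \<mu>_def \<tau>_def)
qed

end

text \<open>\<open>g\<close> drives the first coordinate, \<open>k\<close> lets it act on the second one near \<open>e 0\<close>.\<close>

locale equation_data = eigenbasis +
  fixes g k :: "real \<Rightarrow> real" and \<gamma> M L Kg Kk \<beta> \<eta> :: real
  assumes gaps: "\<And>n. lam (Suc n) - lam n \<le> 2 * M" and lam0_le: "lam 0 \<le> M"
    and g_smooth: "smooth g" and g_neg: "\<And>s. -1 \<le> s \<Longrightarrow> s \<le> 0 \<Longrightarrow> g s = lam 0 * s"
    and g_1: "g 1 = lam 0" and g'_0: "(g has_real_derivative lam 0) (at 0)"
    and g'_1: "(g has_real_derivative \<gamma>) (at 1)"
    and \<gamma>_bounds: "- M \<le> \<gamma>" "\<gamma> + (lam 1 - lam 0) \<le> M"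
    and g_lipschitz: "M-lipschitz_on UNIV g" and g_bounded: "\<And>s. \<bar>g s\<bar> \<le> Kg"
    and k_smooth: "smooth k" and k_neg: "\<And>s. s \<le> 0 \<Longrightarrow> k s = 0"
    and k_1: "k 1 = 0" and k'_0: "(k has_real_derivative 0) (at 0)" and k'_1: "(k has_real_derivative 1) (at 1)"
    and k_lipschitz: "Kk-lipschitz_on UNIV k" and k_bounded: "\<And>s. \<bar>k s\<bar> \<le> Kk"
    and \<beta>: "\<beta> > 0" and \<eta>: "\<eta> > 0" and small: "M + \<beta> * (Kk + 1) + pi * (M + \<beta>) * \<eta> \<le> L"
begin

section \<open>The two balanced pairings\<close>

lemma lam_mono: "m \<le> n \<Longrightarrow> lam m \<le> lam n"
  using mono_lam by (rule monoD)

lemma M_pos: "M > 0"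
  using lam0_le lam0_pos by simp

lemma Kk_nonneg: "Kk \<ge> 0"
  using k_bounded[of 0] by linarith

text \<open>At \<open>0\<close> the first mode is left alone and the others are paired as \<open>(1,2), (3,4), \<dots>\<close>;
  at \<open>e 0\<close> the pairs are \<open>(0,1), (2,3), \<dots>\<close>.\<close>

definition \<sigma>p :: "nat \<Rightarrow> nat" where "\<sigma>p n = (if n = 0 then 0 else if odd n then n + 1 else n - 1)"
definition \<epsilon>p :: "nat \<Rightarrow> real" where "\<epsilon>p n = (if n = 0 then 0 else if odd n then -1 else 1)"
definition dp :: "nat \<Rightarrow> real" where "dp n = (if n = 0 then lam 0 else (lam n - lam (\<sigma>p n)) / 2)"
definition \<sigma>m :: "nat \<Rightarrow> nat" where "\<sigma>m n = (if even n then n + 1 else n - 1)"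
definition \<epsilon>m :: "nat \<Rightarrow> real" where "\<epsilon>m n = (if even n then -1 else 1)"
text \<open>Here the slope of \<open>g\<close> at 1 prescribes the entry of mode 0, and balance then
  fixes the entry of mode 1.\<close>

definition dm :: "nat \<Rightarrow> real" where
  "dm n = (if n = 0 then \<gamma> else if n = 1 then \<gamma> + (lam 1 - lam 0) else (lam n - lam (\<sigma>m n)) / 2)"

definition Tp :: "'a \<Rightarrow> 'a" where "Tp = paired dp \<beta> \<epsilon>p \<sigma>p"
definition Tm :: "'a \<Rightarrow> 'a" where "Tm = paired dm \<beta> \<epsilon>m \<sigma>m"

lemma pairing_p: "pairing \<epsilon>p \<sigma>p"
  unfolding pairing_def
proof (intro allI)
  fix n
  consider "n = 0" | "odd n" | m where "n = Suc m" "odd m" by (cases n) auto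
  then show "\<sigma>p (\<sigma>p n) = n \<and> \<epsilon>p (\<sigma>p n) = - \<epsilon>p n \<and> (\<epsilon>p n)\<^sup>2 = (if \<epsilon>p n = 0 then 0 else 1)"
    by cases (auto simp: \<sigma>p_def \<epsilon>p_def odd_pos)
qed

lemma pairing_m: "pairing \<epsilon>m \<sigma>m"
  unfolding pairing_def
proof (intro allI)
  fix n
  consider "even n" | m where "n = Suc m" "even m" by (cases n) auto
  then show "\<sigma>m (\<sigma>m n) = n \<and> \<epsilon>m (\<sigma>m n) = - \<epsilon>m n \<and> (\<epsilon>m n)\<^sup>2 = (if \<epsilon>m n = 0 then 0 else 1)"
    by cases (auto simp: \<sigma>m_def \<epsilon>m_def)
qed

text \<open>Half a gap on the diagonal is the price of equal decay rates for two neighbouring modes;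
  this is where the bound \<open>2 * M\<close> on the gaps enters.\<close>

lemma half_gap_le:
  assumes "m = Suc n \<or> n = Suc m"
  shows "\<bar>(lam n - lam m) / 2\<bar> \<le> M"
  using assms gaps[of n] gaps[of m] lam_mono[of n "Suc n"] lam_mono[of m "Suc m"] by auto

lemma dp_le: "\<bar>dp n\<bar> \<le> M"
proof (cases "n = 0")
  case True
  then show ?thesis using lam0_le lam0_pos by (simp add: dp_def)
next
  case False
  then have "\<sigma>p n = Suc n \<or> n = Suc (\<sigma>p n)" by (auto simp: \<sigma>p_def)
  then show ?thesis using False half_gap_le[of "\<sigma>p n" n] by (simp add: dp_def)
qed

lemma dm_le: "\<bar>dm n\<bar> \<le> M"
proof -
  have "\<bar>\<gamma>\<bar> \<le> M" "\<bar>\<gamma> + (lam 1 - lam 0)\<bar> \<le> M" using \<gamma>_bounds lam_mono[of 0 1] by auto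
  moreover have "\<sigma>m n = Suc n \<or> n = Suc (\<sigma>m n)" by (cases n) (auto simp: \<sigma>m_def)
  ultimately show ?thesis using half_gap_le[of "\<sigma>m n" n] by (simp add: dm_def)
qed

lemma balance_p: "lam (\<sigma>p n) - dp (\<sigma>p n) = lam n - dp n"
proof -
  have "\<sigma>p n = 0 \<longleftrightarrow> n = 0" by (auto simp: \<sigma>p_def)
  then show ?thesis using pairingD(1)[OF pairing_p, of n] by (auto simp: dp_def field_simps)
qed

lemma balance_m: "lam (\<sigma>m n) - dm (\<sigma>m n) = lam n - dm n"
proof -
  consider "n = 0" | "n = 1" | "n \<ge> 2" by linarith
  then show ?thesis
  proof cases
    case 3
    then have "\<sigma>m n \<ge> 2" unfolding \<sigma>m_def by presburger
    then show ?thesis using 3 pairingD(1)[OF pairing_m, of n] by (simp add: dm_def field_simps)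
  qed (simp_all add: \<sigma>m_def dm_def)
qed

lemmas Tp = paired[where d = dp and M = M, OF pairing_p dp_le less_imp_le[OF \<beta>], folded Tp_def]
lemmas Tm = paired[where d = dm and M = M, OF pairing_m dm_le less_imp_le[OF \<beta>], folded Tm_def]

lemma linear_Tp: "linear Tp" and linear_Tm: "linear Tm"
  using Tp(2) Tm(2) by (auto intro: bounded_linear.linear)

section \<open>The nonlinearity and its Lipschitz constant\<close>

definition P :: "'a \<Rightarrow> 'a" where "P u = u - (u \<bullet> e 0) *\<^sub>R e 0"

text \<open>Equal to 1 at 0 and to 0 at 1, with values between 0 and 1 on the whole line, so that
  the two linear maps are mixed convexly everywhere.\<close>

definition \<theta> :: "real \<Rightarrow> real" where "\<theta> s = (1 + cos (pi * s)) / 2"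

text \<open>On the first axis the last two terms vanish, so the equilibria there are governed by
  \<open>g\<close> and \<open>k\<close>. Since \<open>P\<close> removes mode 0 before
  \<open>Tm\<close> acts, the action of mode 0 on modes 0 and 1 in the rotation at
  \<open>e 0\<close> has to come from \<open>g\<close> and \<open>k\<close>.\<close>

definition F :: "'a \<Rightarrow> 'a" where
  "F u = g (u \<bullet> e 0) *\<^sub>R e 0 + (\<beta> * k (u \<bullet> e 0)) *\<^sub>R e 1
     + \<theta> (u \<bullet> e 0) *\<^sub>R Tp (damp \<eta> (P u)) + (1 - \<theta> (u \<bullet> e 0)) *\<^sub>R Tm (damp \<eta> (P u))"

lemma bounded_linear_P: "bounded_linear P"
  unfolding P_def
  by (intro bounded_linear_sub bounded_linear_ident
      bounded_linear_compose[OF bounded_linear_scaleR_left] bounded_linear_inner_left)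

lemma P_orthogonal: "P u \<bullet> e 0 = 0"
  by (simp add: P_def inner_diff_left inner_e)

lemma P_e0 [simp]: "P (s *\<^sub>R e 0) = 0"
  by (simp add: P_def inner_e)

lemma norm_decompose: "(norm u)\<^sup>2 = (u \<bullet> e 0)\<^sup>2 + (norm (P u))\<^sup>2"
  by (simp add: P_def power2_norm_eq_inner inner_diff_left inner_diff_right inner_e inner_commute)
    (simp add: power2_eq_square)

lemma \<theta>_bounds: "0 \<le> \<theta> s" "\<theta> s \<le> 1"
proof -
  have "-1 \<le> cos (pi * s)" "cos (pi * s) \<le> 1" by auto
  then have "0 \<le> 1 + cos (pi * s)" "1 + cos (pi * s) \<le> 2" by linarith+
  then show "0 \<le> \<theta> s" "\<theta> s \<le> 1" by (simp_all add: \<theta>_def)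
qed

lemma DERIV_\<theta>: "(\<theta> has_real_derivative - sin (pi * s) * pi / 2) (at s)"
  unfolding \<theta>_def[abs_def] by (auto intro!: derivative_eq_intros)

lemma \<theta>_lipschitz: "\<bar>\<theta> s - \<theta> r\<bar> \<le> pi / 2 * \<bar>s - r\<bar>"
proof -
  have "(pi / 2)-lipschitz_on UNIV \<theta>"
  proof (rule lipschitz_on_DERIV[OF DERIV_\<theta>])
    show "\<bar>- sin (pi * s) * pi / 2\<bar> \<le> pi / 2" for s
      using abs_sin_le_one[of "pi * s"] by (simp add: abs_mult divide_right_mono mult_left_le_one_le)
  qed simp
  then show ?thesis using lipschitz_onD[of "pi / 2" UNIV \<theta> s r] by (simp add: dist_real_def)
qed

lemma smooth_F: "smooth F"
proof -
  have s: "smooth (\<lambda>u::'a. u \<bullet> e 0)"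
    by (intro smooth_linear bounded_linear_inner_left)
  have Pi: "smooth P"
    by (intro smooth_linear bounded_linear_P)
  have w: "smooth (\<lambda>u. exp ((- 1 / \<eta>\<^sup>2) * (P u \<bullet> P u)))"
    by (intro smooth_compose_real[OF smooth_exp]
        smooth_mult smooth_const smooth_inner Pi)
  have T: "smooth (\<lambda>u. T (damp \<eta> (P u)))" if "bounded_linear T" for T :: "'a \<Rightarrow> 'a"
  proof -
    have "(\<lambda>u. T (damp \<eta> (P u))) = (\<lambda>u. exp ((- 1 / \<eta>\<^sup>2) * (P u \<bullet> P u)) *\<^sub>R T (P u))"
      by (simp add: damp_def linear_scale[OF bounded_linear.linear[OF that]])
    then show ?thesis
      using smooth_scaleR[OF w smooth_linear[OF bounded_linear_compose[OF that bounded_linear_P]]]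
      by simp
  qed
  have c: "smooth (\<lambda>u. cos (pi * (u \<bullet> e 0)))"
    by (intro smooth_compose_real[OF smooth_cos]
        smooth_mult smooth_const s)
  have eq: "F = (\<lambda>u. g (u \<bullet> e 0) *\<^sub>R e 0 + (\<beta> * k (u \<bullet> e 0)) *\<^sub>R e 1
     + (1 / 2 + 1 / 2 * cos (pi * (u \<bullet> e 0))) *\<^sub>R Tp (damp \<eta> (P u))
     + (1 / 2 + (- 1 / 2) * cos (pi * (u \<bullet> e 0))) *\<^sub>R Tm (damp \<eta> (P u)))"
    by (rule ext) (simp add: F_def \<theta>_def add_divide_distrib)
  show ?thesis
    unfolding eq
    by (intro smooth_add smooth_scaleR smooth_mult
        smooth_const smooth_compose_real[OF g_smooth]
        smooth_compose_real[OF k_smooth] s c T Tp(2) Tm(2))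
qed

lemma norm_convex_le:
  fixes x y :: 'a
  assumes "norm x \<le> B" "norm y \<le> B"
  shows "norm (\<theta> s *\<^sub>R x + (1 - \<theta> s) *\<^sub>R y) \<le> B"
proof -
  have "norm (\<theta> s *\<^sub>R x + (1 - \<theta> s) *\<^sub>R y) \<le> \<theta> s * B + (1 - \<theta> s) * B"
    using \<theta>_bounds[of s] assms by (intro norm_triangle_mono) (auto intro!: mult_left_mono)
  then show ?thesis by (simp add: algebra_simps)
qed

lemma F_bounded: "norm (F u) \<le> Kg + \<beta> * Kk + (M + \<beta>) * \<eta>"
proof -
  have "norm (T (damp \<eta> (P u))) \<le> (M + \<beta>) * \<eta>" if "\<And>x. norm (T x) \<le> (M + \<beta>) * norm x" for T :: "'a \<Rightarrow> 'a"
    using order_trans[OF that mult_left_mono[OF norm_damp_le[OF \<eta>]]] M_pos \<beta> by simp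
  then have "norm (\<theta> (u \<bullet> e 0) *\<^sub>R Tp (damp \<eta> (P u)) + (1 - \<theta> (u \<bullet> e 0)) *\<^sub>R Tm (damp \<eta> (P u))) \<le> (M + \<beta>) * \<eta>"
    using Tp(3) Tm(3) by (intro norm_convex_le) auto
  moreover have "norm (g (u \<bullet> e 0) *\<^sub>R e 0 + (\<beta> * k (u \<bullet> e 0)) *\<^sub>R e 1) \<le> Kg + \<beta> * Kk"
    using g_bounded k_bounded \<beta> by (intro norm_triangle_mono) (auto simp: abs_mult)
  ultimately show ?thesis unfolding F_def
    by (metis (no_types, lifting) add.assoc norm_triangle_mono)
qed

lemma L_bound: "M + \<beta> \<le> L" "L > 0"
proof -
  have "0 \<le> \<beta> * Kk" "0 \<le> pi * (M + \<beta>) * \<eta>" using \<beta> \<eta> Kk_nonneg M_pos by auto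
  then show "M + \<beta> \<le> L" using small by (simp add: distrib_left)
  then show "L > 0" using M_pos \<beta> by linarith
qed

lemma Tp_lipschitz: "L-lipschitz_on UNIV Tp" and Tm_lipschitz: "L-lipschitz_on UNIV Tm"
proof -
  have *: "L-lipschitz_on UNIV T" if "linear T" "\<And>u. norm (T u) \<le> (M + \<beta>) * norm u" for T :: "'a \<Rightarrow> 'a"
  proof (rule lipschitz_onI)
    fix x y
    have "norm (T x - T y) \<le> (M + \<beta>) * norm (x - y)" using that(2)[of "x - y"] by (simp add: linear_diff[OF that(1)])
    also have "\<dots> \<le> L * norm (x - y)" using L_bound by (intro mult_right_mono) auto
    finally show "dist (T x) (T y) \<le> L * dist x y" by (simp add: dist_norm)
  qed (use L_bound in simp)
  show "L-lipschitz_on UNIV Tp" "L-lipschitz_on UNIV Tm"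
    by (rule *[OF linear_Tp Tp(3)], rule *[OF linear_Tm Tm(3)])
qed

text \<open>The diagonal parts and \<open>g\<close> act on orthogonal subspaces, so their joint constant is \<open>M\<close>
  rather than \<open>2 * M\<close>; all other contributions are small.\<close>

lemma F_lipschitz: "L-lipschitz_on UNIV F"
proof (rule lipschitz_onI)
  fix u v :: 'a
  define s r x y where "s = u \<bullet> e 0" and "r = v \<bullet> e 0" and "x = damp \<eta> (P u)" and "y = damp \<eta> (P v)"
  define D J where "D d = weighted_permutation d (\<lambda>n. n)" and "J \<epsilon> \<sigma> = weighted_permutation \<epsilon> \<sigma>" for d \<epsilon> \<sigma>
  have id: "inj (\<lambda>n::nat. n)" by (simp add: inj_on_def)
  have TD: "Tp z = D dp z + \<beta> *\<^sub>R J \<epsilon>p \<sigma>p z" "Tm z = D dm z + \<beta> *\<^sub>R J \<epsilon>m \<sigma>m z" for z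
    by (simp_all add: Tp_def Tm_def paired_def D_def J_def)
  have Dc: "D d w \<bullet> e n = d n * (w \<bullet> e n)" if "\<And>n. \<bar>d n\<bar> \<le> M" for d w n
    unfolding D_def by (rule weighted_permutation_coord[OF id that])
  define N where "N = norm (u - v)"
  have sr: "\<bar>s - r\<bar> \<le> N"
    using Cauchy_Schwarz_ineq2[of "u - v" "e 0"] by (simp add: s_def r_def N_def inner_diff_left)
  have xyP: "norm (x - y) \<le> norm (P (u - v))"
    using norm_damp_diff_le[OF \<eta>, of "P u" "P v"]
    by (simp add: x_def y_def linear_diff[OF bounded_linear.linear[OF bounded_linear_P]])
  have N2: "N\<^sup>2 = (s - r)\<^sup>2 + (norm (P (u - v)))\<^sup>2"
    using norm_decompose[of "u - v"] by (simp add: N_def s_def r_def inner_diff_left)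
  have xyN: "norm (x - y) \<le> N"
  proof (rule order_trans[OF xyP power2_le_imp_le])
    show "(norm (P (u - v)))\<^sup>2 \<le> N\<^sup>2" by (simp add: N2)
  qed (simp add: N_def)
  \<comment> \<open>The increment of the diagonal parts with the weight \<open>\<theta> s\<close>
    frozen. It stays orthogonal to \<open>e 0\<close>, which allows Pythagoras with the increment of
    \<open>g\<close>.\<close>
  define z where "z = \<theta> s *\<^sub>R D dp (x - y) + (1 - \<theta> s) *\<^sub>R D dm (x - y)"
  have zn: "norm z \<le> M * norm (x - y)"
    unfolding z_def D_def
    by (intro norm_convex_le norm_weighted_permutation_le[OF id] dp_le dm_le)
  have xy0: "(x - y) \<bullet> e 0 = 0"
    by (simp add: x_def y_def damp_def inner_diff_left P_orthogonal)
  have z0: "z \<bullet> e 0 = 0"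
    using xy0 Dc[of dp] Dc[of dm] dp_le dm_le by (simp add: z_def inner_add_left)
  have I1: "norm ((g s - g r) *\<^sub>R e 0 + z) \<le> M * N"
  proof (rule power2_le_imp_le)
    have "(norm ((g s - g r) *\<^sub>R e 0 + z))\<^sup>2 = (g s - g r)\<^sup>2 + (norm z)\<^sup>2"
      using z0 by (simp add: power2_norm_eq_inner inner_add_left inner_add_right inner_e inner_commute)
        (simp add: power2_eq_square)
    also have "\<dots> \<le> (M * \<bar>s - r\<bar>)\<^sup>2 + (M * norm (P (u - v)))\<^sup>2"
    proof (rule add_mono)
      have "\<bar>g s - g r\<bar> \<le> M * \<bar>s - r\<bar>"
        using lipschitz_onD[OF g_lipschitz, of s r] by (simp add: dist_real_def)
      then show "(g s - g r)\<^sup>2 \<le> (M * \<bar>s - r\<bar>)\<^sup>2" using power_mono[of "\<bar>g s - g r\<bar>" _ 2] by simp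
      have "norm z \<le> M * norm (P (u - v))"
        using zn mult_left_mono[OF xyP, of M] M_pos by linarith
      then show "(norm z)\<^sup>2 \<le> (M * norm (P (u - v)))\<^sup>2" by (intro power_mono) auto
    qed
    also have "\<dots> = (M * N)\<^sup>2" by (simp add: power_mult_distrib N2 distrib_left)
    finally show "(norm ((g s - g r) *\<^sub>R e 0 + z))\<^sup>2 \<le> (M * N)\<^sup>2" .
  qed (use M_pos in \<open>simp add: N_def\<close>)
  have I2: "norm ((\<beta> * (k s - k r)) *\<^sub>R e 1) \<le> \<beta> * Kk * N"
  proof -
    have "\<bar>k s - k r\<bar> \<le> Kk * \<bar>s - r\<bar>"
      using lipschitz_onD[OF k_lipschitz, of s r] by (simp add: dist_real_def)
    also have "\<dots> \<le> Kk * N" using sr Kk_nonneg by (rule mult_left_mono)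
    finally show ?thesis using \<beta> by (simp add: abs_mult)
  qed
  have I3: "norm (\<beta> *\<^sub>R (\<theta> s *\<^sub>R J \<epsilon>p \<sigma>p (x - y) + (1 - \<theta> s) *\<^sub>R J \<epsilon>m \<sigma>m (x - y))) \<le> \<beta> * N"
  proof -
    have "norm (\<theta> s *\<^sub>R J \<epsilon>p \<sigma>p (x - y) + (1 - \<theta> s) *\<^sub>R J \<epsilon>m \<sigma>m (x - y)) \<le> 1 * norm (x - y)"
      unfolding J_def
      by (intro norm_convex_le norm_weighted_permutation_le pairingD[OF pairing_p] pairingD[OF pairing_m])
    then show ?thesis using xyN \<beta> by simp
  qed
  \<comment> \<open>The change of the weight costs \<open>pi / 2\<close> per unit of
    \<open>s\<close>, but it multiplies a vector of norm at most
    \<open>2 * ((M + \<beta>) * \<eta>)\<close>, which the amplitude \<open>\<eta>\<close> makes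
    small.\<close>
  have I4: "norm ((\<theta> s - \<theta> r) *\<^sub>R (Tp y - Tm y)) \<le> pi * (M + \<beta>) * \<eta> * N"
  proof -
    have y: "norm y \<le> \<eta>" unfolding y_def by (rule norm_damp_le[OF \<eta>])
    have "norm (Tp y - Tm y) \<le> (M + \<beta>) * norm y + (M + \<beta>) * norm y"
      using norm_triangle_ineq4[of "Tp y" "Tm y"] Tp(3)[of y] Tm(3)[of y] by linarith
    also have "\<dots> \<le> 2 * ((M + \<beta>) * \<eta>)"
      using mult_left_mono[OF y, of "M + \<beta>"] M_pos \<beta> by simp
    finally have "norm (Tp y - Tm y) \<le> 2 * ((M + \<beta>) * \<eta>)" .
    moreover have "\<bar>\<theta> s - \<theta> r\<bar> \<le> pi / 2 * N"
      by (rule order_trans[OF \<theta>_lipschitz mult_left_mono[OF sr]]) simp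
    ultimately have "\<bar>\<theta> s - \<theta> r\<bar> * norm (Tp y - Tm y) \<le> pi / 2 * N * (2 * ((M + \<beta>) * \<eta>))"
      by (intro mult_mono) (auto simp: N_def)
    also have "pi / 2 * N * (2 * ((M + \<beta>) * \<eta>)) = pi * (M + \<beta>) * \<eta> * N" by (simp add: algebra_simps)
    finally show ?thesis by simp
  qed
  have "F u - F v = ((g s - g r) *\<^sub>R e 0 + z) + (\<beta> * (k s - k r)) *\<^sub>R e 1
      + \<beta> *\<^sub>R (\<theta> s *\<^sub>R J \<epsilon>p \<sigma>p (x - y) + (1 - \<theta> s) *\<^sub>R J \<epsilon>m \<sigma>m (x - y)) + (\<theta> s - \<theta> r) *\<^sub>R (Tp y - Tm y)"
  proof -
    have Fu: "F u = g s *\<^sub>R e 0 + (\<beta> * k s) *\<^sub>R e 1 + \<theta> s *\<^sub>R Tp x + (1 - \<theta> s) *\<^sub>R Tm x"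
      and Fv: "F v = g r *\<^sub>R e 0 + (\<beta> * k r) *\<^sub>R e 1 + \<theta> r *\<^sub>R Tp y + (1 - \<theta> r) *\<^sub>R Tm y"
      by (simp_all add: F_def s_def r_def x_def y_def)
    have "z + \<beta> *\<^sub>R (\<theta> s *\<^sub>R J \<epsilon>p \<sigma>p (x - y) + (1 - \<theta> s) *\<^sub>R J \<epsilon>m \<sigma>m (x - y))
        = \<theta> s *\<^sub>R Tp (x - y) + (1 - \<theta> s) *\<^sub>R Tm (x - y)"
      by (simp add: z_def TD algebra_simps)
    also have "\<dots> = \<theta> s *\<^sub>R (Tp x - Tp y) + (1 - \<theta> s) *\<^sub>R (Tm x - Tm y)"
      by (simp add: linear_diff[OF linear_Tp] linear_diff[OF linear_Tm])
    finally have "z = \<theta> s *\<^sub>R (Tp x - Tp y) + (1 - \<theta> s) *\<^sub>R (Tm x - Tm y)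
        - \<beta> *\<^sub>R (\<theta> s *\<^sub>R J \<epsilon>p \<sigma>p (x - y) + (1 - \<theta> s) *\<^sub>R J \<epsilon>m \<sigma>m (x - y))"
      by (simp add: algebra_simps)
    then show ?thesis unfolding Fu Fv by (simp add: algebra_simps)
  qed
  also have "norm \<dots> \<le> M * N + \<beta> * Kk * N + \<beta> * N + pi * (M + \<beta>) * \<eta> * N"
    by (intro norm_triangle_mono I1 I2 I3 I4)
  also have "\<dots> = (M + \<beta> * (Kk + 1) + pi * (M + \<beta>) * \<eta>) * N" by (simp add: algebra_simps)
  also have "\<dots> \<le> L * N" using small by (intro mult_right_mono) (auto simp: N_def)
  finally show "dist (F u) (F v) \<le> L * dist u v" by (simp add: dist_norm N_def)
qed (use L_bound in simp)

sublocale lipschitz_equation e lam F L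
  by unfold_locales (rule F_lipschitz, rule L_bound)

section \<open>Equilibria and linearisations\<close>

lemma F_axis: "F (s *\<^sub>R e 0) = g s *\<^sub>R e 0 + (\<beta> * k s) *\<^sub>R e 1"
  by (simp add: F_def inner_e linear_0[OF linear_Tp] linear_0[OF linear_Tm])

lemma F_equilibrium:
  assumes "-1 \<le> s \<and> s \<le> 0 \<or> s = 1"
  shows "F (s *\<^sub>R e 0) \<bullet> e n = lam n * ((s *\<^sub>R e 0) \<bullet> e n)"
  using assms by (auto simp: F_axis inner_add_left inner_e g_neg k_neg g_1 k_1)

text \<open>The derivative of \<open>\<theta>\<close> drops out, because it multiplies the damped
  displacement, which is 0 on the axis.\<close>

lemma F_derivative_axis:
  assumes "(g has_real_derivative g') (at s)" "(k has_real_derivative k') (at s)"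
  shows "(F has_derivative (\<lambda>h. (g' * (h \<bullet> e 0)) *\<^sub>R e 0 + (\<beta> * (k' * (h \<bullet> e 0))) *\<^sub>R e 1
    + \<theta> s *\<^sub>R Tp (P h) + (1 - \<theta> s) *\<^sub>R Tm (P h))) (at (s *\<^sub>R e 0))"
proof -
  define p where "p = s *\<^sub>R e 0"
  have p: "p \<bullet> e 0 = s" "P p = 0" by (simp_all add: p_def inner_e)
  have di: "((\<lambda>u. u \<bullet> e 0) has_derivative (\<lambda>h. h \<bullet> e 0)) (at p)"
    by (rule bounded_linear_imp_has_derivative[OF bounded_linear_inner_left])
  have comp: "((\<lambda>u. f (u \<bullet> e 0)) has_derivative (\<lambda>h. f' * (h \<bullet> e 0))) (at p)"
    if "(f has_real_derivative f') (at s)" for f f'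
    using has_derivative_compose[OF di] that by (simp add: has_field_derivative_def p)
  have ddamp: "((\<lambda>u. damp \<eta> (P u)) has_derivative P) (at p)"
    using has_derivative_compose[OF bounded_linear_imp_has_derivative[OF bounded_linear_P] has_derivative_damp[where v = "P p" and X = UNIV]]
    by (simp add: p)
  have dT: "((\<lambda>u. T (damp \<eta> (P u))) has_derivative (\<lambda>h. T (P h))) (at p)" if "bounded_linear T" for T :: "'a \<Rightarrow> 'a"
    by (rule bounded_linear.has_derivative[OF that ddamp])
  have "(F has_derivative (\<lambda>h. (g' * (h \<bullet> e 0)) *\<^sub>R e 0 + (\<beta> * (k' * (h \<bullet> e 0))) *\<^sub>R e 1
    + (\<theta> (p \<bullet> e 0) *\<^sub>R Tp (P h) + ((- sin (pi * s) * pi / 2) * (h \<bullet> e 0)) *\<^sub>R Tp (damp \<eta> (P p)))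
    + ((1 - \<theta> (p \<bullet> e 0)) *\<^sub>R Tm (P h) + (0 - (- sin (pi * s) * pi / 2) * (h \<bullet> e 0)) *\<^sub>R Tm (damp \<eta> (P p))))) (at p)"
    unfolding F_def[abs_def]
    by (intro has_derivative_add has_derivative_scaleR has_derivative_scaleR_left has_derivative_mult_right
        has_derivative_diff has_derivative_const comp assms DERIV_\<theta> dT Tp(2) Tm(2))
  then show ?thesis by (simp add: p linear_0[OF linear_Tp] linear_0[OF linear_Tm] flip: p_def)
qed

lemma F_derivative_0: "(F has_derivative Tp) (at 0)"
proof -
  have "(\<lambda>h. (lam 0 * (h \<bullet> e 0)) *\<^sub>R e 0 + (\<beta> * (0 * (h \<bullet> e 0))) *\<^sub>R e 1
    + \<theta> 0 *\<^sub>R Tp (P h) + (1 - \<theta> 0) *\<^sub>R Tm (P h)) = Tp"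
  proof
    fix h
    have "Tp (e 0) = lam 0 *\<^sub>R e 0"
      by (rule coord_eqI) (auto simp: Tp(1) inner_e dp_def \<epsilon>p_def \<sigma>p_def)
    then have "Tp h = (lam 0 * (h \<bullet> e 0)) *\<^sub>R e 0 + Tp (P h)"
      by (simp add: P_def linear_diff[OF linear_Tp] linear_scale[OF linear_Tp] mult.commute)
    then show "(lam 0 * (h \<bullet> e 0)) *\<^sub>R e 0 + (\<beta> * (0 * (h \<bullet> e 0))) *\<^sub>R e 1
      + \<theta> 0 *\<^sub>R Tp (P h) + (1 - \<theta> 0) *\<^sub>R Tm (P h) = Tp h"
      by (simp add: \<theta>_def)
  qed
  then show ?thesis using F_derivative_axis[OF g'_0 k'_0] by simp
qed

text \<open>\<open>Tm (e 0)\<close> equals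
  \<open>\<gamma> *\<^sub>R e 0 + \<beta> *\<^sub>R e 1\<close>: the slopes of \<open>g\<close> and
  \<open>k\<close> at 1 complete \<open>Tm\<close> in the direction that \<open>P\<close>
  removes.\<close>

lemma F_derivative_e0: "(F has_derivative Tm) (at (e 0))"
proof -
  have "(\<lambda>h. (\<gamma> * (h \<bullet> e 0)) *\<^sub>R e 0 + (\<beta> * (1 * (h \<bullet> e 0))) *\<^sub>R e 1
    + \<theta> 1 *\<^sub>R Tp (P h) + (1 - \<theta> 1) *\<^sub>R Tm (P h)) = Tm"
  proof
    fix h
    have "Tm (e 0) = \<gamma> *\<^sub>R e 0 + \<beta> *\<^sub>R e 1"
    proof (rule coord_eqI)
      fix n
      have "\<sigma>m n = 0 \<longleftrightarrow> n = 1" by (cases n) (auto simp: \<sigma>m_def odd_pos)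
      then show "Tm (e 0) \<bullet> e n = (\<gamma> *\<^sub>R e 0 + \<beta> *\<^sub>R e 1) \<bullet> e n"
        by (auto simp: Tm(1) inner_add_left inner_e dm_def \<epsilon>m_def)
    qed
    then have "Tm h = (h \<bullet> e 0) *\<^sub>R (\<gamma> *\<^sub>R e 0 + \<beta> *\<^sub>R e 1) + Tm (P h)"
      by (simp add: P_def linear_diff[OF linear_Tm] linear_scale[OF linear_Tm])
    then show "(\<gamma> * (h \<bullet> e 0)) *\<^sub>R e 0 + (\<beta> * (1 * (h \<bullet> e 0))) *\<^sub>R e 1
      + \<theta> 1 *\<^sub>R Tp (P h) + (1 - \<theta> 1) *\<^sub>R Tm (P h) = Tm h"
      by (simp add: \<theta>_def scaleR_add_right mult.commute)
  qed
  then show ?thesis using F_derivative_axis[OF g'_1 k'_1] by simp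
qed

section \<open>Quarter-turn operators and the contradiction of parities\<close>

definition \<tau> :: real where "\<tau> = pi / (2 * \<beta>)"

lemma \<tau>_pos: "\<tau> > 0"
  using \<beta> by (simp add: \<tau>_def)

text \<open>\<open>Vp\<close> annihilates mode 0, on which the linearised flow at 0 is the identity
  because \<open>dp 0 = lam 0\<close>. That mode is kept apart, so that what remains is
  antisymmetric.\<close>

definition Vp :: "'a \<Rightarrow> 'a" where "Vp = weighted_permutation (\<lambda>n. \<epsilon>p n * exp (- (lam n - dp n) * \<tau>)) \<sigma>p"
definition Vm :: "'a \<Rightarrow> 'a" where "Vm = weighted_permutation (\<lambda>n. \<epsilon>m n * exp (- (lam n - dm n) * \<tau>)) \<sigma>m"

lemma weight_le:
  assumes "\<bar>\<epsilon>\<bar> \<le> 1" "\<bar>d\<bar> \<le> M"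
  shows "\<bar>\<epsilon> * exp (- (lam n - d) * \<tau>)\<bar> \<le> exp (M * \<tau>)"
proof -
  have "- (lam n - d) * \<tau> \<le> M * \<tau>"
    using assms lam_pos[of n] \<tau>_pos by (intro mult_right_mono) auto
  then have "\<bar>\<epsilon>\<bar> * exp (- (lam n - d) * \<tau>) \<le> 1 * exp (M * \<tau>)"
    using assms by (intro mult_mono) auto
  then show ?thesis by (simp add: abs_mult)
qed

lemma Vp_weight: "\<bar>\<epsilon>p n * exp (- (lam n - dp n) * \<tau>)\<bar> \<le> exp (M * \<tau>)"
  by (rule weight_le[OF pairingD(4)[OF pairing_p] dp_le])

lemma Vm_weight: "\<bar>\<epsilon>m n * exp (- (lam n - dm n) * \<tau>)\<bar> \<le> exp (M * \<tau>)"
  by (rule weight_le[OF pairingD(4)[OF pairing_m] dm_le])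

lemma Vp_coord: "Vp u \<bullet> e n = \<epsilon>p n * exp (- (lam n - dp n) * \<tau>) * (u \<bullet> e (\<sigma>p n))"
  unfolding Vp_def by (rule weighted_permutation_coord[OF pairingD(5)[OF pairing_p]]) (rule Vp_weight)

lemma Vm_coord: "Vm u \<bullet> e n = \<epsilon>m n * exp (- (lam n - dm n) * \<tau>) * (u \<bullet> e (\<sigma>m n))"
  unfolding Vm_def by (rule weighted_permutation_coord[OF pairingD(5)[OF pairing_m]]) (rule Vm_weight)

lemma bounded_linear_Vp: "bounded_linear Vp"
  unfolding Vp_def by (rule bounded_linear_weighted_permutation[OF pairingD(5)[OF pairing_p]]) (rule Vp_weight)

lemma bounded_linear_Vm: "bounded_linear Vm"
  unfolding Vm_def by (rule bounded_linear_weighted_permutation[OF pairingD(5)[OF pairing_m]]) (rule Vm_weight)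

text \<open>Balance gives both modes of a pair the same exponential factor, and the sign changes
  within the pair.\<close>

lemma Vp_antisymmetric: "Vp u \<bullet> v = - (u \<bullet> Vp v)"
  unfolding Vp_def
  by (rule weighted_permutation_antisymmetric[OF pairingD(1)[OF pairing_p]], rule Vp_weight)
    (simp add: balance_p pairingD(2)[OF pairing_p])

lemma Vm_antisymmetric: "Vm u \<bullet> v = - (u \<bullet> Vm v)"
  unfolding Vm_def
  by (rule weighted_permutation_antisymmetric[OF pairingD(1)[OF pairing_m]], rule Vm_weight)
    (simp add: balance_m pairingD(2)[OF pairing_m])

lemma S_derivative_0: "(S \<tau> has_derivative (\<lambda>h. Vp h + (h \<bullet> e 0) *\<^sub>R e 0)) (at 0)"
proof (rule solution_semigroup_linearization[OF F_lipschitz Tp_lipschitz L_bound(2) _ F_derivative_0])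
  show "bounded_linear (\<lambda>h. Vp h + (h \<bullet> e 0) *\<^sub>R e 0)"
    by (intro bounded_linear_add bounded_linear_Vp bounded_linear_compose[OF bounded_linear_scaleR_left] bounded_linear_inner_left)
  show "F 0 \<bullet> e n = lam n * (0 \<bullet> e n)" for n using F_equilibrium[of 0] by simp
  show "solution_semigroup e lam Tp \<tau> h = Vp h + (h \<bullet> e 0) *\<^sub>R e 0" for h
  proof (rule coord_eqI)
    fix n
    have "\<epsilon>p n = 0 \<longleftrightarrow> n = 0" by (simp add: \<epsilon>p_def)
    then show "solution_semigroup e lam Tp \<tau> h \<bullet> e n = (Vp h + (h \<bullet> e 0) *\<^sub>R e 0) \<bullet> e n"
      unfolding Tp_def \<tau>_def
        paired_quarter_turn[where d = dp, OF pairing_p dp_le \<beta> balance_p Tp_lipschitz[unfolded Tp_def] L_bound(2)]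
      by (auto simp: Vp_coord inner_add_left inner_e dp_def \<tau>_def)
  qed
qed (use \<tau>_pos in simp)

lemma S_derivative_e0: "(S \<tau> has_derivative Vm) (at (e 0))"
proof (rule solution_semigroup_linearization[OF F_lipschitz Tm_lipschitz L_bound(2) _ F_derivative_e0])
  show "bounded_linear Vm" by (rule bounded_linear_Vm)
  show "F (e 0) \<bullet> e n = lam n * (e 0 \<bullet> e n)" for n using F_equilibrium[of 1] by simp
  show "solution_semigroup e lam Tm \<tau> h = Vm h" for h
  proof (rule coord_eqI)
    fix n
    show "solution_semigroup e lam Tm \<tau> h \<bullet> e n = Vm h \<bullet> e n"
      unfolding Tm_def \<tau>_def
        paired_quarter_turn[where d = dm, OF pairing_m dm_le \<beta> balance_m Tm_lipschitz[unfolded Tm_def] L_bound(2)]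
      by (simp add: Vm_coord \<epsilon>m_def \<tau>_def)
  qed
qed (use \<tau>_pos in simp)

lemma Vm_injective: "Vm x = 0 \<Longrightarrow> x = 0"
proof (rule coord_eqI)
  fix n
  assume "Vm x = 0"
  then have "Vm x \<bullet> e (\<sigma>m n) = 0" by simp
  then show "x \<bullet> e n = 0 \<bullet> e n"
    by (simp add: Vm_coord pairingD(1)[OF pairing_m]) (simp add: \<epsilon>m_def split: if_splits)
qed

lemma Vp_injective: "Vp x = 0 \<Longrightarrow> x \<bullet> e 0 = 0 \<Longrightarrow> x = 0"
proof (rule coord_eqI)
  fix n
  assume x: "Vp x = 0" "x \<bullet> e 0 = 0"
  then have "Vp x \<bullet> e (\<sigma>p n) = 0" by simp
  moreover have "\<epsilon>p (\<sigma>p n) \<noteq> 0" if "n \<noteq> 0" using that by (simp add: pairingD(2)[OF pairing_p]) (simp add: \<epsilon>p_def)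
  ultimately show "x \<bullet> e n = 0 \<bullet> e n"
    using x(2) by (cases "n = 0") (auto simp: Vp_coord pairingD(1)[OF pairing_p])
qed

lemma equilibrium: "-1 \<le> s \<and> s \<le> 0 \<or> s = 1 \<Longrightarrow> 0 \<le> t \<Longrightarrow> S t (s *\<^sub>R e 0) = s *\<^sub>R e 0"
  by (rule S_equilibrium) (rule F_equilibrium)

lemma no_invariant_submanifold:
  assumes A: "global_attractor S A" and X: "C1_submanifold n X" "invariant_set S X" "A \<subseteq> X"
  shows False
proof -
  have eqM: "s *\<^sub>R e 0 \<in> X" if "-1 \<le> s \<and> s \<le> 0 \<or> s = 1" for s
    using global_attractor_equilibrium[OF A equilibrium[OF that]] X(3) by blast
  have inv: "S \<tau> ` X \<subseteq> X"
    using X(2) \<tau>_pos unfolding invariant_set_def by simp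
  \<comment> \<open>At a fixed point the derivative of \<open>S \<tau>\<close> maps the tangent cone
    of the invariant set into itself.\<close>
  have tangent: "V z \<in> tangent_directions X p"
    if "(S \<tau> has_derivative V) (at p)" "S \<tau> p = p" "z \<in> tangent_directions X p" for V p z
  proof -
    have "V z \<in> tangent_directions (S \<tau> ` X) p" using tangent_directions_image[OF that(1,3)] that(2) by simp
    then show ?thesis using inv unfolding tangent_directions_def by blast
  qed
  have e0: "e 0 \<in> X" and zero: "0 \<in> X" using eqM[of 1] eqM[of 0] by auto
  have "even n"
  proof -
    obtain C where C: "finite C" "independent C" "card C = n" "tangent_directions X (e 0) = span C"
      using C1_submanifold_tangent_directions[OF X(1) e0] .
    have "Vm z \<in> span C" if "z \<in> span C" for z
      using tangent[OF S_derivative_e0] equilibrium[of 1] \<tau>_pos that by (simp add: C(4))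
    then have "even (card C)"
      by (intro even_dim_of_antisymmetric[OF C(1,2) bounded_linear.linear[OF bounded_linear_Vm] Vm_antisymmetric])
        (auto intro: Vm_injective)
    then show ?thesis by (simp add: C(3))
  qed
  moreover have "odd n"
  proof -
    obtain C where C: "finite C" "independent C" "card C = n" "tangent_directions X 0 = span C"
      using C1_submanifold_tangent_directions[OF X(1) zero] .
    \<comment> \<open>The segment of equilibria lies on the negative side of 0, so the cone yields
      \<open>- e 0\<close>; its being a linear span then yields \<open>e 0\<close>.\<close>
    have "- e 0 \<in> tangent_directions X 0"
    proof (rule tangent_directionsI)
      show "(- inverse (real (Suc k))) *\<^sub>R e 0 \<in> X" for k
        by (rule eqM) (simp add: field_simps)
      show "(\<lambda>k. inverse (real (Suc k))) \<longlonglongrightarrow> 0" by (rule LIMSEQ_inverse_real_of_nat)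
      show "(\<lambda>k. ((- inverse (real (Suc k))) *\<^sub>R e 0 - 0) /\<^sub>R inverse (real (Suc k))) \<longlonglongrightarrow> - e 0"
        by simp
    qed simp
    then have e0C: "e 0 \<in> span C" using span_neg[of "- e 0" C] by (simp add: C(4))
    have "Vp z \<in> span C" if z: "z \<in> span C" for z
    proof -
      have "Vp z + (z \<bullet> e 0) *\<^sub>R e 0 \<in> span C"
        using tangent[OF S_derivative_0] equilibrium[of 0] \<tau>_pos z by (simp add: C(4))
      then have "(Vp z + (z \<bullet> e 0) *\<^sub>R e 0) - (z \<bullet> e 0) *\<^sub>R e 0 \<in> span C"
        by (intro span_diff span_scale e0C)
      then show ?thesis by simp
    qed
    then have "odd (card C)"
      by (intro odd_dim_of_antisymmetric[OF C(1,2) bounded_linear.linear[OF bounded_linear_Vp] Vp_antisymmetric _ e0C])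
        (auto intro: Vp_injective simp: Vp_coord \<epsilon>p_def)
    then show ?thesis by (simp add: C(3))
  qed
  ultimately show False by blast
qed

end

section \<open>Choice of the constants\<close>

theorem theorem1p1:
  fixes e :: "nat \<Rightarrow> 'a::{real_inner,complete_space}" and lam :: "nat \<Rightarrow> real" and L :: real
  assumes spec: "spectral_data e lam"
    and gaps: "bdd_above (range (\<lambda>n. lam (Suc n) - lam n))"
    and L: "L > max ((SUP n. lam (Suc n) - lam n) / 2) (lam 0)"
  shows "\<exists>F :: 'a \<Rightarrow> 'a.
           smooth_map F \<and>
           L-lipschitz_on UNIV F \<and>
           well_posed e lam F \<and>
           (\<exists>\<A>. global_attractor (solution_semigroup e lam F) \<A> \<and>
              \<not> (\<exists>n M. C1_submanifold n M \<and>
                        invariant_set (solution_semigroup e lam F) M \<and> \<A> \<subseteq> M))"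
proof -
  interpret eigenbasis e lam by unfold_locales (rule spec)
  define L0 where "L0 = (SUP n. lam (Suc n) - lam n)"
  \<comment> \<open>\<open>M\<close> bounds \<open>g\<close> and the diagonal parts; the slack
    \<open>L - M\<close> is reserved for all other terms.\<close>
  obtain M where M: "max (L0 / 2) (lam 0) < M" "M < L" using dense L unfolding L0_def by blast
  have gap: "lam (Suc n) - lam n \<le> L0" for n
    unfolding L0_def by (rule cSUP_upper[OF _ gaps]) simp
  define d where "d = (lam 1 - lam 0) / 2"
  have d2: "2 * d = lam 1 - lam 0" by (simp add: d_def)
  have d: "0 \<le> d" "d < M" using gap[of 0] M monoD[OF mono_lam, of 0 1] by (auto simp: d_def)
  obtain g \<gamma> Kg where g: "smooth g" "\<And>s. -1 \<le> s \<Longrightarrow> s \<le> 0 \<Longrightarrow> g s = lam 0 * s" "g 1 = lam 0"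
    "(g has_real_derivative lam 0) (at 0)" "(g has_real_derivative \<gamma>) (at 1)"
    "- M \<le> \<gamma>" "\<gamma> + 2 * d \<le> M" "M-lipschitz_on UNIV g" "\<And>s. \<bar>g s\<bar> \<le> Kg"
    using exists_profile[of "lam 0" M d] lam0_pos M d by (metis max_less_iff_conj)
  obtain k :: "real \<Rightarrow> real" and Kk where k: "smooth k" "\<And>s. s \<le> 0 \<Longrightarrow> k s = 0" "k 1 = 0"
    "(k has_real_derivative 0) (at 0)" "(k has_real_derivative 1) (at 1)"
    "Kk-lipschitz_on UNIV k" "\<And>s. \<bar>k s\<bar> \<le> Kk"
    using exists_flat_bump by metis
  have Kk: "Kk \<ge> 0" using k(7)[of 0] by linarith
  \<comment> \<open>\<open>\<beta>\<close> and \<open>\<eta>\<close> spend at most half of the slack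
    each; \<open>\<beta> \<le> 1\<close> permits \<open>M + 1\<close> in place of
    \<open>M + \<beta>\<close> in the choice of \<open>\<eta>\<close>.\<close>
  define \<beta> where "\<beta> = min 1 ((L - M) / (2 * (Kk + 1)))"
  define \<eta> where "\<eta> = (L - M) / (2 * (pi * (M + 1)))"
  have M0: "M > 0" using M lam0_pos by simp
  have \<beta>: "\<beta> > 0" "\<beta> \<le> 1" "\<beta> * (Kk + 1) \<le> (L - M) / 2"
  proof -
    show "\<beta> > 0" "\<beta> \<le> 1" using M Kk by (auto simp: \<beta>_def)
    have "\<beta> * (Kk + 1) \<le> (L - M) / (2 * (Kk + 1)) * (Kk + 1)"
      using Kk by (intro mult_right_mono) (auto simp: \<beta>_def)
    also have "\<dots> = (L - M) / 2" using Kk by (simp add: field_simps)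
    finally show "\<beta> * (Kk + 1) \<le> (L - M) / 2" .
  qed
  have \<eta>: "\<eta> > 0" using M M0 by (simp add: \<eta>_def)
  have "pi * (M + \<beta>) * \<eta> \<le> pi * (M + 1) * \<eta>" using \<beta> \<eta> by simp
  also have "\<dots> = (L - M) / 2" using M0 by (simp add: \<eta>_def)
  finally have small: "M + \<beta> * (Kk + 1) + pi * (M + \<beta>) * \<eta> \<le> L" using \<beta>(3) by (simp add: field_simps)
  interpret equation_data e lam g k \<gamma> M L Kg Kk \<beta> \<eta>
  proof unfold_locales
    show "lam (Suc n) - lam n \<le> 2 * M" for n using gap[of n] M by simp
    show "\<gamma> + (lam 1 - lam 0) \<le> M" using g(7) unfolding d2 .
    show "lam 0 \<le> M" using M by simp
  qed (fact g k \<beta>(1) \<eta> small)+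
  obtain A where "global_attractor (solution_semigroup e lam F) A"
    using global_attractor_S[OF F_bounded] by blast
  then show ?thesis
    using smooth_imp_smooth_map[OF smooth_F] F_lipschitz
      lipschitz_well_posed[OF F_lipschitz L_bound(2)] no_invariant_submanifold by blast
qed

end
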